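(* Let $H$ be a Hopf algebra over a field $\Bbbk$ and let $(Q,m,u,\Delta,\varepsilon,\omega)$ be a connected coquasi-bialgebra in ${}_H^H\mathcal{YD}$. Let $\gamma:Q\otimes Q\to\Bbbk$ be a gauge transformation in ${}_H^H\mathcal{YD}$. Then $\mathrm{gr}(Q^\gamma)$ and $\mathrm{gr}(Q)$ coincide as bialgebras in ${}_H^H\mathcal{YD}$.
   Context: ${}_H^H\mathcal{YD}$ is the category of left-left Yetter-Drinfeld modules over $H$: left $H$-modules and left $H$-comodules $V$ (coaction $v\mapsto v_{-1}\otimes v_0$) with $(h_1v)_{-1}h_2\otimes(h_1v)_0=h_1v_{-1}\otimes h_2v_0$. It is monoidal (diagonal action, codiagonal coaction, unit $\Bbbk$ with trivial structures) and pre-braided by $c_{V,W}(v\otimes w)=v_{-1}w\otimes v_0$. Tensor products of coalgebras in ${}_H^H\mathcal{YD}$ have comultiplication $(C\otimes c_{C,D}\otimes D)(\Delta_C\otimes\Delta_D)$, and $*$ denotes convolution with respect to such comultiplications. A coquasi-bialgebra $(Q,m,u,\Delta,\varepsilon,\omega)$ in ${}_H^H\mathcal{YD}$ is a coalgebra $(Q,\Delta,\varepsilon)$ in ${}_H^H\mathcal{YD}$ with coalgebra morphisms $m:Q\otimes Q\to Q$, $u:\Bbbk\to Q$ in ${}_H^H\mathcal{YD}$ and a convolution invertible $\omega\in{}_H^H\mathcal{YD}(Q^{\otimes3},\Bbbk)$ such that $\omega(Q\otimes Q\otimes m)*\omega(m\otimes Q\otimes Q)=(\varepsilon\otimes\omega)*\omega(Q\otimes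 m\otimes Q)*(\omega\otimes\varepsilon)$; $\omega(Q\otimes u\otimes Q)=\omega(u\otimes Q\otimes Q)=\omega(Q\otimes Q\otimes u)=\varepsilon_{Q\otimes Q}$; $m(Q\otimes m)*\omega=\omega*m(m\otimes Q)$; $m(u\otimes Q)=\mathrm{Id}_Q=m(Q\otimes u)$. It is connected if its coradical is $Q_0=\Bbbk1_Q$, $1_Q=u(1)$. A gauge transformation for $Q$ in ${}_H^H\mathcal{YD}$ is a morphism $\gamma:Q\otimes Q\to\Bbbk$ in ${}_H^H\mathcal{YD}$ that is convolution invertible in ${}_H^H\mathcal{YD}$ and satisfies $\gamma(1_Q\otimes x)=\varepsilon(x)=\gamma(x\otimes1_Q)$. Then $Q^\gamma=(Q,m^\gamma,u,\Delta,\varepsilon,\omega^\gamma)$ with $m^\gamma=\gamma*m*\gamma^{-1}$, $\omega^\gamma=(\varepsilon\otimes\gamma)*\gamma(Q\otimes m)*\omega*\gamma^{-1}(m\otimes Q)*(\gamma^{-1}\otimes\varepsilon)$ is a coquasi-bialgebra in ${}_H^H\mathcal{YD}$. For a connected coquasi-bialgebra $Q$, $\mathrm{gr}\,Q=\bigoplus_{i\ge0}Q_i/Q_{i-1}$, where $(Q_n)$ is the coradical filtration and $Q_{-1}=0$, is the bialgebra in ${}_H^H\mathcal{YD}$ with $\Delta(x+Q_{n-1})=\sum_{0\le i\le n}(x_1+Q_{i-1})\otimes(x_2+Q_{n-i-1})$ for $x\in Q_n$, counit $\varepsilon$ in degree $0$ and zero in positive degrees, multiplication $(x+Q_{a-1})(y+Q_{b-1})=xy+Q_{a+b-1}$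 for $x\in Q_a,y\in Q_b$, unit $1_Q+Q_{-1}$, and the induced $H$-action and $H$-coaction. *)

theory Defs
  imports "HOL-Algebra.Module" "HOL-Algebra.AbelCoset"
begin

section \<open>Linear algebra over a field\<close>

text \<open>Vector spaces are the modules of HOL-Algebra over a field \<open>K\<close>.  The \<open>mult\<close> and \<open>one\<close>
  components of their records are only meaningful for the Hopf algebra \<open>H\<close> below.\<close>

definition linear_maps ::
  "('k, 'c) ring_scheme \<Rightarrow> ('k, 'a, 'd) module_scheme \<Rightarrow> ('k, 'b, 'e) module_scheme \<Rightarrow> ('a \<Rightarrow> 'b) set"
  where "linear_maps K V W = {f \<in> carrier V \<rightarrow> carrier W.
    (\<forall>x\<in>carrier V. \<forall>y\<in>carrier V. f (x \<oplus>\<^bsub>V\<^esub> y) = f x \<oplus>\<^bsub>W\<^esub> f y) \<and>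
    (\<forall>a\<in>carrier K. \<forall>x\<in>carrier V. f (a \<odot>\<^bsub>V\<^esub> x) = a \<odot>\<^bsub>W\<^esub> f x)}"

definition lin_span ::
  "('k, 'c) ring_scheme \<Rightarrow> ('k, 'a, 'd) module_scheme \<Rightarrow> 'a set \<Rightarrow> 'a set"
  where "lin_span K V S = \<Inter>{N. submodule N K V \<and> S \<subseteq> N}"

definition quotient_space :: "('k, 'a, 'd) module_scheme \<Rightarrow> 'a set \<Rightarrow> ('k, 'a set) module"
  where "quotient_space V N =
    \<lparr>carrier = a_rcosets\<^bsub>V\<^esub> N, mult = undefined, one = undefined, zero = N, add = set_add V,
     smult = (\<lambda>a X. \<Union>x\<in>X. N +>\<^bsub>V\<^esub> (a \<odot>\<^bsub>V\<^esub> x))\<rparr>"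

definition free_space :: "('k, 'c) ring_scheme \<Rightarrow> 'i set \<Rightarrow> ('k, 'i \<Rightarrow> 'k) module"
  where "free_space K S =
    \<lparr>carrier = {f. range f \<subseteq> carrier K \<and> finite {i. f i \<noteq> \<zero>\<^bsub>K\<^esub>} \<and> {i. f i \<noteq> \<zero>\<^bsub>K\<^esub>} \<subseteq> S},
     mult = undefined, one = undefined, zero = (\<lambda>_. \<zero>\<^bsub>K\<^esub>), add = (\<lambda>f g i. f i \<oplus>\<^bsub>K\<^esub> g i),
     smult = (\<lambda>a f i. a \<otimes>\<^bsub>K\<^esub> f i)\<rparr>"

definition free_basis :: "('k, 'c) ring_scheme \<Rightarrow> 'i \<Rightarrow> 'i \<Rightarrow> 'k"
  where "free_basis K i = (\<lambda>j. if j = i then \<one>\<^bsub>K\<^esub> else \<zero>\<^bsub>K\<^esub>)"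

definition direct_sum :: "(nat \<Rightarrow> ('k, 'a) module) \<Rightarrow> ('k, nat \<Rightarrow> 'a) module"
  where "direct_sum M =
    \<lparr>carrier = {f. (\<forall>n. f n \<in> carrier (M n)) \<and> finite {n. f n \<noteq> \<zero>\<^bsub>M n\<^esub>}},
     mult = undefined, one = undefined, zero = (\<lambda>n. \<zero>\<^bsub>M n\<^esub>), add = (\<lambda>f g n. f n \<oplus>\<^bsub>M n\<^esub> g n),
     smult = (\<lambda>a f n. a \<odot>\<^bsub>M n\<^esub> f n)\<rparr>"

definition direct_sum_inj :: "(nat \<Rightarrow> ('k, 'a) module) \<Rightarrow> nat \<Rightarrow> 'a \<Rightarrow> nat \<Rightarrow> 'a"
  where "direct_sum_inj M n x = (\<lambda>k. if k = n then x else \<zero>\<^bsub>M k\<^esub>)"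


section \<open>Tensor products\<close>

text \<open>\<open>V \<otimes> W\<close> is the free vector space on \<open>V \<times> W\<close> modulo the bilinearity relations.\<close>

type_synonym ('k, 'a, 'b) tens = "('a \<times> 'b \<Rightarrow> 'k) set"

definition tensor_relations ::
  "('k, 'c) ring_scheme \<Rightarrow> ('k, 'a, 'd) module_scheme \<Rightarrow> ('k, 'b, 'e) module_scheme \<Rightarrow> ('a \<times> 'b \<Rightarrow> 'k) set"
  where "tensor_relations K V W =
    (let F = free_space K (carrier V \<times> carrier W); e = (\<lambda>v w. free_basis K (v, w)) in
     lin_span K F (
       {e (x \<oplus>\<^bsub>V\<^esub> y) w \<ominus>\<^bsub>F\<^esub> (e x w \<oplus>\<^bsub>F\<^esub> e y w) | x y w.
          x \<in> carrier V \<and> y \<in> carrier V \<and> w \<in> carrier W} \<union>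
       {e v (x \<oplus>\<^bsub>W\<^esub> y) \<ominus>\<^bsub>F\<^esub> (e v x \<oplus>\<^bsub>F\<^esub> e v y) | v x y.
          v \<in> carrier V \<and> x \<in> carrier W \<and> y \<in> carrier W} \<union>
       {e (a \<odot>\<^bsub>V\<^esub> v) w \<ominus>\<^bsub>F\<^esub> (a \<odot>\<^bsub>F\<^esub> e v w) | a v w.
          a \<in> carrier K \<and> v \<in> carrier V \<and> w \<in> carrier W} \<union>
       {e v (a \<odot>\<^bsub>W\<^esub> w) \<ominus>\<^bsub>F\<^esub> (a \<odot>\<^bsub>F\<^esub> e v w) | a v w.
          a \<in> carrier K \<and> v \<in> carrier V \<and> w \<in> carrier W}))"

definition tensor ::
  "('k, 'c) ring_scheme \<Rightarrow> ('k, 'a, 'd) module_scheme \<Rightarrow> ('k, 'b, 'e) module_scheme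
    \<Rightarrow> ('k, ('k, 'a, 'b) tens) module"
  where "tensor K V W =
    quotient_space (free_space K (carrier V \<times> carrier W)) (tensor_relations K V W)"

definition pure_tensor ::
  "('k, 'c) ring_scheme \<Rightarrow> ('k, 'a, 'd) module_scheme \<Rightarrow> ('k, 'b, 'e) module_scheme
    \<Rightarrow> 'a \<Rightarrow> 'b \<Rightarrow> ('k, 'a, 'b) tens"
  where "pure_tensor K V W v w =
    tensor_relations K V W +>\<^bsub>free_space K (carrier V \<times> carrier W)\<^esub> free_basis K (v, w)"

text \<open>\<open>tensor_lift K U b\<close> is the linear map \<open>V \<otimes> W \<rightarrow> U\<close> induced by a bilinear map
  \<open>b : V \<times> W \<rightarrow> U\<close>, evaluated on any formal sum representing the given tensor.  In Sweedler
  notation \<open>tensor_lift K U b (\<Delta> x)\<close> is \<open>b x\<^sub>1 x\<^sub>2\<close>.\<close>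

definition tensor_lift ::
  "('k, 'c) ring_scheme \<Rightarrow> ('k, 'u, 'd) module_scheme \<Rightarrow> ('a \<Rightarrow> 'b \<Rightarrow> 'u) \<Rightarrow> ('k, 'a, 'b) tens \<Rightarrow> 'u"
  where "tensor_lift K U b t =
    (let f = (SOME f. f \<in> t) in
     \<Oplus>\<^bsub>U\<^esub>p\<in>{p. f p \<noteq> \<zero>\<^bsub>K\<^esub>}. f p \<odot>\<^bsub>U\<^esub> b (fst p) (snd p))"

text \<open>\<open>f \<otimes> g\<close> with codomain \<open>V \<otimes> W\<close>.\<close>

definition tensor_map ::
  "('k, 'c) ring_scheme \<Rightarrow> ('k, 'v, 'd) module_scheme \<Rightarrow> ('k, 'w, 'e) module_scheme
    \<Rightarrow> ('a \<Rightarrow> 'v) \<Rightarrow> ('b \<Rightarrow> 'w) \<Rightarrow> ('k, 'a, 'b) tens \<Rightarrow> ('k, 'v, 'w) tens"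
  where "tensor_map K V W f g =
    tensor_lift K (tensor K V W) (\<lambda>x y. pure_tensor K V W (f x) (g y))"

text \<open>The associativity constraint \<open>(U \<otimes> V) \<otimes> W \<rightarrow> U \<otimes> (V \<otimes> W)\<close>.\<close>

definition tensor_assoc ::
  "('k, 'c) ring_scheme \<Rightarrow> ('k, 'u, 'd) module_scheme \<Rightarrow> ('k, 'v, 'e) module_scheme
    \<Rightarrow> ('k, 'w, 'f) module_scheme
    \<Rightarrow> ('k, ('k, 'u, 'v) tens, 'w) tens \<Rightarrow> ('k, 'u, ('k, 'v, 'w) tens) tens"
  where "tensor_assoc K U V W =
    (let T = tensor K U (tensor K V W) in
     tensor_lift K T (\<lambda>s w. tensor_lift K T (\<lambda>u v.
       pure_tensor K U (tensor K V W) u (pure_tensor K V W v w)) s))"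

definition base_space :: "('k, 'c) ring_scheme \<Rightarrow> ('k, 'k) module"
  where "base_space K =
    \<lparr>carrier = carrier K, mult = mult K, one = one K, zero = zero K, add = add K, smult = mult K\<rparr>"


section \<open>Coalgebras, the coradical filtration and convolution\<close>

definition coalgebra ::
  "('k, 'c) ring_scheme \<Rightarrow> ('k, 'a, 'd) module_scheme \<Rightarrow> ('a \<Rightarrow> ('k, 'a, 'a) tens) \<Rightarrow> ('a \<Rightarrow> 'k) \<Rightarrow> bool"
  where "coalgebra K C \<Delta> \<epsilon> \<longleftrightarrow>
    field K \<and> module K C \<and>
    \<Delta> \<in> linear_maps K C (tensor K C C) \<and> \<epsilon> \<in> linear_maps K C (base_space K) \<and>
    (\<forall>x\<in>carrier C.
       tensor_assoc K C C C (tensor_map K (tensor K C C) C \<Delta> (\<lambda>y. y) (\<Delta> x))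
         = tensor_map K C (tensor K C C) (\<lambda>y. y) \<Delta> (\<Delta> x) \<and>
       tensor_lift K C (\<lambda>x\<^sub>1 x\<^sub>2. \<epsilon> x\<^sub>1 \<odot>\<^bsub>C\<^esub> x\<^sub>2) (\<Delta> x) = x \<and>
       tensor_lift K C (\<lambda>x\<^sub>1 x\<^sub>2. \<epsilon> x\<^sub>2 \<odot>\<^bsub>C\<^esub> x\<^sub>1) (\<Delta> x) = x)"

text \<open>The image of \<open>A \<otimes> B\<close> in \<open>C \<otimes> C\<close>, for subspaces \<open>A, B\<close> of \<open>C\<close>.\<close>

definition subtensor ::
  "('k, 'c) ring_scheme \<Rightarrow> ('k, 'a, 'd) module_scheme \<Rightarrow> 'a set \<Rightarrow> 'a set \<Rightarrow> ('k, 'a, 'a) tens set"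
  where "subtensor K C A B =
    lin_span K (tensor K C C) {pure_tensor K C C x y | x y. x \<in> A \<and> y \<in> B}"

definition subcoalgebra ::
  "('k, 'c) ring_scheme \<Rightarrow> ('k, 'a, 'd) module_scheme \<Rightarrow> ('a \<Rightarrow> ('k, 'a, 'a) tens) \<Rightarrow> 'a set \<Rightarrow> bool"
  where "subcoalgebra K C \<Delta> D \<longleftrightarrow> submodule D K C \<and> \<Delta> ` D \<subseteq> subtensor K C D D"

definition simple_subcoalgebra ::
  "('k, 'c) ring_scheme \<Rightarrow> ('k, 'a, 'd) module_scheme \<Rightarrow> ('a \<Rightarrow> ('k, 'a, 'a) tens) \<Rightarrow> 'a set \<Rightarrow> bool"
  where "simple_subcoalgebra K C \<Delta> D \<longleftrightarrow>
    subcoalgebra K C \<Delta> D \<and> D \<noteq> {\<zero>\<^bsub>C\<^esub>} \<and>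
    (\<forall>E. subcoalgebra K C \<Delta> E \<and> E \<subseteq> D \<longrightarrow> E = {\<zero>\<^bsub>C\<^esub>} \<or> E = D)"

definition coradical ::
  "('k, 'c) ring_scheme \<Rightarrow> ('k, 'a, 'd) module_scheme \<Rightarrow> ('a \<Rightarrow> ('k, 'a, 'a) tens) \<Rightarrow> 'a set"
  where "coradical K C \<Delta> = lin_span K C (\<Union>{D. simple_subcoalgebra K C \<Delta> D})"

primrec coradical_filtration ::
  "('k, 'c) ring_scheme \<Rightarrow> ('k, 'a, 'd) module_scheme \<Rightarrow> ('a \<Rightarrow> ('k, 'a, 'a) tens) \<Rightarrow> nat \<Rightarrow> 'a set"
  where
    "coradical_filtration K C \<Delta> 0 = coradical K C \<Delta>"
  | "coradical_filtration K C \<Delta> (Suc n) = {x \<in> carrier C. \<Delta> x \<in>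
       subtensor K C (carrier C) (coradical_filtration K C \<Delta> n)
         <+>\<^bsub>tensor K C C\<^esub> subtensor K C (coradical K C \<Delta>) (carrier C)}"

text \<open>The preceding filtration step \<open>C\<^bsub>n-1\<^esub>\<close>, where \<open>C\<^bsub>-1\<^esub> = 0\<close>.\<close>

definition coradical_filtration_pred ::
  "('k, 'c) ring_scheme \<Rightarrow> ('k, 'a, 'd) module_scheme \<Rightarrow> ('a \<Rightarrow> ('k, 'a, 'a) tens) \<Rightarrow> nat \<Rightarrow> 'a set"
  where "coradical_filtration_pred K C \<Delta> n =
    (case n of 0 \<Rightarrow> {\<zero>\<^bsub>C\<^esub>} | Suc m \<Rightarrow> coradical_filtration K C \<Delta> m)"


section \<open>Hopf algebras and Yetter-Drinfeld modules\<close>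

record ('k, 'h) hopf = "('k, 'h) module" +
  hcomult :: "'h \<Rightarrow> ('k, 'h, 'h) tens"
  hcounit :: "'h \<Rightarrow> 'k"
  antipode :: "'h \<Rightarrow> 'h"

definition hopf_algebra :: "('k, 'c) ring_scheme \<Rightarrow> ('k, 'h, 'd) hopf_scheme \<Rightarrow> bool"
  where "hopf_algebra K H \<longleftrightarrow>
    ring H \<and> coalgebra K H (hcomult H) (hcounit H) \<and>
    (\<forall>a\<in>carrier K. \<forall>x\<in>carrier H. \<forall>y\<in>carrier H.
       (a \<odot>\<^bsub>H\<^esub> x) \<otimes>\<^bsub>H\<^esub> y = a \<odot>\<^bsub>H\<^esub> (x \<otimes>\<^bsub>H\<^esub> y) \<and>
       x \<otimes>\<^bsub>H\<^esub> (a \<odot>\<^bsub>H\<^esub> y) = a \<odot>\<^bsub>H\<^esub> (x \<otimes>\<^bsub>H\<^esub> y)) \<and>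
    hcomult H \<one>\<^bsub>H\<^esub> = pure_tensor K H H \<one>\<^bsub>H\<^esub> \<one>\<^bsub>H\<^esub> \<and>
    (\<forall>x\<in>carrier H. \<forall>y\<in>carrier H. hcomult H (x \<otimes>\<^bsub>H\<^esub> y) =
       tensor_lift K (tensor K H H) (\<lambda>x\<^sub>1 x\<^sub>2. tensor_lift K (tensor K H H) (\<lambda>y\<^sub>1 y\<^sub>2.
         pure_tensor K H H (x\<^sub>1 \<otimes>\<^bsub>H\<^esub> y\<^sub>1) (x\<^sub>2 \<otimes>\<^bsub>H\<^esub> y\<^sub>2)) (hcomult H y)) (hcomult H x)) \<and>
    hcounit H \<one>\<^bsub>H\<^esub> = \<one>\<^bsub>K\<^esub> \<and>
    (\<forall>x\<in>carrier H. \<forall>y\<in>carrier H. hcounit H (x \<otimes>\<^bsub>H\<^esub> y) = hcounit H x \<otimes>\<^bsub>K\<^esub> hcounit H y) \<and>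
    antipode H \<in> linear_maps K H H \<and>
    (\<forall>x\<in>carrier H.
       tensor_lift K H (\<lambda>x\<^sub>1 x\<^sub>2. antipode H x\<^sub>1 \<otimes>\<^bsub>H\<^esub> x\<^sub>2) (hcomult H x) = hcounit H x \<odot>\<^bsub>H\<^esub> \<one>\<^bsub>H\<^esub> \<and>
       tensor_lift K H (\<lambda>x\<^sub>1 x\<^sub>2. x\<^sub>1 \<otimes>\<^bsub>H\<^esub> antipode H x\<^sub>2) (hcomult H x) = hcounit H x \<odot>\<^bsub>H\<^esub> \<one>\<^bsub>H\<^esub>)"

record ('k, 'h, 'v) yd_mod = "('k, 'v) module" +
  act :: "'h \<Rightarrow> 'v \<Rightarrow> 'v"
  coact :: "'v \<Rightarrow> ('k, 'h, 'v) tens"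

definition left_module ::
  "('k, 'c) ring_scheme \<Rightarrow> ('k, 'h, 'd) hopf_scheme \<Rightarrow> ('k, 'h, 'v, 'e) yd_mod_scheme \<Rightarrow> bool"
  where "left_module K H V \<longleftrightarrow>
    field K \<and> module K V \<and>
    (\<forall>h\<in>carrier H. act V h \<in> linear_maps K V V) \<and>
    (\<forall>v\<in>carrier V. (\<lambda>h. act V h v) \<in> linear_maps K H V) \<and>
    (\<forall>v\<in>carrier V. act V \<one>\<^bsub>H\<^esub> v = v) \<and>
    (\<forall>g\<in>carrier H. \<forall>h\<in>carrier H. \<forall>v\<in>carrier V. act V (g \<otimes>\<^bsub>H\<^esub> h) v = act V g (act V h v))"

definition left_comodule ::
  "('k, 'c) ring_scheme \<Rightarrow> ('k, 'h, 'd) hopf_scheme \<Rightarrow> ('k, 'h, 'v, 'e) yd_mod_scheme \<Rightarrow> bool"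
  where "left_comodule K H V \<longleftrightarrow>
    field K \<and> module K V \<and> coact V \<in> linear_maps K V (tensor K H V) \<and>
    (\<forall>v\<in>carrier V.
       tensor_assoc K H H V (tensor_map K (tensor K H H) V (hcomult H) (\<lambda>x. x) (coact V v))
         = tensor_map K H (tensor K H V) (\<lambda>x. x) (coact V) (coact V v) \<and>
       tensor_lift K V (\<lambda>a v\<^sub>0. hcounit H a \<odot>\<^bsub>V\<^esub> v\<^sub>0) (coact V v) = v)"

definition yetter_drinfeld ::
  "('k, 'c) ring_scheme \<Rightarrow> ('k, 'h, 'd) hopf_scheme \<Rightarrow> ('k, 'h, 'v, 'e) yd_mod_scheme \<Rightarrow> bool"
  where "yetter_drinfeld K H V \<longleftrightarrow>
    left_module K H V \<and> left_comodule K H V \<and>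
    (\<forall>h\<in>carrier H. \<forall>v\<in>carrier V.
       tensor_lift K (tensor K H V) (\<lambda>h\<^sub>1 h\<^sub>2. tensor_lift K (tensor K H V) (\<lambda>a w.
         pure_tensor K H V (a \<otimes>\<^bsub>H\<^esub> h\<^sub>2) w) (coact V (act V h\<^sub>1 v))) (hcomult H h)
       = tensor_lift K (tensor K H V) (\<lambda>h\<^sub>1 h\<^sub>2. tensor_lift K (tensor K H V) (\<lambda>a v\<^sub>0.
         pure_tensor K H V (h\<^sub>1 \<otimes>\<^bsub>H\<^esub> a) (act V h\<^sub>2 v\<^sub>0)) (coact V v)) (hcomult H h))"

definition yd_hom ::
  "('k, 'c) ring_scheme \<Rightarrow> ('k, 'h, 'd) hopf_scheme \<Rightarrow> ('k, 'h, 'v, 'e) yd_mod_scheme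
    \<Rightarrow> ('k, 'h, 'w, 'f) yd_mod_scheme \<Rightarrow> ('v \<Rightarrow> 'w) set"
  where "yd_hom K H V W = {f \<in> linear_maps K V W.
    (\<forall>h\<in>carrier H. \<forall>v\<in>carrier V. f (act V h v) = act W h (f v)) \<and>
    (\<forall>v\<in>carrier V. coact W (f v) = tensor_map K H W (\<lambda>x. x) f (coact V v))}"

definition yd_tensor ::
  "('k, 'c) ring_scheme \<Rightarrow> ('k, 'h, 'd) hopf_scheme \<Rightarrow> ('k, 'h, 'v, 'e) yd_mod_scheme
    \<Rightarrow> ('k, 'h, 'w, 'f) yd_mod_scheme \<Rightarrow> ('k, 'h, ('k, 'v, 'w) tens) yd_mod"
  where "yd_tensor K H V W =
    (let T = tensor K V W; HT = tensor K H T in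
     \<lparr>carrier = carrier T, mult = mult T, one = one T, zero = zero T, add = add T, smult = smult T,
      act = (\<lambda>h t. tensor_lift K T (\<lambda>h\<^sub>1 h\<^sub>2.
        tensor_map K V W (act V h\<^sub>1) (act W h\<^sub>2) t) (hcomult H h)),
      coact = tensor_lift K HT (\<lambda>v w.
          tensor_lift K HT (\<lambda>a v\<^sub>0. tensor_lift K HT (\<lambda>b w\<^sub>0.
            pure_tensor K H T (a \<otimes>\<^bsub>H\<^esub> b) (pure_tensor K V W v\<^sub>0 w\<^sub>0)) (coact W w)) (coact V v))\<rparr>)"

definition yd_braiding ::
  "('k, 'c) ring_scheme \<Rightarrow> ('k, 'h, 'd) hopf_scheme \<Rightarrow> ('k, 'h, 'v, 'e) yd_mod_scheme
    \<Rightarrow> ('k, 'h, 'w, 'f) yd_mod_scheme \<Rightarrow> ('k, 'v, 'w) tens \<Rightarrow> ('k, 'w, 'v) tens"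
  where "yd_braiding K H V W =
    tensor_lift K (tensor K W V) (\<lambda>v w.
      tensor_lift K (tensor K W V) (\<lambda>a v\<^sub>0. pure_tensor K W V (act W a w) v\<^sub>0) (coact V v))"


section \<open>Coalgebras in the category of Yetter-Drinfeld modules\<close>

record ('k, 'h, 'v) yd_coalg = "('k, 'h, 'v) yd_mod" +
  comult :: "'v \<Rightarrow> ('k, 'v, 'v) tens"
  counit :: "'v \<Rightarrow> 'k"

definition yd_unit ::
  "('k, 'c) ring_scheme \<Rightarrow> ('k, 'h, 'd) hopf_scheme \<Rightarrow> ('k, 'h, 'k) yd_coalg"
  where "yd_unit K H =
    \<lparr>carrier = carrier K, mult = mult K, one = one K, zero = zero K, add = add K, smult = mult K,
     act = (\<lambda>h a. hcounit H h \<otimes>\<^bsub>K\<^esub> a),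
     coact = (\<lambda>a. pure_tensor K H (base_space K) \<one>\<^bsub>H\<^esub> a),
     comult = (\<lambda>a. pure_tensor K (base_space K) (base_space K) a \<one>\<^bsub>K\<^esub>),
     counit = (\<lambda>a. a)\<rparr>"

definition yd_coalgebra ::
  "('k, 'c) ring_scheme \<Rightarrow> ('k, 'h, 'd) hopf_scheme \<Rightarrow> ('k, 'h, 'v, 'e) yd_coalg_scheme \<Rightarrow> bool"
  where "yd_coalgebra K H C \<longleftrightarrow>
    yetter_drinfeld K H C \<and> coalgebra K C (comult C) (counit C) \<and>
    comult C \<in> yd_hom K H C (yd_tensor K H C C) \<and> counit C \<in> yd_hom K H C (yd_unit K H)"

definition yd_coalg_tensor ::
  "('k, 'c) ring_scheme \<Rightarrow> ('k, 'h, 'd) hopf_scheme \<Rightarrow> ('k, 'h, 'v, 'e) yd_coalg_scheme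
    \<Rightarrow> ('k, 'h, 'w, 'f) yd_coalg_scheme \<Rightarrow> ('k, 'h, ('k, 'v, 'w) tens) yd_coalg"
  where "yd_coalg_tensor K H C D =
    (let T = tensor K C D; TT = tensor K T T; Y = yd_tensor K H C D in
     \<lparr>carrier = carrier Y, mult = mult Y, one = one Y, zero = zero Y, add = add Y, smult = smult Y,
      act = act Y, coact = coact Y,
      comult = tensor_lift K TT (\<lambda>x y.
          tensor_lift K TT (\<lambda>x\<^sub>1 x\<^sub>2. tensor_lift K TT (\<lambda>y\<^sub>1 y\<^sub>2.
            tensor_lift K TT (\<lambda>y' x'.
              pure_tensor K T T (pure_tensor K C D x\<^sub>1 y') (pure_tensor K C D x' y\<^sub>2))
            (yd_braiding K H C D (pure_tensor K C D x\<^sub>2 y\<^sub>1))) (comult D y)) (comult C x)),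
      counit = tensor_lift K (base_space K) (\<lambda>x y. counit C x \<otimes>\<^bsub>K\<^esub> counit D y)\<rparr>)"

definition yd_coalg_hom ::
  "('k, 'c) ring_scheme \<Rightarrow> ('k, 'h, 'd) hopf_scheme \<Rightarrow> ('k, 'h, 'v, 'e) yd_coalg_scheme
    \<Rightarrow> ('k, 'h, 'w, 'f) yd_coalg_scheme \<Rightarrow> ('v \<Rightarrow> 'w) set"
  where "yd_coalg_hom K H C D = {f \<in> yd_hom K H C D. \<forall>x\<in>carrier C.
    comult D (f x) = tensor_map K D D f f (comult C x) \<and> counit D (f x) = counit C x}"

text \<open>\<open>convolution K C U \<mu> f g\<close> is \<open>x \<mapsto> \<mu> (f x\<^sub>1) (g x\<^sub>2)\<close> for \<open>x \<in> C\<close>, where \<open>\<mu>\<close> is bilinear with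
  values in \<open>U\<close>.  Below \<open>\<mu>\<close> is the multiplication of \<open>K\<close> or a left or right scalar multiplication.\<close>

definition convolution ::
  "('k, 'c) ring_scheme \<Rightarrow> ('k, 'h, 'v, 'e) yd_coalg_scheme \<Rightarrow> ('k, 'u, 'd) module_scheme
    \<Rightarrow> ('a \<Rightarrow> 'b \<Rightarrow> 'u) \<Rightarrow> ('v \<Rightarrow> 'a) \<Rightarrow> ('v \<Rightarrow> 'b) \<Rightarrow> 'v \<Rightarrow> 'u"
  where "convolution K C U \<mu> f g = (\<lambda>x. tensor_lift K U (\<lambda>x\<^sub>1 x\<^sub>2. \<mu> (f x\<^sub>1) (g x\<^sub>2)) (comult C x))"

abbreviation scalar_convolution ::
  "('k, 'c) ring_scheme \<Rightarrow> ('k, 'h, 'v, 'e) yd_coalg_scheme \<Rightarrow> ('v \<Rightarrow> 'k) \<Rightarrow> ('v \<Rightarrow> 'k) \<Rightarrow> 'v \<Rightarrow> 'k"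
  where "scalar_convolution K C \<equiv> convolution K C (base_space K) (mult K)"

definition convolution_inverses ::
  "('k, 'c) ring_scheme \<Rightarrow> ('k, 'h, 'v, 'e) yd_coalg_scheme \<Rightarrow> ('v \<Rightarrow> 'k) \<Rightarrow> ('v \<Rightarrow> 'k) set"
  where "convolution_inverses K C f = {g \<in> linear_maps K C (base_space K). \<forall>x\<in>carrier C.
    scalar_convolution K C f g x = counit C x \<and> scalar_convolution K C g f x = counit C x}"

text \<open>Unique on the carrier of \<open>C\<close> if it exists.\<close>

definition convolution_inverse ::
  "('k, 'c) ring_scheme \<Rightarrow> ('k, 'h, 'v, 'e) yd_coalg_scheme \<Rightarrow> ('v \<Rightarrow> 'k) \<Rightarrow> 'v \<Rightarrow> 'k"
  where "convolution_inverse K C f = (SOME g. g \<in> convolution_inverses K C f)"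


section \<open>Coquasi-bialgebras and gauge transformations\<close>

text \<open>\<open>mul\<close> is the linear map \<open>m : Q \<otimes> Q \<rightarrow> Q\<close>, \<open>uni\<close> is \<open>u : K \<rightarrow> Q\<close> and \<open>reassoc\<close> is
  \<open>\<omega> : (Q \<otimes> Q) \<otimes> Q \<rightarrow> K\<close>.  The \<open>mult\<close> and \<open>one\<close> components of \<open>Q\<close> are irrelevant.  Iterated tensor
  powers of \<open>Q\<close> are bracketed to the left.\<close>

record ('k, 'h, 'v) yd_bialg = "('k, 'h, 'v) yd_coalg" +
  mul :: "('k, 'v, 'v) tens \<Rightarrow> 'v"
  uni :: "'k \<Rightarrow> 'v"

record ('k, 'h, 'v) coquasi_bialg = "('k, 'h, 'v) yd_bialg" +
  reassoc :: "('k, ('k, 'v, 'v) tens, 'v) tens \<Rightarrow> 'k"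

abbreviation one_of :: "('k, 'c) ring_scheme \<Rightarrow> ('k, 'h, 'v, 'e) yd_bialg_scheme \<Rightarrow> 'v"
  where "one_of K Q \<equiv> uni Q \<one>\<^bsub>K\<^esub>"

abbreviation tpower2 ::
  "('k, 'c) ring_scheme \<Rightarrow> ('k, 'h, 'd) hopf_scheme \<Rightarrow> ('k, 'h, 'v, 'e) yd_bialg_scheme
    \<Rightarrow> ('k, 'h, ('k, 'v, 'v) tens) yd_coalg"
  where "tpower2 K H Q \<equiv> yd_coalg_tensor K H Q Q"

abbreviation tpower3 ::
  "('k, 'c) ring_scheme \<Rightarrow> ('k, 'h, 'd) hopf_scheme \<Rightarrow> ('k, 'h, 'v, 'e) yd_bialg_scheme
    \<Rightarrow> ('k, 'h, ('k, ('k, 'v, 'v) tens, 'v) tens) yd_coalg"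
  where "tpower3 K H Q \<equiv> yd_coalg_tensor K H (tpower2 K H Q) Q"

abbreviation tpower4 ::
  "('k, 'c) ring_scheme \<Rightarrow> ('k, 'h, 'd) hopf_scheme \<Rightarrow> ('k, 'h, 'v, 'e) yd_bialg_scheme
    \<Rightarrow> ('k, 'h, ('k, ('k, ('k, 'v, 'v) tens, 'v) tens, 'v) tens) yd_coalg"
  where "tpower4 K H Q \<equiv> yd_coalg_tensor K H (tpower3 K H Q) Q"

definition coquasi_bialgebra ::
  "('k, 'c) ring_scheme \<Rightarrow> ('k, 'h, 'd) hopf_scheme \<Rightarrow> ('k, 'h, 'v, 'e) coquasi_bialg_scheme \<Rightarrow> bool"
  where "coquasi_bialgebra K H Q \<longleftrightarrow>
    (let m = mul Q; \<omega> = reassoc Q; \<epsilon> = counit Q; one = one_of K Q; KK = base_space K;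
         Q2 = tpower2 K H Q; Q3 = tpower3 K H Q; Q4 = tpower4 K H Q;
         m_id = tensor_map K Q Q m (\<lambda>x. x);
         id_m = tensor_map K Q Q (\<lambda>x. x) m \<circ> tensor_assoc K Q Q Q;
         m_id_id = tensor_map K Q2 Q m_id (\<lambda>x. x);
         id_m_id = tensor_map K Q2 Q id_m (\<lambda>x. x);
         id_id_m = tensor_map K Q2 Q (\<lambda>x. x) m \<circ> tensor_assoc K Q2 Q Q;
         \<omega>_\<epsilon> = tensor_lift K KK (\<lambda>t x. \<omega> t \<otimes>\<^bsub>K\<^esub> \<epsilon> x);
         \<epsilon>_\<omega> = tensor_lift K KK (\<lambda>t z. tensor_lift K KK (\<lambda>s y. tensor_lift K KK (\<lambda>w x.
                  \<epsilon> w \<otimes>\<^bsub>K\<^esub> \<omega> (pure_tensor K Q2 Q (pure_tensor K Q Q x y) z)) s) t)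
     in
      yd_coalgebra K H Q \<and>
      m \<in> yd_coalg_hom K H Q2 Q \<and> uni Q \<in> yd_coalg_hom K H (yd_unit K H) Q \<and>
      \<omega> \<in> yd_hom K H Q3 (yd_unit K H) \<and> convolution_inverses K Q3 \<omega> \<noteq> {} \<and>
      (\<forall>t\<in>carrier Q4.
         scalar_convolution K Q4 (\<omega> \<circ> id_id_m) (\<omega> \<circ> m_id_id) t
         = scalar_convolution K Q4 (scalar_convolution K Q4 \<epsilon>_\<omega> (\<omega> \<circ> id_m_id)) \<omega>_\<epsilon> t) \<and>
      (\<forall>x\<in>carrier Q. \<forall>y\<in>carrier Q.
         \<omega> (pure_tensor K Q2 Q (pure_tensor K Q Q x one) y) = \<epsilon> x \<otimes>\<^bsub>K\<^esub> \<epsilon> y \<and>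
         \<omega> (pure_tensor K Q2 Q (pure_tensor K Q Q one x) y) = \<epsilon> x \<otimes>\<^bsub>K\<^esub> \<epsilon> y \<and>
         \<omega> (pure_tensor K Q2 Q (pure_tensor K Q Q x y) one) = \<epsilon> x \<otimes>\<^bsub>K\<^esub> \<epsilon> y) \<and>
      (\<forall>t\<in>carrier Q3.
         convolution K Q3 Q (\<lambda>x a. a \<odot>\<^bsub>Q\<^esub> x) (m \<circ> id_m) \<omega> t
         = convolution K Q3 Q (\<lambda>a x. a \<odot>\<^bsub>Q\<^esub> x) \<omega> (m \<circ> m_id) t) \<and>
      (\<forall>x\<in>carrier Q. m (pure_tensor K Q Q one x) = x \<and> m (pure_tensor K Q Q x one) = x))"

definition connected_bialg :: "('k, 'c) ring_scheme \<Rightarrow> ('k, 'h, 'v, 'e) yd_bialg_scheme \<Rightarrow> bool"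
  where "connected_bialg K Q \<longleftrightarrow>
    coradical K Q (comult Q) = {a \<odot>\<^bsub>Q\<^esub> one_of K Q | a. a \<in> carrier K}"

definition gauge_transformation ::
  "('k, 'c) ring_scheme \<Rightarrow> ('k, 'h, 'd) hopf_scheme \<Rightarrow> ('k, 'h, 'v, 'e) yd_bialg_scheme
    \<Rightarrow> (('k, 'v, 'v) tens \<Rightarrow> 'k) \<Rightarrow> bool"
  where "gauge_transformation K H Q \<gamma> \<longleftrightarrow>
    \<gamma> \<in> yd_hom K H (tpower2 K H Q) (yd_unit K H) \<and>
    convolution_inverses K (tpower2 K H Q) \<gamma> \<inter> yd_hom K H (tpower2 K H Q) (yd_unit K H) \<noteq> {} \<and>
    (\<forall>x\<in>carrier Q. \<gamma> (pure_tensor K Q Q (one_of K Q) x) = counit Q x \<and>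
                    \<gamma> (pure_tensor K Q Q x (one_of K Q)) = counit Q x)"

text \<open>The twisted coquasi-bialgebra \<open>Q\<^sup>\<gamma>\<close>.\<close>

definition gauge_twist ::
  "('k, 'c) ring_scheme \<Rightarrow> ('k, 'h, 'd) hopf_scheme \<Rightarrow> ('k, 'h, 'v, 'e) coquasi_bialg_scheme
    \<Rightarrow> (('k, 'v, 'v) tens \<Rightarrow> 'k) \<Rightarrow> ('k, 'h, 'v, 'e) coquasi_bialg_scheme"
  where "gauge_twist K H Q \<gamma> =
    (let m = mul Q; \<omega> = reassoc Q; \<epsilon> = counit Q; KK = base_space K;
         Q2 = tpower2 K H Q; Q3 = tpower3 K H Q;
         \<gamma>' = convolution_inverse K Q2 \<gamma>;
         m_id = tensor_map K Q Q m (\<lambda>x. x);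
         id_m = tensor_map K Q Q (\<lambda>x. x) m \<circ> tensor_assoc K Q Q Q;
         \<epsilon>_\<gamma> = tensor_lift K KK (\<lambda>t z. tensor_lift K KK (\<lambda>x y.
                  \<epsilon> x \<otimes>\<^bsub>K\<^esub> \<gamma> (pure_tensor K Q Q y z)) t);
         \<gamma>'_\<epsilon> = tensor_lift K KK (\<lambda>t z. \<gamma>' t \<otimes>\<^bsub>K\<^esub> \<epsilon> z);
         conv = scalar_convolution K Q3
     in Q\<lparr>mul := convolution K Q2 Q (\<lambda>x a. a \<odot>\<^bsub>Q\<^esub> x)
                   (convolution K Q2 Q (\<lambda>a x. a \<odot>\<^bsub>Q\<^esub> x) \<gamma> m) \<gamma>',
          reassoc := conv (conv (conv (conv \<epsilon>_\<gamma> (\<gamma> \<circ> id_m)) \<omega>) (\<gamma>' \<circ> m_id)) \<gamma>'_\<epsilon>\<rparr>)"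


section \<open>The associated graded bialgebra\<close>

definition gr_component ::
  "('k, 'c) ring_scheme \<Rightarrow> ('k, 'h, 'v, 'e) yd_coalg_scheme \<Rightarrow> nat \<Rightarrow> ('k, 'v set) module"
  where "gr_component K Q n =
    quotient_space (Q\<lparr>carrier := coradical_filtration K Q (comult Q) n\<rparr>)
      (coradical_filtration_pred K Q (comult Q) n)"

text \<open>An element of \<open>gr Q\<close> is a finitely supported family \<open>f\<close> of cosets \<open>f n \<in> Q\<^sub>n / Q\<^bsub>n-1\<^esub>\<close>.\<close>

definition gr_space ::
  "('k, 'c) ring_scheme \<Rightarrow> ('k, 'h, 'v, 'e) yd_coalg_scheme \<Rightarrow> ('k, nat \<Rightarrow> 'v set) module"
  where "gr_space K Q = direct_sum (gr_component K Q)"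

text \<open>In the formulas \<open>(x\<^sub>1 + Q\<^bsub>i-1\<^esub>) \<otimes> (x\<^sub>2 + Q\<^bsub>n-i-1\<^esub>)\<close> and \<open>x\<^bsub>-1\<^esub> \<otimes> (x\<^sub>0 + Q\<^bsub>n-1\<^esub>)\<close> with \<open>x \<in> Q\<^sub>n\<close> the
  Sweedler components are arbitrary elements of \<open>Q\<close>, so that these are a priori elements of
  \<open>Q/Q\<^bsub>i-1\<^esub> \<otimes> Q/Q\<^bsub>n-i-1\<^esub>\<close> and \<open>H \<otimes> Q/Q\<^bsub>n-1\<^esub>\<close>.  The next two definitions take the elements of
  \<open>Q\<^sub>i/Q\<^bsub>i-1\<^esub> \<otimes> Q\<^bsub>n-i\<^esub>/Q\<^bsub>n-i-1\<^esub>\<close> and \<open>H \<otimes> Q\<^sub>n/Q\<^bsub>n-1\<^esub>\<close> that map to them; the inclusion of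
  \<open>Q\<^sub>i/Q\<^bsub>i-1\<^esub>\<close> into \<open>Q/Q\<^bsub>i-1\<^esub>\<close> is the identity on cosets.\<close>

definition gr_comult_component ::
  "('k, 'c) ring_scheme \<Rightarrow> ('k, 'h, 'v, 'e) yd_coalg_scheme \<Rightarrow> nat \<Rightarrow> nat \<Rightarrow> 'v set
    \<Rightarrow> ('k, 'v set, 'v set) tens"
  where "gr_comult_component K Q i j X =
    (let P = coradical_filtration_pred K Q (comult Q);
         V = quotient_space Q (P i); W = quotient_space Q (P j) in
     THE y. y \<in> carrier (tensor K (gr_component K Q i) (gr_component K Q j)) \<and>
       (\<exists>x\<in>X. tensor_map K V W (\<lambda>Y. Y) (\<lambda>Y. Y) y =
                tensor_map K V W (\<lambda>z. P i +>\<^bsub>Q\<^esub> z) (\<lambda>z. P j +>\<^bsub>Q\<^esub> z) (comult Q x)))"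

definition gr_coact_component ::
  "('k, 'c) ring_scheme \<Rightarrow> ('k, 'h, 'd) hopf_scheme \<Rightarrow> ('k, 'h, 'v, 'e) yd_coalg_scheme
    \<Rightarrow> nat \<Rightarrow> 'v set \<Rightarrow> ('k, 'h, 'v set) tens"
  where "gr_coact_component K H Q n X =
    (let P = coradical_filtration_pred K Q (comult Q);
         V = quotient_space Q (P n) in
     THE y. y \<in> carrier (tensor K H (gr_component K Q n)) \<and>
       (\<exists>x\<in>X. tensor_map K H V (\<lambda>h. h) (\<lambda>Y. Y) y =
                tensor_map K H V (\<lambda>h. h) (\<lambda>z. P n +>\<^bsub>Q\<^esub> z) (coact Q x)))"

text \<open>The structure maps are set to \<open>undefined\<close> outside their domains, so that equality of two such
  records means that the underlying vector spaces and all structure maps are equal.\<close>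

definition gr ::
  "('k, 'c) ring_scheme \<Rightarrow> ('k, 'h, 'd) hopf_scheme \<Rightarrow> ('k, 'h, 'v, 'e) yd_bialg_scheme
    \<Rightarrow> ('k, 'h, nat \<Rightarrow> 'v set) yd_bialg"
  where "gr K H Q =
    (let P = coradical_filtration_pred K Q (comult Q);
         M = gr_component K Q; G = gr_space K Q; inj = direct_sum_inj M;
         supp = (\<lambda>f. {n. f n \<noteq> \<zero>\<^bsub>M n\<^esub>})
     in \<lparr>carrier = carrier G, mult = mult G, one = one G, zero = zero G, add = add G, smult = smult G,
        act = (\<lambda>h\<in>carrier H. \<lambda>f\<in>carrier G. \<lambda>n. \<Union>x\<in>f n. P n +>\<^bsub>Q\<^esub> act Q h x),
        coact = (\<lambda>f\<in>carrier G. \<Oplus>\<^bsub>tensor K H G\<^esub>n\<in>supp f.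
          tensor_map K H G (\<lambda>h. h) (inj n) (gr_coact_component K H Q n (f n))),
        comult = (\<lambda>f\<in>carrier G. \<Oplus>\<^bsub>tensor K G G\<^esub>n\<in>supp f. \<Oplus>\<^bsub>tensor K G G\<^esub>i\<in>{..n}.
          tensor_map K G G (inj i) (inj (n - i)) (gr_comult_component K Q i (n - i) (f n))),
        counit = (\<lambda>f\<in>carrier G. counit Q (the_elem (f 0))),
        mul = (\<lambda>t\<in>carrier (tensor K G G). tensor_lift K G (\<lambda>f g n. \<Oplus>\<^bsub>M n\<^esub>a\<in>{..n}.
          (\<Union>x\<in>f a. \<Union>y\<in>g (n - a). P n +>\<^bsub>Q\<^esub> mul Q (pure_tensor K Q Q x y))) t),
        uni = (\<lambda>a\<in>carrier K. inj 0 (P 0 +>\<^bsub>Q\<^esub> uni Q a))\<rparr>)"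

end

theory Submission
  imports Defs
begin

text \<open>
  A gauge transformation changes only the product \<open>m\<close> and the reassociator, and the reassociator does
  not enter \<open>gr\<close>.  So the claim is that for \<open>x\<close> and \<open>y\<close> of filtration degrees \<open>a\<close> and \<open>b\<close> the products
  \<open>m(x \<otimes> y)\<close> and \<open>m\<^sup>\<gamma>(x \<otimes> y)\<close> agree modulo filtration degree \<open>a + b - 1\<close>.

  Let \<open>F\<^sub>n\<close> be the sum of the \<open>Q\<^sub>i \<otimes> Q\<^sub>j\<close> with \<open>i + j = n\<close>, and let \<open>z \<in> F\<^sub>n\<close>.  The comultiplication
  of \<open>Q \<otimes> Q\<close> sends \<open>z\<close> to \<open>(1 \<otimes> 1) \<otimes> z\<close> plus terms whose second factor lies in \<open>F\<^bsub>n-1\<^esub>\<close>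
  (\<open>comult_Q2_left\<close>), and also to \<open>z \<otimes> (1 \<otimes> 1)\<close> plus terms whose first factor lies in \<open>F\<^bsub>n-1\<^esub>\<close>
  (\<open>comult_Q2_right\<close>).  The first formula and induction on \<open>n\<close> give \<open>m(F\<^sub>n) \<subseteq> Q\<^sub>n\<close>
  (\<open>mul_filtration\<close>).  Since \<open>\<gamma>(1 \<otimes> 1) = 1\<close>, it follows that \<open>\<gamma> * m\<close> sends \<open>z\<close> to \<open>m(z)\<close> plus an
  element of \<open>m(F\<^bsub>n-1\<^esub>) \<subseteq> Q\<^bsub>n-1\<^esub>\<close>.  The second formula does the same for the convolution with
  \<open>\<gamma>\<^sup>-\<^sup>1\<close> from the right (\<open>twisted_product_congruent\<close>).

  The two formulas for the braided coalgebra \<open>Q \<otimes> Q\<close> rest on two properties of the coradical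
  filtration of \<open>Q\<close>.  The first one belongs to the coalgebra: as the coradical is \<open>K 1\<close>, an element
  \<open>x\<close> lies in \<open>Q\<^sub>n\<close> if and only if \<open>\<Delta> x - 1 \<otimes> x\<close> lies in \<open>Q \<otimes> Q\<^bsub>n-1\<^esub>\<close> (\<open>filtration_Suc_iff\<close>), and
  coassociativity yields the mirror image \<open>\<Delta> x - x \<otimes> 1 \<in> Q\<^bsub>n-1\<^esub> \<otimes> Q\<close> (\<open>filtration_right_defect\<close>).
  The second one controls the braiding: every \<open>Q\<^sub>n\<close> is stable under the action and the coaction of \<open>H\<close>
  (\<open>filtration_act\<close>, \<open>filtration_coact\<close>), by induction along the same criterion.

  Over a field, a tensor lies in \<open>V \<otimes> N\<close> as soon as contracting its first factor with an arbitrary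
  functional gives an element of \<open>N\<close> (\<open>tensor_span_detect_right\<close>).  This turns the mirror image and
  the stability under the coaction into statements about elements of \<open>Q\<close>, to which the criterion
  applies.
\<close>

section \<open>Linear maps, spans and quotients\<close>

lemma linear_mapsI:
  assumes "\<And>x. x \<in> carrier V \<Longrightarrow> f x \<in> carrier W"
    and "\<And>x y. x \<in> carrier V \<Longrightarrow> y \<in> carrier V \<Longrightarrow> f (x \<oplus>\<^bsub>V\<^esub> y) = f x \<oplus>\<^bsub>W\<^esub> f y"
    and "\<And>a x. a \<in> carrier K \<Longrightarrow> x \<in> carrier V \<Longrightarrow> f (a \<odot>\<^bsub>V\<^esub> x) = a \<odot>\<^bsub>W\<^esub> f x"
  shows "f \<in> linear_maps K V W"
  using assms by (auto simp: linear_maps_def)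

lemma linear_maps_closed: "f \<in> linear_maps K V W \<Longrightarrow> x \<in> carrier V \<Longrightarrow> f x \<in> carrier W"
  and linear_maps_add: "f \<in> linear_maps K V W \<Longrightarrow> x \<in> carrier V \<Longrightarrow> y \<in> carrier V \<Longrightarrow>
    f (x \<oplus>\<^bsub>V\<^esub> y) = f x \<oplus>\<^bsub>W\<^esub> f y"
  and linear_maps_smult: "f \<in> linear_maps K V W \<Longrightarrow> a \<in> carrier K \<Longrightarrow> x \<in> carrier V \<Longrightarrow>
    f (a \<odot>\<^bsub>V\<^esub> x) = a \<odot>\<^bsub>W\<^esub> f x"
  by (auto simp: linear_maps_def)

lemma linear_maps_zero:
  assumes "module K V" "module K W" "f \<in> linear_maps K V W"
  shows "f \<zero>\<^bsub>V\<^esub> = \<zero>\<^bsub>W\<^esub>"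
proof -
  interpret V: module K V by fact
  interpret W: module K W by fact
  have "f (\<zero>\<^bsub>K\<^esub> \<odot>\<^bsub>V\<^esub> \<zero>\<^bsub>V\<^esub>) = \<zero>\<^bsub>K\<^esub> \<odot>\<^bsub>W\<^esub> f \<zero>\<^bsub>V\<^esub>"
    using assms(3) by (simp add: linear_maps_smult del: V.smult_l_null V.smult_r_null)
  then show ?thesis using linear_maps_closed[OF assms(3)] by simp
qed

lemma linear_maps_diff:
  assumes "module K V" "module K W" "f \<in> linear_maps K V W" "x \<in> carrier V" "y \<in> carrier V"
  shows "f (x \<ominus>\<^bsub>V\<^esub> y) = f x \<ominus>\<^bsub>W\<^esub> f y"
proof -
  interpret V: module K V by fact
  interpret W: module K W by fact
  have "f x \<oplus>\<^bsub>W\<^esub> (\<ominus>\<^bsub>K\<^esub> \<one>\<^bsub>K\<^esub>) \<odot>\<^bsub>W\<^esub> f y = f (x \<oplus>\<^bsub>V\<^esub> (\<ominus>\<^bsub>K\<^esub> \<one>\<^bsub>K\<^esub>) \<odot>\<^bsub>V\<^esub> y)"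
    using assms by (simp add: linear_maps_add linear_maps_smult)
  then show ?thesis
    using assms linear_maps_closed[OF assms(3)]
    by (simp add: V.smult_l_minus W.smult_l_minus a_minus_def)
qed

lemma submodule_vimage:
  assumes "module K V" "module K W" "f \<in> linear_maps K V W" "submodule N K W"
  shows "submodule {x \<in> carrier V. f x \<in> N} K V"
proof -
  interpret V: module K V by fact
  interpret W: module K W by fact
  note N = W.submoduleE[OF assms(4)] and f = assms(3)
  have z: "\<zero>\<^bsub>W\<^esub> \<in> N" using submodule.axioms(1)[OF assms(4)] subgroup.one_closed by fastforce
  show ?thesis
  proof (rule V.submoduleI)
    fix a assume a: "a \<in> {x \<in> carrier V. f x \<in> N}"
    have "f (\<ominus>\<^bsub>V\<^esub> a) = (\<ominus>\<^bsub>K\<^esub> \<one>\<^bsub>K\<^esub>) \<odot>\<^bsub>W\<^esub> f a"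
      using a linear_maps_smult[OF f, of "\<ominus>\<^bsub>K\<^esub> \<one>\<^bsub>K\<^esub>" a] by (simp add: V.smult_l_minus)
    then show "\<ominus>\<^bsub>V\<^esub> a \<in> {x \<in> carrier V. f x \<in> N}" using a N by simp
  qed (use N z linear_maps_zero[OF assms(1-3)] in
        \<open>auto simp: linear_maps_add[OF f] linear_maps_smult[OF f]\<close>)
qed

lemma submodule_zero:
  assumes "module K V" shows "submodule {\<zero>\<^bsub>V\<^esub>} K V"
proof -
  interpret V: module K V by fact
  show ?thesis by (rule V.submoduleI) auto
qed

lemma submodule_zero_mem: "submodule N K V \<Longrightarrow> \<zero>\<^bsub>V\<^esub> \<in> N"
  using submodule.axioms(1) subgroup.one_closed by fastforce

lemma submodule_diff:
  assumes "module K V" "submodule N K V" "x \<in> N" "y \<in> N"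
  shows "x \<ominus>\<^bsub>V\<^esub> y \<in> N"
  using assms module.submoduleE(5,6)[OF assms(1,2)] by (simp add: a_minus_def)

lemma (in abelian_group) add_minus_cancel:
  assumes "x \<in> carrier G" "y \<in> carrier G"
  shows "y \<oplus> (x \<ominus> y) = x"
  using assms by (metis minus_closed a_comm add.inv_solve_right a_minus_def)

lemma (in abelian_group) a_inv_zero: "\<ominus> \<zero> = \<zero>"
  using l_neg[OF zero_closed] by (simp add: r_zero)

lemma (in abelian_group) minus_eq_zero_iff:
  assumes "x \<in> carrier G" "y \<in> carrier G"
  shows "x \<ominus> y = \<zero> \<longleftrightarrow> x = y"
  using add_minus_cancel[OF assms] assms by (auto simp: minus_eq r_neg)

lemma lin_span_submodule:
  assumes "module K V" "S \<subseteq> carrier V"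
  shows "submodule (lin_span K V S) K V"
proof -
  interpret V: module K V by fact
  have "carrier V \<in> {N. submodule N K V \<and> S \<subseteq> N}"
    using assms(2) V.carrier_is_submodule by auto
  then show ?thesis
    unfolding lin_span_def
    by (intro V.submoduleI)
       (auto intro: submodule_zero_mem V.submoduleE(5,6) submodule.smult_closed)
qed

lemma lin_span_incl: "x \<in> S \<Longrightarrow> x \<in> lin_span K V S"
  by (auto simp: lin_span_def)

lemma lin_span_least: "submodule N K V \<Longrightarrow> S \<subseteq> N \<Longrightarrow> lin_span K V S \<subseteq> N"
  by (auto simp: lin_span_def)

lemma lin_span_mono: "S \<subseteq> T \<Longrightarrow> lin_span K V S \<subseteq> lin_span K V T"
  by (auto simp: lin_span_def)

lemma abelian_subgroup_of_submodule:
  assumes "module K V" "submodule N K V"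
  shows "abelian_subgroup N V"
  by (meson abelian_subgroupI3 additive_subgroup.intro assms module.axioms(2) submodule.axioms(1))

lemma quotient_space_simps:
  "carrier (quotient_space V N) = a_rcosets\<^bsub>V\<^esub> N"
  "\<zero>\<^bsub>quotient_space V N\<^esub> = N"
  "X \<oplus>\<^bsub>quotient_space V N\<^esub> Y = set_add V X Y"
  "a \<odot>\<^bsub>quotient_space V N\<^esub> X = (\<Union>x\<in>X. N +>\<^bsub>V\<^esub> (a \<odot>\<^bsub>V\<^esub> x))"
  by (simp_all add: quotient_space_def)

context
  fixes K :: "('k, 'c) ring_scheme" and V :: "('k, 'v, 'd) module_scheme" and N
  assumes V: "module K V" and N: "submodule N K V"
begin

interpretation V: module K V by (rule V)
interpretation N: abelian_subgroup N V by (rule abelian_subgroup_of_submodule[OF V N])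

lemma coset_eq_iff:
  assumes "x \<in> carrier V" "y \<in> carrier V"
  shows "N +>\<^bsub>V\<^esub> x = N +>\<^bsub>V\<^esub> y \<longleftrightarrow> x \<ominus>\<^bsub>V\<^esub> y \<in> N"
proof
  assume "N +>\<^bsub>V\<^esub> x = N +>\<^bsub>V\<^esub> y"
  then show "x \<ominus>\<^bsub>V\<^esub> y \<in> N"
    using N.a_rcos_module_imp[OF assms(2), of x] N.a_rcos_self[OF assms(1)]
    by (simp add: a_minus_def)
next
  assume "x \<ominus>\<^bsub>V\<^esub> y \<in> N"
  then have "x \<in> N +>\<^bsub>V\<^esub> y" using assms N.a_rcos_module_rev by (simp add: a_minus_def)
  then show "N +>\<^bsub>V\<^esub> x = N +>\<^bsub>V\<^esub> y"
    by (rule V.a_repr_independence[OF _ assms(2) N.a_subgroup, symmetric])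
qed

lemma mem_coset_iff:
  assumes "x \<in> carrier V"
  shows "y \<in> N +>\<^bsub>V\<^esub> x \<longleftrightarrow> y \<in> carrier V \<and> y \<ominus>\<^bsub>V\<^esub> x \<in> N"
  using N.a_elemrcos_carrier[OF assms] N.a_rcos_module_imp[OF assms]
    N.a_rcos_module_rev[OF assms]
  unfolding a_minus_def by metis

lemma smult_coset:
  assumes "a \<in> carrier K" "x \<in> carrier V"
  shows "a \<odot>\<^bsub>quotient_space V N\<^esub> (N +>\<^bsub>V\<^esub> x) = N +>\<^bsub>V\<^esub> (a \<odot>\<^bsub>V\<^esub> x)"
proof -
  have eq: "N +>\<^bsub>V\<^esub> (a \<odot>\<^bsub>V\<^esub> y) = N +>\<^bsub>V\<^esub> (a \<odot>\<^bsub>V\<^esub> x)" if "y \<in> N +>\<^bsub>V\<^esub> x" for y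
  proof -
    have y: "y \<in> carrier V" "y \<ominus>\<^bsub>V\<^esub> x \<in> N" using that mem_coset_iff[OF assms(2)] by auto
    have "a \<odot>\<^bsub>V\<^esub> (y \<ominus>\<^bsub>V\<^esub> x) \<in> N" using y submodule.smult_closed[OF N assms(1)] by simp
    then show ?thesis using y assms
      by (subst coset_eq_iff) (simp_all add: a_minus_def V.smult_r_distr V.smult_r_minus)
  qed
  have "x \<in> N +>\<^bsub>V\<^esub> x" by (rule N.a_rcos_self[OF assms(2)])
  then show ?thesis unfolding quotient_space_simps using eq by blast
qed

lemma quotient_space_carrier_iff:
  "X \<in> carrier (quotient_space V N) \<longleftrightarrow> (\<exists>x\<in>carrier V. X = N +>\<^bsub>V\<^esub> x)"
  by (auto simp: quotient_space_simps A_RCOSETS_def')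

lemma module_quotient_space: "module K (quotient_space V N)"
proof -
  have zero: "N = N +>\<^bsub>V\<^esub> \<zero>\<^bsub>V\<^esub>" using N.a_subset by simp
  note sum = N.a_rcos_sum quotient_space_simps(3)
  have "abelian_group (quotient_space V N)"
  proof (rule abelian_groupI)
    fix X assume "X \<in> carrier (quotient_space V N)"
    then obtain x where x: "x \<in> carrier V" "X = N +>\<^bsub>V\<^esub> x"
      by (auto simp: quotient_space_carrier_iff)
    show "\<exists>Y\<in>carrier (quotient_space V N).
        Y \<oplus>\<^bsub>quotient_space V N\<^esub> X = \<zero>\<^bsub>quotient_space V N\<^esub>"
    proof (rule bexI)
      show "(N +>\<^bsub>V\<^esub> (\<ominus>\<^bsub>V\<^esub> x)) \<oplus>\<^bsub>quotient_space V N\<^esub> X = \<zero>\<^bsub>quotient_space V N\<^esub>"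
        unfolding x(2) sum(2) quotient_space_simps(2)
        by (subst sum(1)) (use x in \<open>simp_all add: V.l_neg zero[symmetric]\<close>)
      show "N +>\<^bsub>V\<^esub> (\<ominus>\<^bsub>V\<^esub> x) \<in> carrier (quotient_space V N)"
        unfolding quotient_space_carrier_iff using x by blast
    qed
    show "\<zero>\<^bsub>quotient_space V N\<^esub> \<oplus>\<^bsub>quotient_space V N\<^esub> X = X"
      unfolding x(2) sum(2) quotient_space_simps(2)
      by (subst (1) zero, subst sum(1)) (use x in simp_all)
  next
    show "\<zero>\<^bsub>quotient_space V N\<^esub> \<in> carrier (quotient_space V N)"
      unfolding quotient_space_carrier_iff quotient_space_simps(2)
      by (intro bexI) (rule zero, simp)
  qed (auto simp: quotient_space_carrier_iff sum V.a_ac)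
  then show ?thesis
    by (intro moduleI)
       (auto simp: V.is_cring quotient_space_carrier_iff smult_coset N.a_rcos_sum
          V.smult_l_distr V.smult_r_distr V.smult_assoc1 quotient_space_simps(3))
qed

lemma quotient_map_linear: "(\<lambda>x. N +>\<^bsub>V\<^esub> x) \<in> linear_maps K V (quotient_space V N)"
  by (rule linear_mapsI)
     (auto simp: quotient_space_carrier_iff smult_coset N.a_rcos_sum quotient_space_simps(3))

lemma coset_nonempty: "X \<in> carrier (quotient_space V N) \<Longrightarrow> X \<noteq> {}"
  using N.a_rcos_self by (auto simp: quotient_space_carrier_iff)

end

section \<open>The universal property of the tensor product\<close>

lemma free_space_simps:
  "f \<in> carrier (free_space K S) \<longleftrightarrow>
     (\<forall>i. f i \<in> carrier K) \<and> finite {i. f i \<noteq> \<zero>\<^bsub>K\<^esub>} \<and> {i. f i \<noteq> \<zero>\<^bsub>K\<^esub>} \<subseteq> S"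
  "\<zero>\<^bsub>free_space K S\<^esub> = (\<lambda>_. \<zero>\<^bsub>K\<^esub>)"
  "f \<oplus>\<^bsub>free_space K S\<^esub> g = (\<lambda>i. f i \<oplus>\<^bsub>K\<^esub> g i)"
  "a \<odot>\<^bsub>free_space K S\<^esub> f = (\<lambda>i. a \<otimes>\<^bsub>K\<^esub> f i)"
  by (auto simp: free_space_def)

lemma module_free_space:
  fixes K :: "('k, 'c) ring_scheme" and S :: "'i set"
  assumes "cring K" shows "module K (free_space K S)"
proof -
  interpret K: cring K by fact
  have add: "f \<oplus>\<^bsub>free_space K S\<^esub> g \<in> carrier (free_space K S)"
    if f: "f \<in> carrier (free_space K S)" and g: "g \<in> carrier (free_space K S)" for f g
  proof -
    have "{i. f i \<oplus>\<^bsub>K\<^esub> g i \<noteq> \<zero>\<^bsub>K\<^esub>} \<subseteq> {i. f i \<noteq> \<zero>\<^bsub>K\<^esub>} \<union> {i. g i \<noteq> \<zero>\<^bsub>K\<^esub>}"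
      by auto
    then show ?thesis using f g unfolding free_space_simps apply (intro conjI)
      subgoal by simp
      subgoal by (elim conjE) (erule finite_subset[OF _ finite_UnI])
      subgoal by blast
      done
  qed
  have smult: "a \<odot>\<^bsub>free_space K S\<^esub> f \<in> carrier (free_space K S)"
    if f: "f \<in> carrier (free_space K S)" and a: "a \<in> carrier K" for f a
  proof -
    have "{i. a \<otimes>\<^bsub>K\<^esub> f i \<noteq> \<zero>\<^bsub>K\<^esub>} \<subseteq> {i. f i \<noteq> \<zero>\<^bsub>K\<^esub>}"
      using a by auto
    then show ?thesis using f a unfolding free_space_simps apply (intro conjI)
      subgoal by simp
      subgoal by (elim conjE) (erule finite_subset)
      subgoal by blast
      done
  qed
  have car: "f i \<in> carrier K" if "f \<in> carrier (free_space K S)" for f i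
    using that by (simp add: free_space_simps(1))
  have zero: "\<zero>\<^bsub>free_space K S\<^esub> \<in> carrier (free_space K S)"
    by (simp add: free_space_simps)
  have inv: "\<exists>g\<in>carrier (free_space K S). g \<oplus>\<^bsub>free_space K S\<^esub> f = \<zero>\<^bsub>free_space K S\<^esub>"
    if f: "f \<in> carrier (free_space K S)" for f
    using smult[OF f, of "\<ominus>\<^bsub>K\<^esub> \<one>\<^bsub>K\<^esub>"] car[OF f]
    by (intro bexI[of _ "(\<ominus>\<^bsub>K\<^esub> \<one>\<^bsub>K\<^esub>) \<odot>\<^bsub>free_space K S\<^esub> f"])
       (simp_all add: free_space_simps(2-4) K.l_minus K.l_neg)
  have "abelian_group (free_space K S)"
    by (rule abelian_groupI)
       (use add zero inv in \<open>auto simp: free_space_simps(2,3) car K.a_ac\<close>)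
  then show ?thesis
    by (intro moduleI)
       (use smult in \<open>auto simp: free_space_simps(3,4) car K.l_distr K.r_distr K.m_assoc K.is_cring\<close>)
qed

lemma free_basis_closed:
  assumes "cring K" "i \<in> S" shows "free_basis K i \<in> carrier (free_space K S)"
proof -
  interpret K: cring K by fact
  have "{j. free_basis K i j \<noteq> \<zero>\<^bsub>K\<^esub>} \<subseteq> {i}" by (auto simp: free_basis_def)
  then have "finite {j. free_basis K i j \<noteq> \<zero>\<^bsub>K\<^esub>}" "{j. free_basis K i j \<noteq> \<zero>\<^bsub>K\<^esub>} \<subseteq> S"
    using assms(2) by (auto intro: rev_finite_subset)
  then show ?thesis by (simp add: free_space_simps(1)) (simp add: free_basis_def)
qed

definition bilinear_maps ::
  "('k, 'c) ring_scheme \<Rightarrow> ('k, 'v, 'd) module_scheme \<Rightarrow> ('k, 'w, 'e) module_scheme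
    \<Rightarrow> ('k, 'u, 'f) module_scheme \<Rightarrow> ('v \<Rightarrow> 'w \<Rightarrow> 'u) set"
  where "bilinear_maps K V W U =
    {b. (\<forall>v\<in>carrier V. b v \<in> linear_maps K W U) \<and>
        (\<forall>w\<in>carrier W. (\<lambda>v. b v w) \<in> linear_maps K V U)}"

lemma bilinear_mapsD:
  assumes "b \<in> bilinear_maps K V W U"
  shows "v \<in> carrier V \<Longrightarrow> b v \<in> linear_maps K W U"
    and "w \<in> carrier W \<Longrightarrow> (\<lambda>v. b v w) \<in> linear_maps K V U"
    and "v \<in> carrier V \<Longrightarrow> w \<in> carrier W \<Longrightarrow> b v w \<in> carrier U"
  using assms linear_maps_closed[of "b v" K W U w] unfolding bilinear_maps_def by simp_all

text \<open>The linear extension to formal sums of a map on the basis.\<close>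

definition free_lift ::
  "('k, 'c) ring_scheme \<Rightarrow> ('k, 'u, 'd) module_scheme \<Rightarrow> ('i \<Rightarrow> 'u) \<Rightarrow> ('i \<Rightarrow> 'k) \<Rightarrow> 'u"
  where "free_lift K U b f = (\<Oplus>\<^bsub>U\<^esub>i\<in>{i. f i \<noteq> \<zero>\<^bsub>K\<^esub>}. f i \<odot>\<^bsub>U\<^esub> b i)"

lemma free_lift_superset:
  assumes U: "module K U" and b: "\<And>i. i \<in> S \<Longrightarrow> b i \<in> carrier U"
    and f: "f \<in> carrier (free_space K S)"
    and T: "finite T" "{i. f i \<noteq> \<zero>\<^bsub>K\<^esub>} \<subseteq> T" "T \<subseteq> S"
  shows "free_lift K U b f = (\<Oplus>\<^bsub>U\<^esub>i\<in>T. f i \<odot>\<^bsub>U\<^esub> b i)"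
proof -
  interpret U: module K U by fact
  show ?thesis unfolding free_lift_def
    by (rule U.add.finprod_mono_neutral_cong_left)
       (use f T b in \<open>auto simp: free_space_simps(1)\<close>)
qed

lemma free_lift_linear:
  assumes U: "module K U" and b: "\<And>i. i \<in> S \<Longrightarrow> b i \<in> carrier U"
  shows "free_lift K U b \<in> linear_maps K (free_space K S) U"
proof -
  interpret U: module K U by fact
  interpret F: module K "free_space K S" by (rule module_free_space[OF U.is_cring])
  note sup = free_lift_superset[OF U, where S = S and b = b]
  show ?thesis
  proof (rule linear_mapsI)
    fix f assume f: "f \<in> carrier (free_space K S)"
    show "free_lift K U b f \<in> carrier U"
      unfolding free_lift_def using f b
      by (intro U.finsum_closed) (auto simp: free_space_simps)
  next
    fix f g assume f: "f \<in> carrier (free_space K S)" and g: "g \<in> carrier (free_space K S)"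
    let ?T = "{i. f i \<noteq> \<zero>\<^bsub>K\<^esub>} \<union> {i. g i \<noteq> \<zero>\<^bsub>K\<^esub>}"
    have T: "finite ?T" "?T \<subseteq> S" using f g by (auto simp: free_space_simps)
    have "{i. (f \<oplus>\<^bsub>free_space K S\<^esub> g) i \<noteq> \<zero>\<^bsub>K\<^esub>} \<subseteq> ?T" by (auto simp: free_space_simps)
    then have "free_lift K U b (f \<oplus>\<^bsub>free_space K S\<^esub> g)
        = (\<Oplus>\<^bsub>U\<^esub>i\<in>?T. (f \<oplus>\<^bsub>free_space K S\<^esub> g) i \<odot>\<^bsub>U\<^esub> b i)"
      using T f g by (intro sup b) auto
    also have "\<dots> = (\<Oplus>\<^bsub>U\<^esub>i\<in>?T. f i \<odot>\<^bsub>U\<^esub> b i \<oplus>\<^bsub>U\<^esub> g i \<odot>\<^bsub>U\<^esub> b i)"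
      using T f g b
      by (intro U.finsum_cong') (auto simp: free_space_simps U.smult_l_distr subset_iff)
    also have "\<dots> = (\<Oplus>\<^bsub>U\<^esub>i\<in>?T. f i \<odot>\<^bsub>U\<^esub> b i) \<oplus>\<^bsub>U\<^esub> (\<Oplus>\<^bsub>U\<^esub>i\<in>?T. g i \<odot>\<^bsub>U\<^esub> b i)"
      using T f g b by (intro U.finsum_addf) (auto simp: free_space_simps subset_iff)
    also have "(\<Oplus>\<^bsub>U\<^esub>i\<in>?T. f i \<odot>\<^bsub>U\<^esub> b i) = free_lift K U b f"
      using T f by (intro sup[symmetric] b) auto
    also have "(\<Oplus>\<^bsub>U\<^esub>i\<in>?T. g i \<odot>\<^bsub>U\<^esub> b i) = free_lift K U b g"
      using T g by (intro sup[symmetric] b) auto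
    finally show "free_lift K U b (f \<oplus>\<^bsub>free_space K S\<^esub> g)
        = free_lift K U b f \<oplus>\<^bsub>U\<^esub> free_lift K U b g" .
  next
    fix a f assume a: "a \<in> carrier K" and f: "f \<in> carrier (free_space K S)"
    let ?T = "{i. f i \<noteq> \<zero>\<^bsub>K\<^esub>}"
    have T: "finite ?T" "?T \<subseteq> S" using f by (auto simp: free_space_simps)
    have "free_lift K U b (a \<odot>\<^bsub>free_space K S\<^esub> f)
        = (\<Oplus>\<^bsub>U\<^esub>i\<in>?T. (a \<odot>\<^bsub>free_space K S\<^esub> f) i \<odot>\<^bsub>U\<^esub> b i)"
      using T f a
      by (intro sup b) (simp_all add: F.smult_closed, auto simp: free_space_simps)
    also have "\<dots> = (\<Oplus>\<^bsub>U\<^esub>i\<in>?T. a \<odot>\<^bsub>U\<^esub> (f i \<odot>\<^bsub>U\<^esub> b i))"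
      using T f a b
      by (intro U.finsum_cong') (auto simp: free_space_simps U.smult_assoc1 subset_iff)
    also have "\<dots> = a \<odot>\<^bsub>U\<^esub> free_lift K U b f"
      unfolding free_lift_def using T f a b
      by (intro U.finsum_smult_ldistr[symmetric]) (auto simp: free_space_simps subset_iff)
    finally show "free_lift K U b (a \<odot>\<^bsub>free_space K S\<^esub> f) = a \<odot>\<^bsub>U\<^esub> free_lift K U b f" .
  qed
qed

lemma free_lift_basis:
  assumes U: "module K U" and b: "b i \<in> carrier U"
  shows "free_lift K U b (free_basis K i) = b i"
proof -
  interpret U: module K U by fact
  have "free_lift K U b (free_basis K i) = (\<Oplus>\<^bsub>U\<^esub>j\<in>{i}. free_basis K i j \<odot>\<^bsub>U\<^esub> b j)"
    by (rule free_lift_superset[where S = "{i}", OF U])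
       (use b in \<open>auto simp: free_basis_closed U.is_cring\<close>,
        auto simp: free_basis_def split: if_splits)
  then show ?thesis using b by (simp add: free_basis_def)
qed

text \<open>Induction on the support: a formal sum is obtained from one with smaller support by adding a
  multiple of a basis vector.\<close>

lemma free_space_induct:
  assumes K: "cring K" and f: "f \<in> carrier (free_space K S)" and N: "submodule N K (free_space K S)"
    and basis: "\<And>i. i \<in> S \<Longrightarrow> free_basis K i \<in> N"
  shows "f \<in> N"
proof -
  interpret F: module K "free_space K S" by (rule module_free_space[OF K])
  interpret K: cring K by fact
  have "f \<in> carrier (free_space K S) \<Longrightarrow> {i. f i \<noteq> \<zero>\<^bsub>K\<^esub>} = T \<Longrightarrow> f \<in> N" if "finite T" for T
    using that
  proof (induction T arbitrary: f rule: finite_induct)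
    case empty
    then have "f = \<zero>\<^bsub>free_space K S\<^esub>" by (auto simp: free_space_simps)
    then show ?case using submodule_zero_mem[OF N] by simp
  next
    case (insert i T)
    define g where "g = f(i := \<zero>\<^bsub>K\<^esub>)"
    have i: "i \<in> S" "f i \<in> carrier K" using insert.prems by (auto simp: free_space_simps)
    have supp: "{j. g j \<noteq> \<zero>\<^bsub>K\<^esub>} = T" using insert unfolding g_def by (auto split: if_splits)
    then have g: "g \<in> carrier (free_space K S)"
      using insert by (auto simp: free_space_simps g_def)
    have "g \<in> N" by (rule insert.IH[OF g supp])
    moreover have "f i \<odot>\<^bsub>free_space K S\<^esub> free_basis K i \<in> N"
      using submodule.smult_closed[OF N i(2) basis[OF i(1)]] .
    moreover have "f = g \<oplus>\<^bsub>free_space K S\<^esub> f i \<odot>\<^bsub>free_space K S\<^esub> free_basis K i"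
      using insert.prems i by (auto simp: free_space_simps g_def free_basis_def)
    ultimately show ?case using F.submoduleE(5)[OF N] by metis
  qed
  then show ?thesis using f by (auto simp: free_space_simps(1))
qed

context
  fixes K :: "('k, 'c) ring_scheme" and V :: "('k, 'v, 'd) module_scheme"
    and W :: "('k, 'w, 'e) module_scheme"
  assumes V: "module K V" and W: "module K W"
begin

interpretation V: module K V by (rule V)
interpretation W: module K W by (rule W)

abbreviation (input) "FS \<equiv> free_space K (carrier V \<times> carrier W)"

interpretation F: module K FS by (rule module_free_space[OF V.is_cring])

lemma basis_pair_closed:
  "v \<in> carrier V \<Longrightarrow> w \<in> carrier W \<Longrightarrow> free_basis K (v, w) \<in> carrier FS"
  by (auto intro: free_basis_closed[OF V.is_cring])

lemma tensor_relations_submodule: "submodule (tensor_relations K V W) K FS"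
  unfolding tensor_relations_def Let_def
  by (rule lin_span_submodule[OF F.module_axioms])
     (auto intro!: basis_pair_closed F.minus_closed F.add.m_closed F.smult_closed)

lemma module_tensor: "module K (tensor K V W)"
  unfolding tensor_def
  by (rule module_quotient_space[OF F.module_axioms tensor_relations_submodule])

lemma tensor_repr_closed:
  assumes "t \<in> carrier (tensor K V W)" "f \<in> t" shows "f \<in> carrier FS"
  using assms mem_coset_iff[OF F.module_axioms tensor_relations_submodule]
    quotient_space_carrier_iff[OF F.module_axioms tensor_relations_submodule]
  unfolding tensor_def by blast

lemma tensor_nonempty: "t \<in> carrier (tensor K V W) \<Longrightarrow> t \<noteq> {}"
  unfolding tensor_def by (rule coset_nonempty[OF F.module_axioms tensor_relations_submodule])

lemma pure_tensor_bilinear: "pure_tensor K V W \<in> bilinear_maps K V W (tensor K V W)"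
proof -
  let ?R = "tensor_relations K V W"
  let ?p = "\<lambda>f. ?R +>\<^bsub>FS\<^esub> f"
  have p: "?p \<in> linear_maps K FS (tensor K V W)"
    unfolding tensor_def by (rule quotient_map_linear[OF F.module_axioms tensor_relations_submodule])
  have eq: "?p f = ?p g" if "f \<in> carrier FS" "g \<in> carrier FS" "f \<ominus>\<^bsub>FS\<^esub> g \<in> ?R" for f g
    using coset_eq_iff[OF F.module_axioms tensor_relations_submodule] that by blast
  have rel: "?p (free_basis K (x \<oplus>\<^bsub>V\<^esub> y, w))
      = ?p (free_basis K (x, w) \<oplus>\<^bsub>FS\<^esub> free_basis K (y, w))"
    "?p (free_basis K (v, z \<oplus>\<^bsub>W\<^esub> w))
      = ?p (free_basis K (v, z) \<oplus>\<^bsub>FS\<^esub> free_basis K (v, w))"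
    "?p (free_basis K (a \<odot>\<^bsub>V\<^esub> v, w)) = ?p (a \<odot>\<^bsub>FS\<^esub> free_basis K (v, w))"
    "?p (free_basis K (v, a \<odot>\<^bsub>W\<^esub> w)) = ?p (a \<odot>\<^bsub>FS\<^esub> free_basis K (v, w))"
    if v: "x \<in> carrier V" "y \<in> carrier V" "v \<in> carrier V" "w \<in> carrier W" "z \<in> carrier W"
      "a \<in> carrier K" for x y v w z a
    by (rule eq; (intro basis_pair_closed F.add.m_closed F.smult_closed V.add.m_closed
          W.add.m_closed V.smult_closed W.smult_closed v)?;
        unfold tensor_relations_def Let_def; rule lin_span_incl; use v in blast)+
  show ?thesis
    unfolding bilinear_maps_def pure_tensor_def mem_Collect_eq
    by (intro conjI ballI linear_mapsI linear_maps_closed[OF p] basis_pair_closed)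
       (simp_all only: rel(1)[OF _ _ V.zero_closed _ W.zero_closed V.R.zero_closed]
          rel(2)[OF V.zero_closed V.zero_closed _ _ _ V.R.zero_closed]
          rel(3)[OF V.zero_closed V.zero_closed _ _ W.zero_closed]
          rel(4)[OF V.zero_closed V.zero_closed _ _ W.zero_closed]
          linear_maps_add[OF p] linear_maps_smult[OF p] basis_pair_closed)
qed

lemma tensor_induct:
  assumes N: "submodule N K (tensor K V W)" and t: "t \<in> carrier (tensor K V W)"
    and "\<And>v w. v \<in> carrier V \<Longrightarrow> w \<in> carrier W \<Longrightarrow> pure_tensor K V W v w \<in> N"
  shows "t \<in> N"
proof -
  let ?p = "\<lambda>f. tensor_relations K V W +>\<^bsub>FS\<^esub> f"
  have p: "?p \<in> linear_maps K FS (tensor K V W)"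
    unfolding tensor_def by (rule quotient_map_linear[OF F.module_axioms tensor_relations_submodule])
  obtain f where f: "f \<in> carrier FS" "t = ?p f"
    using t quotient_space_carrier_iff[OF F.module_axioms tensor_relations_submodule]
    unfolding tensor_def by blast
  have "f \<in> {f \<in> carrier FS. ?p f \<in> N}"
    by (rule free_space_induct[OF V.is_cring f(1)
          submodule_vimage[OF F.module_axioms module_tensor p N]])
       (use assms(3) basis_pair_closed in \<open>auto simp: pure_tensor_def\<close>)
  then show ?thesis using f by simp
qed

context
  fixes U :: "('k, 'u, 'f) module_scheme" and b
  assumes U: "module K U" and b: "b \<in> bilinear_maps K V W U"
begin

interpretation U: module K U by (rule U)

text \<open>A bilinear map, extended linearly to formal sums, respects the relations defining the tensor
  product; hence the choice of a representative in \<open>tensor_lift\<close> is immaterial.\<close>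

lemma free_lift_kills_relations:
  assumes "f \<in> tensor_relations K V W"
  shows "free_lift K U (\<lambda>p. b (fst p) (snd p)) f = \<zero>\<^bsub>U\<^esub>"
proof -
  let ?L = "free_lift K U (\<lambda>p. b (fst p) (snd p))"
  have bc: "b v w \<in> carrier U" if "v \<in> carrier V" "w \<in> carrier W" for v w
    by (rule bilinear_mapsD(3)[OF b that])
  have L: "?L \<in> linear_maps K FS U"
    by (rule free_lift_linear[OF U]) (auto intro: bc)
  note Ldiff = linear_maps_diff[OF F.module_axioms U L]
    and Ladd = linear_maps_add[OF L] and Lsm = linear_maps_smult[OF L]
  have Lb: "?L (free_basis K (v, w)) = b v w" if "v \<in> carrier V" "w \<in> carrier W" for v w
    using free_lift_basis[OF U, where b="\<lambda>p. b (fst p) (snd p)" and i="(v,w)"] bc that by simp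
  note b_simps =
    linear_maps_add[OF bilinear_mapsD(2)[OF b]] linear_maps_smult[OF bilinear_mapsD(2)[OF b]]
    linear_maps_add[OF bilinear_mapsD(1)[OF b]] linear_maps_smult[OF bilinear_mapsD(1)[OF b]]
  have kill: "f \<ominus>\<^bsub>FS\<^esub> g \<in> {f \<in> carrier FS. ?L f \<in> {\<zero>\<^bsub>U\<^esub>}}"
    if "f \<in> carrier FS" "g \<in> carrier FS" "?L f = ?L g" for f g
    using that linear_maps_closed[OF L, of g] Ldiff[of f g]
    by (simp add: U.minus_eq_zero_iff)
  have "tensor_relations K V W \<subseteq> {f \<in> carrier FS. ?L f \<in> {\<zero>\<^bsub>U\<^esub>}}"
    unfolding tensor_relations_def Let_def
  proof (rule lin_span_least[OF submodule_vimage[OF F.module_axioms U L submodule_zero[OF U]]],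
      intro Un_least subsetI; elim CollectE exE conjE; hypsubst; rule kill)
  qed (simp_all add: basis_pair_closed Ladd Lsm Lb b_simps bc)
  then show ?thesis using assms by blast
qed

lemma tensor_lift_coset:
  assumes f: "f \<in> carrier FS"
  shows "tensor_lift K U b (tensor_relations K V W +>\<^bsub>FS\<^esub> f)
    = free_lift K U (\<lambda>p. b (fst p) (snd p)) f"
proof -
  let ?L = "free_lift K U (\<lambda>p. b (fst p) (snd p))" and ?t = "tensor_relations K V W +>\<^bsub>FS\<^esub> f"
  have bc: "b v w \<in> carrier U" if "v \<in> carrier V" "w \<in> carrier W" for v w
    by (rule bilinear_mapsD(3)[OF b that])
  have L: "?L \<in> linear_maps K FS U"
    by (rule free_lift_linear[OF U]) (auto intro: bc)
  have "f \<in> ?t"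
    using mem_coset_iff[OF F.module_axioms tensor_relations_submodule f] f
      submodule_zero_mem[OF tensor_relations_submodule] by (simp add: a_minus_def F.r_neg)
  then have "(SOME f. f \<in> ?t) \<in> ?t" by (rule someI[of "\<lambda>f. f \<in> ?t"])
  then have g: "(SOME f. f \<in> ?t) \<in> carrier FS" "(SOME f. f \<in> ?t) \<ominus>\<^bsub>FS\<^esub> f \<in> tensor_relations K V W"
    using mem_coset_iff[OF F.module_axioms tensor_relations_submodule f] by auto
  have "?L (SOME f. f \<in> ?t) \<ominus>\<^bsub>U\<^esub> ?L f = \<zero>\<^bsub>U\<^esub>"
    using free_lift_kills_relations[OF g(2)] linear_maps_diff[OF F.module_axioms U L g(1) f] by simp
  then have "?L (SOME f. f \<in> ?t) = ?L f"
    using linear_maps_closed[OF L] g(1) f by (simp add: U.minus_eq_zero_iff)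
  then show ?thesis by (simp add: tensor_lift_def Let_def free_lift_def)
qed

theorem tensor_lift_linear: "tensor_lift K U b \<in> linear_maps K (tensor K V W) U"
proof -
  let ?L = "free_lift K U (\<lambda>p. b (fst p) (snd p))"
  have bc: "b v w \<in> carrier U" if "v \<in> carrier V" "w \<in> carrier W" for v w
    by (rule bilinear_mapsD(3)[OF b that])
  have L: "?L \<in> linear_maps K FS U"
    by (rule free_lift_linear[OF U]) (auto intro: bc)
  let ?p = "\<lambda>f. tensor_relations K V W +>\<^bsub>FS\<^esub> f"
  have p: "?p \<in> linear_maps K FS (tensor K V W)"
    unfolding tensor_def by (rule quotient_map_linear[OF F.module_axioms tensor_relations_submodule])
  have repr: "\<exists>f\<in>carrier FS. t = ?p f" if "t \<in> carrier (tensor K V W)" for t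
    using that quotient_space_carrier_iff[OF F.module_axioms tensor_relations_submodule]
    unfolding tensor_def by blast
  show ?thesis
    by (rule linear_mapsI)
       (auto dest!: repr simp: tensor_lift_coset linear_maps_closed[OF L]
          linear_maps_add[OF p, symmetric] linear_maps_smult[OF p, symmetric]
          linear_maps_add[OF L] linear_maps_smult[OF L])
qed

theorem tensor_lift_pure:
  assumes "v \<in> carrier V" "w \<in> carrier W"
  shows "tensor_lift K U b (pure_tensor K V W v w) = b v w"
proof -
  note bc = bilinear_mapsD(3)[OF b assms]
  show ?thesis
    using free_lift_basis[OF U, where b="\<lambda>p. b (fst p) (snd p)" and i="(v,w)"] bc
    by (simp add: pure_tensor_def tensor_lift_coset basis_pair_closed assms)
qed

end
end

section \<open>Calculus of linear and bilinear maps\<close>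

lemma module_base_space: "cring K \<Longrightarrow> module K (base_space K)"
proof -
  assume "cring K"
  then interpret K: cring K .
  have "abelian_group (base_space K)"
    by (rule abelian_groupI) (auto simp: base_space_def K.a_ac intro: K.add.l_inv_ex)
  then show ?thesis
    by (intro moduleI) (auto simp: base_space_def K.is_cring K.l_distr K.r_distr K.m_assoc)
qed

lemma base_space_simps [simp]:
  "carrier (base_space K) = carrier K" "\<zero>\<^bsub>base_space K\<^esub> = \<zero>\<^bsub>K\<^esub>"
  "x \<oplus>\<^bsub>base_space K\<^esub> y = x \<oplus>\<^bsub>K\<^esub> y" "a \<odot>\<^bsub>base_space K\<^esub> x = a \<otimes>\<^bsub>K\<^esub> x"
  by (simp_all add: base_space_def)

lemma bilinear_mapsI:
  assumes "\<And>v. v \<in> carrier V \<Longrightarrow> (\<lambda>w. b v w) \<in> linear_maps K W U"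
    and "\<And>w. w \<in> carrier W \<Longrightarrow> (\<lambda>v. b v w) \<in> linear_maps K V U"
  shows "b \<in> bilinear_maps K V W U"
  using assms by (simp add: bilinear_maps_def)

lemma linear_minus:
  assumes U: "module K U" and f: "f \<in> linear_maps K V U" and g: "g \<in> linear_maps K V U"
  shows "(\<lambda>x. f x \<ominus>\<^bsub>U\<^esub> g x) \<in> linear_maps K V U"
proof -
  interpret U: module K U by fact
  show ?thesis
    using linear_maps_closed[OF f] linear_maps_closed[OF g]
    by (intro linear_mapsI)
       (simp_all add: linear_maps_add[OF f] linear_maps_add[OF g] linear_maps_smult[OF f]
         linear_maps_smult[OF g] U.minus_eq U.minus_add U.a_ac U.smult_r_distr U.smult_r_minus)
qed

lemma linear_ident: "(\<lambda>x. x) \<in> linear_maps K V V"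
  by (rule linear_mapsI) auto

lemma linear_comp:
  assumes "f \<in> linear_maps K V W" "g \<in> linear_maps K W U"
  shows "(\<lambda>x. g (f x)) \<in> linear_maps K V U"
  by (rule linear_mapsI)
     (simp_all add: assms linear_maps_closed[OF assms(1)] linear_maps_closed[OF assms(2)]
       linear_maps_add[OF assms(1)] linear_maps_add[OF assms(2)]
       linear_maps_smult[OF assms(1)] linear_maps_smult[OF assms(2)])

lemma linear_bilinear_left:
  assumes "b \<in> bilinear_maps K V W U" "w \<in> carrier W" "f \<in> linear_maps K X V"
  shows "(\<lambda>x. b (f x) w) \<in> linear_maps K X U"
  by (rule linear_comp[OF assms(3) bilinear_mapsD(2)[OF assms(1,2)]])

lemma linear_bilinear_right:
  assumes "b \<in> bilinear_maps K V W U" "v \<in> carrier V" "f \<in> linear_maps K X W"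
  shows "(\<lambda>x. b v (f x)) \<in> linear_maps K X U"
  by (rule linear_comp[OF assms(3) bilinear_mapsD(1)[OF assms(1,2)]])

lemmas linear_pure_left = linear_bilinear_left[OF pure_tensor_bilinear]
  and linear_pure_right = linear_bilinear_right[OF pure_tensor_bilinear]

lemma pure_tensor_closed:
  "module K V \<Longrightarrow> module K W \<Longrightarrow> v \<in> carrier V \<Longrightarrow> w \<in> carrier W \<Longrightarrow>
    pure_tensor K V W v w \<in> carrier (tensor K V W)"
  by (rule bilinear_mapsD(3)[OF pure_tensor_bilinear])

lemma smult_bilinear:
  assumes "module K V" shows "smult V \<in> bilinear_maps K (base_space K) V V"
proof -
  interpret V: module K V by fact
  show ?thesis
    by (intro bilinear_mapsI linear_mapsI)
       (auto simp: V.smult_l_distr V.smult_r_distr V.smult_assoc1[symmetric] V.R.m_comm)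
qed

lemmas linear_smult_left = linear_bilinear_left[OF smult_bilinear]
  and linear_smult_right =
    linear_bilinear_right[OF smult_bilinear, unfolded base_space_simps]

lemma mult_bilinear:
  assumes "cring K" shows "mult K \<in> bilinear_maps K (base_space K) (base_space K) (base_space K)"
  using smult_bilinear[OF module_base_space[OF assms]] by (simp add: base_space_def)

lemmas linear_mult_left = linear_bilinear_left[OF mult_bilinear, unfolded base_space_simps]
  and linear_mult_right = linear_bilinear_right[OF mult_bilinear, unfolded base_space_simps]

text \<open>The rules \<open>linear_lift_arg\<close> and \<open>linear_lift_par\<close> are the two ways in which a Sweedler
  expression can depend linearly on a variable: through the tensor that is taken apart, or through
  the expression in its components.\<close>

lemma linear_lift_arg:
  assumes "f \<in> linear_maps K X (tensor K V W)" "b \<in> bilinear_maps K V W U"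
    and "module K V" "module K W" "module K U"
  shows "(\<lambda>x. tensor_lift K U b (f x)) \<in> linear_maps K X U"
  by (rule linear_comp[OF assms(1) tensor_lift_linear[OF assms(3-5,2)]])

lemma tensor_lift_closed:
  assumes "module K V" "module K W" "module K U" "b \<in> bilinear_maps K V W U"
    and "t \<in> carrier (tensor K V W)"
  shows "tensor_lift K U b t \<in> carrier U"
  by (rule linear_maps_closed[OF tensor_lift_linear[OF assms(1-4)] assms(5)])

text \<open>Pure tensors generate, and the equaliser of two linear maps is a subspace.\<close>

lemma tensor_ext:
  assumes V: "module K V" and W: "module K W" and U: "module K U"
    and f: "f \<in> linear_maps K (tensor K V W) U" and g: "g \<in> linear_maps K (tensor K V W) U"
    and eq: "\<And>v w. v \<in> carrier V \<Longrightarrow> w \<in> carrier W \<Longrightarrow>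
      f (pure_tensor K V W v w) = g (pure_tensor K V W v w)"
    and t: "t \<in> carrier (tensor K V W)"
  shows "f t = g t"
proof -
  interpret U: module K U by fact
  note T = module_tensor[OF V W]
  have d: "(\<lambda>x. f x \<ominus>\<^bsub>U\<^esub> g x) \<in> linear_maps K (tensor K V W) U"
    by (rule linear_minus[OF U f g])
  have "t \<in> {t \<in> carrier (tensor K V W). f t \<ominus>\<^bsub>U\<^esub> g t \<in> {\<zero>\<^bsub>U\<^esub>}}"
    using linear_maps_closed[OF f] linear_maps_closed[OF g]
    by (intro tensor_induct[OF V W submodule_vimage[OF T U d submodule_zero[OF U]] t])
       (simp_all add: eq U.minus_eq_zero_iff pure_tensor_closed[OF V W])
  then show ?thesis
    using linear_maps_closed[OF f t] linear_maps_closed[OF g t] U.minus_eq_zero_iff by simp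
qed

lemma linear_lift_par:
  assumes t: "t \<in> carrier (tensor K V W)"
    and B: "\<And>x. x \<in> carrier X \<Longrightarrow> B x \<in> bilinear_maps K V W U"
    and lin: "\<And>v w. v \<in> carrier V \<Longrightarrow> w \<in> carrier W \<Longrightarrow> (\<lambda>x. B x v w) \<in> linear_maps K X U"
    and V: "module K V" and W: "module K W" and U: "module K U" and X: "module K X"
  shows "(\<lambda>x. tensor_lift K U (B x) t) \<in> linear_maps K X U"
proof -
  interpret U: module K U by fact
  interpret X: module K X by fact
  note LC = tensor_lift_closed[OF V W U B] and LL = tensor_lift_linear[OF V W U B]
    and LP = tensor_lift_pure[OF V W U B]
  have add: "(\<lambda>s. tensor_lift K U (B x) s \<oplus>\<^bsub>U\<^esub> tensor_lift K U (B y) s)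
      \<in> linear_maps K (tensor K V W) U" if "x \<in> carrier X" "y \<in> carrier X" for x y
    using that by (intro linear_mapsI)
      (simp_all add: LC linear_maps_add[OF LL] linear_maps_smult[OF LL] U.a_ac U.smult_r_distr)
  have smult: "(\<lambda>s. a \<odot>\<^bsub>U\<^esub> tensor_lift K U (B x) s) \<in> linear_maps K (tensor K V W) U"
    if "x \<in> carrier X" "a \<in> carrier K" for x a
    using that by (intro linear_smult_right LL U)
  show ?thesis
  proof (rule linear_mapsI)
    fix x assume "x \<in> carrier X"
    then show "tensor_lift K U (B x) t \<in> carrier U" by (rule LC[OF _ t])
  next
    fix x y assume "x \<in> carrier X" "y \<in> carrier X"
    then show "tensor_lift K U (B (x \<oplus>\<^bsub>X\<^esub> y)) t
        = tensor_lift K U (B x) t \<oplus>\<^bsub>U\<^esub> tensor_lift K U (B y) t"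
      by (intro tensor_ext[OF V W U LL add _ t]) (simp_all add: LP linear_maps_add[OF lin])
  next
    fix a x assume "a \<in> carrier K" "x \<in> carrier X"
    then show "tensor_lift K U (B (a \<odot>\<^bsub>X\<^esub> x)) t = a \<odot>\<^bsub>U\<^esub> tensor_lift K U (B x) t"
      by (intro tensor_ext[OF V W U LL smult _ t]) (simp_all add: LP linear_maps_smult[OF lin])
  qed
qed

text \<open>The image of \<open>A \<otimes> B\<close> in \<open>V \<otimes> W\<close> if \<open>A\<close> and \<open>B\<close> are subspaces.  Arbitrary sets are allowed, because
  below \<open>A\<close> or \<open>B\<close> is often only a generating set.\<close>

definition tensor_span ::
  "('k, 'c) ring_scheme \<Rightarrow> ('k, 'a, 'd) module_scheme \<Rightarrow> ('k, 'b, 'e) module_scheme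
    \<Rightarrow> 'a set \<Rightarrow> 'b set \<Rightarrow> ('k, 'a, 'b) tens set"
  where "tensor_span K V W A B =
    lin_span K (tensor K V W) {pure_tensor K V W x y | x y. x \<in> A \<and> y \<in> B}"

lemma subtensor_eq_tensor_span: "subtensor K C = tensor_span K C C"
  by (auto simp: fun_eq_iff subtensor_def tensor_span_def)

lemma tensor_span_mono: "A \<subseteq> A' \<Longrightarrow> B \<subseteq> B' \<Longrightarrow> tensor_span K V W A B \<subseteq> tensor_span K V W A' B'"
  unfolding tensor_span_def by (rule lin_span_mono) blast

lemma tensor_span_pure: "x \<in> A \<Longrightarrow> y \<in> B \<Longrightarrow> pure_tensor K V W x y \<in> tensor_span K V W A B"
  unfolding tensor_span_def by (rule lin_span_incl) blast

lemma tensor_span_submodule: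
  assumes V: "module K V" and W: "module K W" and A: "A \<subseteq> carrier V" and B: "B \<subseteq> carrier W"
  shows "submodule (tensor_span K V W A B) K (tensor K V W)"
  unfolding tensor_span_def using A B
  by (intro lin_span_submodule module_tensor[OF V W]) (auto intro: pure_tensor_closed[OF V W])

lemma tensor_span_subset:
  assumes "module K V" "module K W" "A \<subseteq> carrier V" "B \<subseteq> carrier W"
  shows "tensor_span K V W A B \<subseteq> carrier (tensor K V W)"
  by (rule module.submoduleE(1)[OF module_tensor[OF assms(1,2)] tensor_span_submodule[OF assms]])

lemma tensor_span_least:
  assumes "submodule N K (tensor K V W)"
    and "\<And>a b. a \<in> A \<Longrightarrow> b \<in> B \<Longrightarrow> pure_tensor K V W a b \<in> N"
  shows "tensor_span K V W A B \<subseteq> N"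
  unfolding tensor_span_def using assms by (intro lin_span_least) auto

lemma tensor_span_carrier:
  assumes "module K V" "module K W"
  shows "tensor_span K V W (carrier V) (carrier W) = carrier (tensor K V W)"
proof (intro equalityI subsetI)
  fix t assume "t \<in> carrier (tensor K V W)"
  then show "t \<in> tensor_span K V W (carrier V) (carrier W)"
    by (rule tensor_induct[OF assms tensor_span_submodule[OF assms order_refl order_refl]])
       (rule tensor_span_pure)
qed (rule subsetD[OF tensor_span_subset[OF assms order_refl order_refl]])

lemma linear_tensor_span:
  assumes V: "module K V" and W: "module K W" and U: "module K U"
    and f: "f \<in> linear_maps K (tensor K V W) U" and N: "submodule N K U"
    and A: "A \<subseteq> carrier V" and B: "B \<subseteq> carrier W"
    and pure: "\<And>a b. a \<in> A \<Longrightarrow> b \<in> B \<Longrightarrow> f (pure_tensor K V W a b) \<in> N"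
    and t: "t \<in> tensor_span K V W A B"
  shows "f t \<in> N"
proof -
  have "tensor_span K V W A B \<subseteq> {t \<in> carrier (tensor K V W). f t \<in> N}"
    using A B by (intro tensor_span_least submodule_vimage[OF module_tensor[OF V W] U f N])
      (auto intro: pure pure_tensor_closed[OF V W])
  then show ?thesis using t by blast
qed

lemma lift_tensor_span:
  assumes V: "module K V" and W: "module K W" and U: "module K U"
    and b: "b \<in> bilinear_maps K V W U" and N: "submodule N K U"
    and A: "A \<subseteq> carrier V" and B: "B \<subseteq> carrier W"
    and pure: "\<And>x y. x \<in> A \<Longrightarrow> y \<in> B \<Longrightarrow> b x y \<in> N"
    and t: "t \<in> tensor_span K V W A B"
  shows "tensor_lift K U b t \<in> N"
  by (rule linear_tensor_span[OF V W U tensor_lift_linear[OF V W U b] N A B _ t])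
     (simp add: tensor_lift_pure[OF V W U b subsetD[OF A] subsetD[OF B]] pure)

text \<open>The definition of finite sums by \<open>foldSetD\<close> involves the summands only through their values on
  the index set.  This gives a congruence rule for summands that are not known to lie in the
  carrier, and with it one for \<open>tensor_lift\<close> and arbitrary, not necessarily bilinear, functions.\<close>

lemma foldSetD_cong:
  assumes "(A, z) \<in> foldSetD D f e" "\<And>x. x \<in> A \<Longrightarrow> f x = g x"
  shows "(A, z) \<in> foldSetD D g e"
  using assms
proof (induction rule: foldSetD.induct)
  case emptyI
  then show ?case by (intro foldSetD.emptyI)
next
  case (insertI x A y)
  then have "(insert x A, g x y) \<in> foldSetD D g e"
    using insertI.prems[of x] by (intro foldSetD.insertI insertI.IH) auto
  then show ?case using insertI.prems[of x] by simp
qed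

lemma finsum_cong_everywhere:
  assumes "\<And>x. x \<in> A \<Longrightarrow> f x = g x"
  shows "finsum G f A = finsum G g A"
proof -
  have "(A, z) \<in> foldSetD D (add G \<circ> f) e \<longleftrightarrow> (A, z) \<in> foldSetD D (add G \<circ> g) e" for z D e
    using foldSetD_cong[of A z D "add G \<circ> f" e "add G \<circ> g"]
      foldSetD_cong[of A z D "add G \<circ> g" e "add G \<circ> f"] assms by auto
  then show ?thesis by (simp add: finsum_def finprod_def foldD_def)
qed

lemma tensor_lift_cong:
  assumes V: "module K V" and W: "module K W" and t: "t \<in> carrier (tensor K V W)"
    and eq: "\<And>v w. v \<in> carrier V \<Longrightarrow> w \<in> carrier W \<Longrightarrow> b v w = c v w"
  shows "tensor_lift K U b t = tensor_lift K U c t"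
proof -
  have "(SOME f. f \<in> t) \<in> t" using tensor_nonempty[OF V W t] by (simp add: some_in_eq)
  then have "(SOME f. f \<in> t) \<in> carrier (free_space K (carrier V \<times> carrier W))"
    by (rule tensor_repr_closed[OF V W t])
  then have "{q. (SOME f. f \<in> t) q \<noteq> \<zero>\<^bsub>K\<^esub>} \<subseteq> carrier V \<times> carrier W"
    by (simp add: free_space_simps)
  then show ?thesis
    unfolding tensor_lift_def Let_def by (intro finsum_cong_everywhere) (auto simp: eq subset_iff)
qed

lemma linear_comp_tensor_lift:
  assumes V: "module K V" and W: "module K W" and U: "module K U" and X: "module K X"
    and b: "b \<in> bilinear_maps K V W U" and f: "f \<in> linear_maps K U X"
    and t: "t \<in> carrier (tensor K V W)"
  shows "f (tensor_lift K U b t) = tensor_lift K X (\<lambda>v w. f (b v w)) t"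
proof -
  have fb: "(\<lambda>v w. f (b v w)) \<in> bilinear_maps K V W X"
    by (intro bilinear_mapsI linear_comp[OF _ f] bilinear_mapsD[OF b])
  show ?thesis
    by (rule tensor_ext[OF V W X linear_comp[OF tensor_lift_linear[OF V W U b] f]
          tensor_lift_linear[OF V W X fb] _ t])
       (simp add: tensor_lift_pure[OF V W U b] tensor_lift_pure[OF V W X fb])
qed

lemma tensor_map_linear:
  assumes "module K V" "module K W" "module K V'" "module K W'"
    and "f \<in> linear_maps K V V'" "g \<in> linear_maps K W W'"
  shows "tensor_map K V' W' f g \<in> linear_maps K (tensor K V W) (tensor K V' W')"
  unfolding tensor_map_def
  by (intro tensor_lift_linear assms module_tensor bilinear_mapsI linear_pure_left
      linear_pure_right linear_maps_closed[OF assms(5)] linear_maps_closed[OF assms(6)])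

lemma tensor_map_pure:
  assumes "module K V" "module K W" "module K V'" "module K W'"
    and "f \<in> linear_maps K V V'" "g \<in> linear_maps K W W'"
    and "v \<in> carrier V" "w \<in> carrier W"
  shows "tensor_map K V' W' f g (pure_tensor K V W v w) = pure_tensor K V' W' (f v) (g w)"
  unfolding tensor_map_def
  by (intro tensor_lift_pure assms module_tensor bilinear_mapsI linear_pure_left
      linear_pure_right linear_maps_closed[OF assms(5)] linear_maps_closed[OF assms(6)])

lemma tensor_map_bilinear:
  assumes "module K V" "module K W" "module K V'" "module K W'"
    and "f \<in> linear_maps K V V'" "g \<in> linear_maps K W W'"
  shows "(\<lambda>v w. pure_tensor K V' W' (f v) (g w)) \<in> bilinear_maps K V W (tensor K V' W')"
  by (intro assms module_tensor bilinear_mapsI linear_pure_left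
      linear_pure_right linear_maps_closed[OF assms(5)] linear_maps_closed[OF assms(6)])

lemma tensor_assoc_pure:
  assumes U: "module K U" and V: "module K V" and W: "module K W"
  shows "tensor_assoc K U V W \<in> linear_maps K (tensor K (tensor K U V) W) (tensor K U (tensor K V W))"
    and "s \<in> carrier (tensor K U V) \<Longrightarrow> w \<in> carrier W \<Longrightarrow>
      tensor_assoc K U V W (pure_tensor K (tensor K U V) W s w)
      = tensor_lift K (tensor K U (tensor K V W)) (\<lambda>u v.
          pure_tensor K U (tensor K V W) u (pure_tensor K V W v w)) s"
proof -
  note UV = module_tensor[OF U V] and VW = module_tensor[OF V W]
  note T = module_tensor[OF U VW]
  have b: "(\<lambda>u v. pure_tensor K U (tensor K V W) u (pure_tensor K V W v w))
      \<in> bilinear_maps K U V (tensor K U (tensor K V W))" if "w \<in> carrier W" for w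
    using that by (intro bilinear_mapsI linear_pure_left linear_pure_right linear_ident
        pure_tensor_closed U V W VW)
  have c: "(\<lambda>s w. tensor_lift K (tensor K U (tensor K V W)) (\<lambda>u v.
      pure_tensor K U (tensor K V W) u (pure_tensor K V W v w)) s)
      \<in> bilinear_maps K (tensor K U V) W (tensor K U (tensor K V W))"
  proof (rule bilinear_mapsI)
    fix s assume s: "s \<in> carrier (tensor K U V)"
    show "(\<lambda>w. tensor_lift K (tensor K U (tensor K V W)) (\<lambda>u v.
        pure_tensor K U (tensor K V W) u (pure_tensor K V W v w)) s)
        \<in> linear_maps K W (tensor K U (tensor K V W))"
      by (rule linear_lift_par[OF s b _ U V T W], assumption)
         (intro linear_pure_right linear_ident U V W VW)
  qed (rule tensor_lift_linear[OF U V T b])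
  show "tensor_assoc K U V W \<in> linear_maps K (tensor K (tensor K U V) W) (tensor K U (tensor K V W))"
    unfolding tensor_assoc_def Let_def by (rule tensor_lift_linear[OF UV W T c])
  show "tensor_assoc K U V W (pure_tensor K (tensor K U V) W s w)
      = tensor_lift K (tensor K U (tensor K V W)) (\<lambda>u v.
          pure_tensor K U (tensor K V W) u (pure_tensor K V W v w)) s"
    if "s \<in> carrier (tensor K U V)" "w \<in> carrier W"
    unfolding tensor_assoc_def Let_def by (rule tensor_lift_pure[OF UV W T c that])
qed

section \<open>Detecting subspaces of tensor products by functionals\<close>

text \<open>Choose \<open>M\<close> maximal among the subspaces that contain \<open>S\<close> but not \<open>v\<close>.  Then \<open>M\<close> and \<open>v\<close> span
  everything, and the coefficient of \<open>v\<close> is the required functional.\<close>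

lemma linear_functional_separation:
  assumes K: "field K" and V: "module K V" and S: "submodule S K V"
    and v: "v \<in> carrier V" "v \<notin> S"
  obtains \<phi> where "\<phi> \<in> linear_maps K V (base_space K)" "\<phi> v = \<one>\<^bsub>K\<^esub>" "\<And>x. x \<in> S \<Longrightarrow> \<phi> x = \<zero>\<^bsub>K\<^esub>"
proof -
  interpret K: field K by fact
  interpret V: module K V by fact
  let ?A = "{N. submodule N K V \<and> S \<subseteq> N \<and> v \<notin> N}"
  have "\<exists>M\<in>?A. \<forall>X\<in>?A. M \<subseteq> X \<longrightarrow> X = M"
  proof (rule subset_Zorn_nonempty)
    show "?A \<noteq> {}" using S v by blast
    fix C assume C: "C \<noteq> {}" "subset.chain ?A C"
    have sub: "submodule N K V" "S \<subseteq> N" "v \<notin> N" if "N \<in> C" for N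
      using C(2) that unfolding subset_chain_def by auto
    have "submodule (\<Union>C) K V"
    proof (rule V.submoduleI)
      fix a b assume "a \<in> \<Union>C" "b \<in> \<Union>C"
      then obtain M N where MN: "M \<in> C" "N \<in> C" "a \<in> M" "b \<in> N" by blast
      then consider "M \<subseteq> N" | "N \<subseteq> M" using C(2) unfolding subset_chain_def by blast
      then show "a \<oplus>\<^bsub>V\<^esub> b \<in> \<Union>C"
      proof cases
        case 1
        then have "a \<oplus>\<^bsub>V\<^esub> b \<in> N" using MN V.submoduleE(5)[OF sub(1)[OF MN(2)]] by blast
        then show ?thesis using MN(2) by blast
      next
        case 2
        then have "a \<oplus>\<^bsub>V\<^esub> b \<in> M" using MN V.submoduleE(5)[OF sub(1)[OF MN(1)]] by blast
        then show ?thesis using MN(1) by blast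
      qed
    next
      show "\<Union>C \<subseteq> carrier V" using V.submoduleE(1)[OF sub(1)] by blast
      show "\<zero>\<^bsub>V\<^esub> \<in> \<Union>C" using C(1) submodule_zero_mem[OF sub(1)] by blast
    next
      fix a assume "a \<in> \<Union>C"
      then show "\<ominus>\<^bsub>V\<^esub> a \<in> \<Union>C" using V.submoduleE(6)[OF sub(1)] by blast
    next
      fix a x assume "a \<in> carrier K" "x \<in> \<Union>C"
      then show "a \<odot>\<^bsub>V\<^esub> x \<in> \<Union>C" using V.submoduleE(4)[OF sub(1)] by blast
    qed
    moreover have "S \<subseteq> \<Union>C" using C(1) sub(2) by blast
    moreover have "v \<notin> \<Union>C" using sub(3) by blast
    ultimately show "\<Union>C \<in> ?A" by simp
  qed
  then obtain M where MA: "M \<in> ?A" and maxA: "\<forall>X\<in>?A. M \<subseteq> X \<longrightarrow> X = M"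
    by (rule bexE)
  have M: "submodule M K V" "S \<subseteq> M" "v \<notin> M" using MA by simp_all
  have max: "X = M" if "submodule X K V" "S \<subseteq> X" "v \<notin> X" "M \<subseteq> X" for X
    using maxA that by simp
  note Mc = V.submoduleE[OF M(1)]
  have Mcar: "x \<in> carrier V" if "x \<in> M" for x using that Mc(1) by blast
  have ex: "\<exists>c\<in>carrier K. x \<ominus>\<^bsub>V\<^esub> c \<odot>\<^bsub>V\<^esub> v \<in> M" if x: "x \<in> carrier V" for x
  proof (cases "x \<in> M")
    case True
    then show ?thesis using v(1) x by (intro bexI[of _ "\<zero>\<^bsub>K\<^esub>"]) (simp_all add: V.minus_eq V.a_inv_zero)
  next
    case False
    \<comment> \<open>The subspace spanned by \<open>M\<close> and \<open>x\<close> is larger than \<open>M\<close>, so by maximality it contains \<open>v\<close>;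
      solve for \<open>x\<close>.\<close>
    let ?X = "{m \<oplus>\<^bsub>V\<^esub> a \<odot>\<^bsub>V\<^esub> x | m a. m \<in> M \<and> a \<in> carrier K}"
    have X: "submodule ?X K V"
    proof (rule V.submoduleI)
      show "?X \<subseteq> carrier V" using Mcar x by blast
      show "\<zero>\<^bsub>V\<^esub> \<in> ?X"
        using submodule_zero_mem[OF M(1)] x
        by (intro CollectI exI[of _ "\<zero>\<^bsub>V\<^esub>"] exI[of _ "\<zero>\<^bsub>K\<^esub>"]) simp
    next
      fix y assume "y \<in> ?X"
      then obtain m a where y: "y = m \<oplus>\<^bsub>V\<^esub> a \<odot>\<^bsub>V\<^esub> x" "m \<in> M" "a \<in> carrier K" by blast
      then show "\<ominus>\<^bsub>V\<^esub> y \<in> ?X"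
        using Mcar x Mc(6)
        by (intro CollectI exI[of _ "\<ominus>\<^bsub>V\<^esub> m"] exI[of _ "\<ominus>\<^bsub>K\<^esub> a"])
           (simp add: V.minus_add V.smult_l_minus)
      fix c assume "c \<in> carrier K"
      then show "c \<odot>\<^bsub>V\<^esub> y \<in> ?X"
        using y Mcar x Mc(4)
        by (intro CollectI exI[of _ "c \<odot>\<^bsub>V\<^esub> m"] exI[of _ "c \<otimes>\<^bsub>K\<^esub> a"])
           (simp add: V.smult_r_distr V.smult_assoc1)
    next
      fix y z assume "y \<in> ?X" "z \<in> ?X"
      then obtain m a n b where y: "y = m \<oplus>\<^bsub>V\<^esub> a \<odot>\<^bsub>V\<^esub> x" "m \<in> M" "a \<in> carrier K"
        and z: "z = n \<oplus>\<^bsub>V\<^esub> b \<odot>\<^bsub>V\<^esub> x" "n \<in> M" "b \<in> carrier K" by blast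
      then show "y \<oplus>\<^bsub>V\<^esub> z \<in> ?X"
        using Mcar x Mc(5)
        by (intro CollectI exI[of _ "m \<oplus>\<^bsub>V\<^esub> n"] exI[of _ "a \<oplus>\<^bsub>K\<^esub> b"])
           (simp add: V.smult_l_distr V.a_ac)
    qed
    have MX: "M \<subseteq> ?X"
    proof
      fix m assume "m \<in> M"
      then show "m \<in> ?X" using Mcar x
        by (intro CollectI exI[of _ m] exI[of _ "\<zero>\<^bsub>K\<^esub>"]) simp
    qed
    have "x \<in> ?X" using submodule_zero_mem[OF M(1)] x
      by (intro CollectI exI[of _ "\<zero>\<^bsub>V\<^esub>"] exI[of _ "\<one>\<^bsub>K\<^esub>"]) simp
    then have "?X \<noteq> M" using False by blast
    then have "v \<in> ?X" using max[OF X subset_trans[OF M(2) MX] _ MX] by (rule contrapos_np)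
    then obtain m a where ma: "v = m \<oplus>\<^bsub>V\<^esub> a \<odot>\<^bsub>V\<^esub> x" "m \<in> M" "a \<in> carrier K" by blast
    have "a \<noteq> \<zero>\<^bsub>K\<^esub>" using ma x M(3) Mcar by auto
    then have inv: "inv\<^bsub>K\<^esub> a \<in> carrier K" "inv\<^bsub>K\<^esub> a \<otimes>\<^bsub>K\<^esub> a = \<one>\<^bsub>K\<^esub>"
      using ma(3) K.field_Units by auto
    have "inv\<^bsub>K\<^esub> a \<odot>\<^bsub>V\<^esub> v = inv\<^bsub>K\<^esub> a \<odot>\<^bsub>V\<^esub> m \<oplus>\<^bsub>V\<^esub> x"
      using ma Mcar[OF ma(2)] inv x
      by (simp add: V.smult_r_distr V.smult_assoc1[symmetric])
    then have "x \<ominus>\<^bsub>V\<^esub> inv\<^bsub>K\<^esub> a \<odot>\<^bsub>V\<^esub> v = \<ominus>\<^bsub>V\<^esub> (inv\<^bsub>K\<^esub> a \<odot>\<^bsub>V\<^esub> m)"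
      using x inv(1) Mcar[OF ma(2)]
      by (simp add: V.minus_eq V.minus_add V.a_ac V.r_neg1 V.r_neg2)
    then have "x \<ominus>\<^bsub>V\<^esub> inv\<^bsub>K\<^esub> a \<odot>\<^bsub>V\<^esub> v \<in> M" using Mc(4,6) ma(2) inv(1) by simp
    then show ?thesis using inv(1) by blast
  qed
  have unique: "c = d" if c: "c \<in> carrier K" "x \<ominus>\<^bsub>V\<^esub> c \<odot>\<^bsub>V\<^esub> v \<in> M"
    and d: "d \<in> carrier K" "x \<ominus>\<^bsub>V\<^esub> d \<odot>\<^bsub>V\<^esub> v \<in> M" and x: "x \<in> carrier V" for x c d
  proof (rule ccontr)
    assume "c \<noteq> d"
    let ?e = "d \<ominus>\<^bsub>K\<^esub> c"
    have "?e \<noteq> \<zero>\<^bsub>K\<^esub>"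
      using \<open>c \<noteq> d\<close> c(1) d(1) by (simp add: K.minus_eq_zero_iff)
    then have inv: "inv\<^bsub>K\<^esub> ?e \<in> carrier K" "inv\<^bsub>K\<^esub> ?e \<otimes>\<^bsub>K\<^esub> ?e = \<one>\<^bsub>K\<^esub>"
      using c d K.field_Units by auto
    have "(x \<ominus>\<^bsub>V\<^esub> c \<odot>\<^bsub>V\<^esub> v) \<ominus>\<^bsub>V\<^esub> (x \<ominus>\<^bsub>V\<^esub> d \<odot>\<^bsub>V\<^esub> v) = ?e \<odot>\<^bsub>V\<^esub> v"
      using x c d v
      by (simp add: V.minus_eq K.minus_eq V.minus_add V.smult_l_distr V.smult_l_minus V.a_ac
          V.r_neg V.r_neg1 V.r_neg2)
    then have "?e \<odot>\<^bsub>V\<^esub> v \<in> M" using submodule_diff[OF V M(1) c(2) d(2)] by simp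
    then have "inv\<^bsub>K\<^esub> ?e \<odot>\<^bsub>V\<^esub> (?e \<odot>\<^bsub>V\<^esub> v) \<in> M" using Mc(4) inv(1) by blast
    then show False using inv c d v M(3) by (simp add: V.smult_assoc1[symmetric])
  qed
  define \<phi> where "\<phi> = (\<lambda>x. THE c. c \<in> carrier K \<and> x \<ominus>\<^bsub>V\<^esub> c \<odot>\<^bsub>V\<^esub> v \<in> M)"
  have \<phi>: "\<phi> x = c" if "c \<in> carrier K" "x \<ominus>\<^bsub>V\<^esub> c \<odot>\<^bsub>V\<^esub> v \<in> M" "x \<in> carrier V" for x c
    unfolding \<phi>_def
  proof (rule the_equality)
    fix d assume "d \<in> carrier K \<and> x \<ominus>\<^bsub>V\<^esub> d \<odot>\<^bsub>V\<^esub> v \<in> M"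
    then show "d = c" using unique[OF _ _ that] by simp
  qed (use that in simp)
  have \<phi>': "\<phi> x \<in> carrier K" "x \<ominus>\<^bsub>V\<^esub> \<phi> x \<odot>\<^bsub>V\<^esub> v \<in> M" if x: "x \<in> carrier V" for x
  proof -
    obtain c where c: "c \<in> carrier K" "x \<ominus>\<^bsub>V\<^esub> c \<odot>\<^bsub>V\<^esub> v \<in> M" using ex[OF x] by (rule bexE)
    then show "\<phi> x \<in> carrier K" "x \<ominus>\<^bsub>V\<^esub> \<phi> x \<odot>\<^bsub>V\<^esub> v \<in> M" using \<phi>[OF c x] by simp_all
  qed
  show thesis
  proof (rule that[of \<phi>])
    show "\<phi> \<in> linear_maps K V (base_space K)"
    proof (rule linear_mapsI)
      fix x y assume xy: "x \<in> carrier V" "y \<in> carrier V"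
      have "(x \<ominus>\<^bsub>V\<^esub> \<phi> x \<odot>\<^bsub>V\<^esub> v) \<oplus>\<^bsub>V\<^esub> (y \<ominus>\<^bsub>V\<^esub> \<phi> y \<odot>\<^bsub>V\<^esub> v)
          = (x \<oplus>\<^bsub>V\<^esub> y) \<ominus>\<^bsub>V\<^esub> (\<phi> x \<oplus>\<^bsub>K\<^esub> \<phi> y) \<odot>\<^bsub>V\<^esub> v"
        using xy v \<phi>' by (simp add: V.minus_eq V.minus_add V.smult_l_distr V.a_ac)
      then have "(x \<oplus>\<^bsub>V\<^esub> y) \<ominus>\<^bsub>V\<^esub> (\<phi> x \<oplus>\<^bsub>K\<^esub> \<phi> y) \<odot>\<^bsub>V\<^esub> v \<in> M"
        using Mc(5)[OF \<phi>'(2)[OF xy(1)] \<phi>'(2)[OF xy(2)]] by simp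
      then show "\<phi> (x \<oplus>\<^bsub>V\<^esub> y) = \<phi> x \<oplus>\<^bsub>base_space K\<^esub> \<phi> y"
        using xy by (simp add: \<phi> \<phi>'(1))
    next
      fix a x assume ax: "a \<in> carrier K" "x \<in> carrier V"
      have "a \<odot>\<^bsub>V\<^esub> (x \<ominus>\<^bsub>V\<^esub> \<phi> x \<odot>\<^bsub>V\<^esub> v) = a \<odot>\<^bsub>V\<^esub> x \<ominus>\<^bsub>V\<^esub> (a \<otimes>\<^bsub>K\<^esub> \<phi> x) \<odot>\<^bsub>V\<^esub> v"
        using ax v \<phi>' by (simp add: V.minus_eq V.smult_r_distr V.smult_r_minus V.smult_assoc1)
      then have "a \<odot>\<^bsub>V\<^esub> x \<ominus>\<^bsub>V\<^esub> (a \<otimes>\<^bsub>K\<^esub> \<phi> x) \<odot>\<^bsub>V\<^esub> v \<in> M"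
        using Mc(4)[OF ax(1) \<phi>'(2)[OF ax(2)]] by simp
      then show "\<phi> (a \<odot>\<^bsub>V\<^esub> x) = a \<odot>\<^bsub>base_space K\<^esub> \<phi> x"
        using ax by (simp add: \<phi> \<phi>'(1))
    qed (use \<phi>' in simp)
    show "\<phi> v = \<one>\<^bsub>K\<^esub>"
      using v submodule_zero_mem[OF M(1)] by (intro \<phi>) (simp_all add: V.minus_eq V.r_neg)
    show "\<phi> x = \<zero>\<^bsub>K\<^esub>" if "x \<in> S" for x
      using that M(2) Mcar v by (intro \<phi>) (auto simp: V.minus_eq V.a_inv_zero)
  qed
qed

lemma tensor_span_insert:
  assumes V: "module K V" and W: "module K W" and A: "insert v A \<subseteq> carrier V"
    and t: "t \<in> tensor_span K V W (insert v A) (carrier W)"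
  obtains w t' where "w \<in> carrier W" "t' \<in> tensor_span K V W A (carrier W)"
    "t = pure_tensor K V W v w \<oplus>\<^bsub>tensor K V W\<^esub> t'"
proof -
  let ?T = "tensor K V W" and ?p = "pure_tensor K V W"
  interpret T: module K ?T by (rule module_tensor[OF V W])
  interpret W: module K W by fact
  let ?S = "tensor_span K V W A (carrier W)"
  have v: "v \<in> carrier V" and A': "A \<subseteq> carrier V" using A by auto
  note S = tensor_span_submodule[OF V W A' order_refl] and Sc = tensor_span_subset[OF V W A' order_refl]
  note SE = T.submoduleE[OF S]
  have pv: "?p v \<in> linear_maps K W ?T" by (rule bilinear_mapsD(1)[OF pure_tensor_bilinear[OF V W] v])
  note pc = linear_maps_closed[OF pv]
  let ?N = "{?p v w \<oplus>\<^bsub>?T\<^esub> t' | w t'. w \<in> carrier W \<and> t' \<in> ?S}"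
  have pz: "?p v \<zero>\<^bsub>W\<^esub> = \<zero>\<^bsub>?T\<^esub>" by (rule linear_maps_zero[OF W T.module_axioms pv])
  have sm: "c \<odot>\<^bsub>?T\<^esub> y \<in> ?N" if yN: "y \<in> ?N" and c: "c \<in> carrier K" for y c
  proof -
    obtain w s where y: "y = ?p v w \<oplus>\<^bsub>?T\<^esub> s" "w \<in> carrier W" "s \<in> ?S" using yN by blast
    then have "c \<odot>\<^bsub>?T\<^esub> y = ?p v (c \<odot>\<^bsub>W\<^esub> w) \<oplus>\<^bsub>?T\<^esub> c \<odot>\<^bsub>?T\<^esub> s"
      using Sc c by (simp add: T.smult_r_distr linear_maps_smult[OF pv] pc subset_iff)
    then show ?thesis using y c SE(4) by blast
  qed
  have "submodule ?N K ?T"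
  proof (rule T.submoduleI)
    show N: "?N \<subseteq> carrier ?T" using pc Sc by blast
    show "\<zero>\<^bsub>?T\<^esub> \<in> ?N" using submodule_zero_mem[OF S] pz
      by (intro CollectI exI[of _ "\<zero>\<^bsub>W\<^esub>"] exI[of _ "\<zero>\<^bsub>?T\<^esub>"]) simp
    show "c \<odot>\<^bsub>?T\<^esub> y \<in> ?N" if "c \<in> carrier K" "y \<in> ?N" for y c using sm that by blast
    show "\<ominus>\<^bsub>?T\<^esub> y \<in> ?N" if "y \<in> ?N" for y
      using sm[OF that, of "\<ominus>\<^bsub>K\<^esub> \<one>\<^bsub>K\<^esub>"] that N by (simp add: T.smult_l_minus subset_iff)
  next
    fix y z assume "y \<in> ?N" "z \<in> ?N"
    then obtain w s w' s' where y: "y = ?p v w \<oplus>\<^bsub>?T\<^esub> s" "w \<in> carrier W" "s \<in> ?S"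
      and z: "z = ?p v w' \<oplus>\<^bsub>?T\<^esub> s'" "w' \<in> carrier W" "s' \<in> ?S" by blast
    then have "y \<oplus>\<^bsub>?T\<^esub> z = ?p v (w \<oplus>\<^bsub>W\<^esub> w') \<oplus>\<^bsub>?T\<^esub> (s \<oplus>\<^bsub>?T\<^esub> s')"
      using Sc by (simp add: linear_maps_add[OF pv] pc subset_iff T.a_ac)
    then show "y \<oplus>\<^bsub>?T\<^esub> z \<in> ?N" using y z SE(5) by blast
  qed
  then have "tensor_span K V W (insert v A) (carrier W) \<subseteq> ?N"
  proof (rule tensor_span_least)
    fix a w assume a: "a \<in> insert v A" and w: "w \<in> carrier W"
    show "?p a w \<in> ?N"
    proof (cases "a = v")
      case True
      then show ?thesis using w submodule_zero_mem[OF S] pc[OF w]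
        by (intro CollectI exI[of _ w] exI[of _ "\<zero>\<^bsub>?T\<^esub>"]) simp
    next
      case False
      then have "?p a w \<in> ?S" using a w by (intro tensor_span_pure) auto
      then show ?thesis using pz Sc
        by (intro CollectI exI[of _ "\<zero>\<^bsub>W\<^esub>"] exI[of _ "?p a w"]) auto
    qed
  qed
  then show thesis using t that by blast
qed

lemma tensor_in_finite_span:
  assumes V: "module K V" and W: "module K W" and t: "t \<in> carrier (tensor K V W)"
  obtains A where "finite A" "A \<subseteq> carrier V" "t \<in> tensor_span K V W A (carrier W)"
proof -
  interpret T: module K "tensor K V W" by (rule module_tensor[OF V W])
  let ?S = "\<lambda>A. tensor_span K V W A (carrier W)"
  let ?N = "{t. \<exists>A. finite A \<and> A \<subseteq> carrier V \<and> t \<in> ?S A}"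
  have S: "submodule (?S A) K (tensor K V W)" if "A \<subseteq> carrier V" for A
    using tensor_span_submodule[OF V W that order_refl] .
  have "submodule ?N K (tensor K V W)"
  proof (rule T.submoduleI)
    show "?N \<subseteq> carrier (tensor K V W)" using tensor_span_subset[OF V W _ order_refl] by blast
    show "\<zero>\<^bsub>tensor K V W\<^esub> \<in> ?N" using submodule_zero_mem[OF S[of "{}"]] by blast
  next
    fix x assume "x \<in> ?N"
    then show "\<ominus>\<^bsub>tensor K V W\<^esub> x \<in> ?N" using T.submoduleE(6)[OF S] by blast
  next
    fix a x assume "a \<in> carrier K" "x \<in> ?N"
    then show "a \<odot>\<^bsub>tensor K V W\<^esub> x \<in> ?N" using T.submoduleE(4)[OF S] by blast
  next
    fix x y assume "x \<in> ?N" "y \<in> ?N"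
    then obtain A B where A: "finite A" "A \<subseteq> carrier V" "x \<in> ?S A"
      and B: "finite B" "B \<subseteq> carrier V" "y \<in> ?S B" by blast
    have AB: "finite (A \<union> B)" "A \<union> B \<subseteq> carrier V" using A B by auto
    have "x \<in> ?S (A \<union> B)" "y \<in> ?S (A \<union> B)"
      using A(3) B(3) tensor_span_mono[of A "A \<union> B" "carrier W" "carrier W" K V W]
        tensor_span_mono[of B "A \<union> B" "carrier W" "carrier W" K V W] by auto
    then have "x \<oplus>\<^bsub>tensor K V W\<^esub> y \<in> ?S (A \<union> B)" by (rule T.submoduleE(5)[OF S[OF AB(2)]])
    then show "x \<oplus>\<^bsub>tensor K V W\<^esub> y \<in> ?N" using AB by blast
  qed
  then have "t \<in> ?N"
  proof (rule tensor_induct[OF V W _ t])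
    fix v w assume "v \<in> carrier V" "w \<in> carrier W"
    then have "finite {v} \<and> {v} \<subseteq> carrier V \<and> pure_tensor K V W v w \<in> ?S {v}"
      using tensor_span_pure[of v "{v}" w "carrier W"] by simp
    then show "pure_tensor K V W v w \<in> ?N" by blast
  qed
  then show thesis using that by blast
qed

text \<open>\<open>V \<otimes> N\<close> is the common kernel of the maps \<open>\<phi> \<otimes> (W \<rightarrow> W/N)\<close>.  The tensor lies in \<open>A \<otimes> W\<close> for some
  finite set \<open>A\<close> of first factors, and \<open>A\<close> is reduced one element \<open>v\<close> at a time.  If \<open>v\<close> depends linearly
  on the other elements, it can be dropped.  Otherwise a functional that is \<open>1\<close> on \<open>v\<close> and \<open>0\<close> on the
  others shows that the second factor \<open>w\<close> belonging to \<open>v\<close> lies in \<open>N\<close>.\<close>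

lemma tensor_span_detect_right:
  assumes K: "field K" and V: "module K V" and W: "module K W" and N: "submodule N K W"
    and t: "t \<in> carrier (tensor K V W)"
    and detect: "\<And>\<phi>. \<phi> \<in> linear_maps K V (base_space K) \<Longrightarrow>
      tensor_lift K W (\<lambda>v w. \<phi> v \<odot>\<^bsub>W\<^esub> w) t \<in> N"
  shows "t \<in> tensor_span K V W (carrier V) N"
proof -
  let ?T = "tensor K V W" and ?p = "pure_tensor K V W"
  let ?E = "\<lambda>\<phi>. tensor_lift K W (\<lambda>v w. \<phi> v \<odot>\<^bsub>W\<^esub> w)"
  interpret V: module K V by fact
  interpret W: module K W by fact
  interpret T: module K ?T by (rule module_tensor[OF V W])
  have Nc: "N \<subseteq> carrier W" by (rule W.submoduleE(1)[OF N])
  let ?R = "tensor_span K V W (carrier V) N"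
  have R: "submodule ?R K ?T" and Rc: "?R \<subseteq> carrier ?T"
    using tensor_span_submodule[OF V W order_refl Nc] tensor_span_subset[OF V W order_refl Nc] by auto
  have bil: "(\<lambda>v w. \<phi> v \<odot>\<^bsub>W\<^esub> w) \<in> bilinear_maps K V W W"
    if "\<phi> \<in> linear_maps K V (base_space K)" for \<phi>
    using that linear_maps_closed[OF that]
    by (intro bilinear_mapsI linear_smult_left linear_smult_right linear_ident W) simp_all
  \<comment> \<open>The summand \<open>s\<close> collects the terms \<open>v \<otimes> w\<close> already recognised as elements of \<open>V \<otimes> N\<close>.\<close>
  have main: "t' \<oplus>\<^bsub>?T\<^esub> s \<in> ?R"
    if "finite A" "A \<subseteq> carrier V" "t' \<in> tensor_span K V W A (carrier W)" "s \<in> ?R"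
      "\<And>\<phi>. \<phi> \<in> linear_maps K V (base_space K) \<Longrightarrow> ?E \<phi> (t' \<oplus>\<^bsub>?T\<^esub> s) \<in> N" for A t' s
    using that
  proof (induction A arbitrary: t' s rule: finite_induct)
    case empty
    have "tensor_span K V W {} (carrier W) \<subseteq> {\<zero>\<^bsub>?T\<^esub>}"
      by (rule tensor_span_least[OF submodule_zero[OF T.module_axioms]]) auto
    then have "t' = \<zero>\<^bsub>?T\<^esub>" using empty by blast
    then show ?case using empty Rc by auto
  next
    case (insert v A)
    have v: "v \<in> carrier V" and A: "A \<subseteq> carrier V" using insert by auto
    let ?S = "tensor_span K V W A (carrier W)" and ?L = "lin_span K V A"
    note S = tensor_span_submodule[OF V W A order_refl] and Sc = tensor_span_subset[OF V W A order_refl]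
    have L: "submodule ?L K V" by (rule lin_span_submodule[OF V A])
    obtain w t'' where w: "w \<in> carrier W" "t'' \<in> ?S" "t' = ?p v w \<oplus>\<^bsub>?T\<^esub> t''"
      using tensor_span_insert[OF V W insert.prems(1,2)] by blast
    have pc: "?p v w \<in> carrier ?T" by (rule pure_tensor_closed[OF V W v w(1)])
    have sc: "s \<in> carrier ?T" "t'' \<in> carrier ?T" using insert.prems(3) w(2) Rc Sc by auto
    show ?case
    proof (cases "v \<in> ?L")
      case True
      have "?L \<subseteq> {x \<in> carrier V. ?p x w \<in> ?S}"
        using A w(1) by (intro lin_span_least submodule_vimage[OF V T.module_axioms _ S]
            linear_pure_left[OF V W] linear_ident) (auto intro: tensor_span_pure)
      then have "?p v w \<in> ?S" using True by blast
      then have "t' \<in> ?S" using w T.submoduleE(5)[OF S] by blast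
      then show ?thesis using insert.IH[OF A _ insert.prems(3,4)] by blast
    next
      case False
      obtain \<phi> where \<phi>: "\<phi> \<in> linear_maps K V (base_space K)" "\<phi> v = \<one>\<^bsub>K\<^esub>"
        "\<And>x. x \<in> ?L \<Longrightarrow> \<phi> x = \<zero>\<^bsub>K\<^esub>"
        using linear_functional_separation[OF K V L v False] by blast
      note E = tensor_lift_linear[OF V W W bil[OF \<phi>(1)]]
        and Ep = tensor_lift_pure[OF V W W bil[OF \<phi>(1)]]
      have "?E \<phi> t'' \<in> {\<zero>\<^bsub>W\<^esub>}"
        by (rule lift_tensor_span[OF V W W bil[OF \<phi>(1)] submodule_zero[OF W] A order_refl _ w(2)])
           (simp add: \<phi>(3)[OF lin_span_incl])
      then have "?E \<phi> (t' \<oplus>\<^bsub>?T\<^esub> s) = w \<oplus>\<^bsub>W\<^esub> ?E \<phi> s"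
        using w pc sc v \<phi>(2) by (simp add: linear_maps_add[OF E] Ep)
      moreover have "?E \<phi> s \<in> N"
        by (rule lift_tensor_span[OF V W W bil[OF \<phi>(1)] N order_refl Nc _ insert.prems(3)])
           (use W.submoduleE(4)[OF N] linear_maps_closed[OF \<phi>(1)] in simp)
      ultimately have "(w \<oplus>\<^bsub>W\<^esub> ?E \<phi> s) \<ominus>\<^bsub>W\<^esub> ?E \<phi> s \<in> N"
        using insert.prems(4)[OF \<phi>(1)] submodule_diff[OF W N] by simp
      moreover have "(w \<oplus>\<^bsub>W\<^esub> ?E \<phi> s) \<ominus>\<^bsub>W\<^esub> ?E \<phi> s = w"
        using w(1) linear_maps_closed[OF E sc(1)] by (simp add: W.minus_eq W.a_assoc W.r_neg)
      ultimately have "w \<in> N" by simp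
      then have "?p v w \<oplus>\<^bsub>?T\<^esub> s \<in> ?R"
        using v insert.prems(3) T.submoduleE(5)[OF R] by (intro T.submoduleE(5)[OF R] tensor_span_pure)
      moreover have eq: "t' \<oplus>\<^bsub>?T\<^esub> s = t'' \<oplus>\<^bsub>?T\<^esub> (?p v w \<oplus>\<^bsub>?T\<^esub> s)"
        using w(3) pc sc by (simp add: T.a_ac)
      ultimately show ?thesis
        using insert.IH[OF A w(2), of "?p v w \<oplus>\<^bsub>?T\<^esub> s"] insert.prems(4) unfolding eq by blast
    qed
  qed
  obtain A where A: "finite A" "A \<subseteq> carrier V" "t \<in> tensor_span K V W A (carrier W)"
    using tensor_in_finite_span[OF V W t] by blast
  have "t \<oplus>\<^bsub>?T\<^esub> \<zero>\<^bsub>?T\<^esub> \<in> ?R"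
    using main[OF A submodule_zero_mem[OF R]] detect t by simp
  then show ?thesis using t by simp
qed

lemma tensor_span_detect_left:
  assumes K: "field K" and V: "module K V" and W: "module K W" and N: "submodule N K V"
    and t: "t \<in> carrier (tensor K V W)"
    and detect: "\<And>\<phi>. \<phi> \<in> linear_maps K W (base_space K) \<Longrightarrow>
      tensor_lift K V (\<lambda>v w. \<phi> w \<odot>\<^bsub>V\<^esub> v) t \<in> N"
  shows "t \<in> tensor_span K V W N (carrier W)"
proof -
  let ?T = "tensor K V W" and ?T' = "tensor K W V"
  let ?flip = "tensor_lift K ?T' (\<lambda>v w. pure_tensor K W V w v)"
  let ?flip' = "tensor_lift K ?T (\<lambda>w v. pure_tensor K V W v w)"
  note T = module_tensor[OF V W] and T' = module_tensor[OF W V]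
  interpret V: module K V by fact
  have Nc: "N \<subseteq> carrier V" by (rule V.submoduleE(1)[OF N])
  have b: "(\<lambda>v w. pure_tensor K W V w v) \<in> bilinear_maps K V W ?T'"
    by (intro bilinear_mapsI linear_pure_left[OF W V] linear_pure_right[OF W V] linear_ident)
  have b': "(\<lambda>w v. pure_tensor K V W v w) \<in> bilinear_maps K W V ?T"
    by (intro bilinear_mapsI linear_pure_left[OF V W] linear_pure_right[OF V W] linear_ident)
  have bil: "(\<lambda>v w. \<phi> w \<odot>\<^bsub>V\<^esub> v) \<in> bilinear_maps K V W V"
    and bil': "(\<lambda>w v. \<phi> w \<odot>\<^bsub>V\<^esub> v) \<in> bilinear_maps K W V V"
    if "\<phi> \<in> linear_maps K W (base_space K)" for \<phi>
    using that linear_maps_closed[OF that]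
    by (intro bilinear_mapsI linear_smult_left linear_smult_right linear_ident V; simp)+
  note f = tensor_lift_linear[OF V W T' b] and f' = tensor_lift_linear[OF W V T b']
  note fp = tensor_lift_pure[OF V W T' b] and f'p = tensor_lift_pure[OF W V T b']
  have "?flip t \<in> tensor_span K W V (carrier W) N"
  proof (rule tensor_span_detect_right[OF K W V N linear_maps_closed[OF f t]])
    fix \<phi> assume \<phi>: "\<phi> \<in> linear_maps K W (base_space K)"
    have "tensor_lift K V (\<lambda>w v. \<phi> w \<odot>\<^bsub>V\<^esub> v) (?flip t) = tensor_lift K V (\<lambda>v w. \<phi> w \<odot>\<^bsub>V\<^esub> v) t"
      by (rule tensor_ext[OF V W V linear_lift_arg[OF f bil'[OF \<phi>] W V V]
            tensor_lift_linear[OF V W V bil[OF \<phi>]] _ t])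
         (simp add: fp tensor_lift_pure[OF W V V bil'[OF \<phi>]] tensor_lift_pure[OF V W V bil[OF \<phi>]])
    then show "tensor_lift K V (\<lambda>w v. \<phi> w \<odot>\<^bsub>V\<^esub> v) (?flip t) \<in> N" using detect[OF \<phi>] by simp
  qed
  then have "?flip' (?flip t) \<in> tensor_span K V W N (carrier W)"
    by (intro lift_tensor_span[OF W V T b' tensor_span_submodule[OF V W Nc order_refl] order_refl Nc])
       (auto intro: tensor_span_pure)
  moreover have "?flip' (?flip t) = t"
    by (rule tensor_ext[OF V W T linear_lift_arg[OF f b' W V T] linear_ident _ t]) (simp add: fp f'p)
  ultimately show ?thesis by simp
qed

section \<open>Coalgebras with trivial coradical\<close>

locale connected_coalgebra =
  fixes K :: "('k, 'c) ring_scheme" and C :: "('k, 'a, 'd) module_scheme"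
    and \<Delta> :: "'a \<Rightarrow> ('k, 'a, 'a) tens" and \<epsilon> :: "'a \<Rightarrow> 'k" and e :: 'a
  assumes coalgebra: "coalgebra K C \<Delta> \<epsilon>"
    and e_closed: "e \<in> carrier C"
    and comult_e: "\<Delta> e = pure_tensor K C C e e"
    and counit_e: "\<epsilon> e = \<one>\<^bsub>K\<^esub>"
    and coradical_eq: "coradical K C \<Delta> = {a \<odot>\<^bsub>C\<^esub> e | a. a \<in> carrier K}"
begin

text \<open>The index of \<open>P\<close> is shifted: \<open>P 0 = 0\<close> and \<open>P (Suc n)\<close> is the \<open>n\<close>-th step of the coradical
  filtration.  This makes inductions start at the zero subspace.\<close>

abbreviation "T \<equiv> tensor K C C"
abbreviation "p \<equiv> pure_tensor K C C"
abbreviation "P \<equiv> coradical_filtration_pred K C \<Delta>"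

lemma field_K: "field K" and module_C: "module K C"
  and \<Delta>: "\<Delta> \<in> linear_maps K C T" and \<epsilon>: "\<epsilon> \<in> linear_maps K C (base_space K)"
  and counit_left: "x \<in> carrier C \<Longrightarrow> tensor_lift K C (\<lambda>a b. \<epsilon> a \<odot>\<^bsub>C\<^esub> b) (\<Delta> x) = x"
  and counit_right: "x \<in> carrier C \<Longrightarrow> tensor_lift K C (\<lambda>a b. \<epsilon> b \<odot>\<^bsub>C\<^esub> a) (\<Delta> x) = x"
  and coassoc: "x \<in> carrier C \<Longrightarrow>
    tensor_assoc K C C C (tensor_map K T C \<Delta> (\<lambda>y. y) (\<Delta> x)) = tensor_map K C T (\<lambda>y. y) \<Delta> (\<Delta> x)"
  using coalgebra by (auto simp: coalgebra_def)

sublocale K: field K by (rule field_K)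
sublocale C: module K C by (rule module_C)
sublocale T: module K T by (rule module_tensor[OF module_C module_C])

lemmas mods = module_C T.module_axioms module_base_space[OF K.is_cring]
lemmas \<Delta>_closed = linear_maps_closed[OF \<Delta>]
lemma \<epsilon>_closed: "x \<in> carrier C \<Longrightarrow> \<epsilon> x \<in> carrier K"
  using linear_maps_closed[OF \<epsilon>] by simp
lemmas p_closed = pure_tensor_closed[OF module_C module_C]
lemmas p_left = linear_pure_left[OF module_C module_C]
  and p_right = linear_pure_right[OF module_C module_C]

lemma functional_bilinear_left:
  "f \<in> linear_maps K C (base_space K) \<Longrightarrow> (\<lambda>a b. f a \<odot>\<^bsub>C\<^esub> b) \<in> bilinear_maps K C C C"
  using linear_maps_closed[of f K C "base_space K"]
  by (intro bilinear_mapsI linear_smult_left linear_smult_right linear_ident mods) simp_all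

lemma functional_bilinear_right:
  "f \<in> linear_maps K C (base_space K) \<Longrightarrow> (\<lambda>a b. f b \<odot>\<^bsub>C\<^esub> a) \<in> bilinear_maps K C C C"
  using linear_maps_closed[of f K C "base_space K"]
  by (intro bilinear_mapsI linear_smult_left linear_smult_right linear_ident mods) simp_all

definition "left_defect x = \<Delta> x \<ominus>\<^bsub>T\<^esub> p e x"

lemma left_defect_linear: "left_defect \<in> linear_maps K C T"
  unfolding left_defect_def[abs_def]
  by (intro linear_minus mods \<Delta> p_right linear_ident e_closed)

lemmas left_defect_closed = linear_maps_closed[OF left_defect_linear]

lemma \<Delta>_left_defect: "x \<in> carrier C \<Longrightarrow> \<Delta> x = p e x \<oplus>\<^bsub>T\<^esub> left_defect x"
  unfolding left_defect_def by (simp add: T.add_minus_cancel \<Delta>_closed p_closed e_closed)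

lemma filtration_pred_simps:
  "P 0 = {\<zero>\<^bsub>C\<^esub>}" "P (Suc 0) = coradical K C \<Delta>"
  "P (Suc (Suc n)) = {x \<in> carrier C. \<Delta> x \<in>
    tensor_span K C C (carrier C) (P (Suc n)) <+>\<^bsub>T\<^esub> tensor_span K C C (coradical K C \<Delta>) (carrier C)}"
  by (simp_all add: coradical_filtration_pred_def subtensor_eq_tensor_span)

lemma coradical_subset: "coradical K C \<Delta> \<subseteq> carrier C"
  using e_closed by (auto simp: coradical_eq)

lemma coradical_submodule: "submodule (coradical K C \<Delta>) K C"
proof -
  have "D \<subseteq> carrier C" if "simple_subcoalgebra K C \<Delta> D" for D
    using that unfolding simple_subcoalgebra_def subcoalgebra_def
    by (intro C.submoduleE(1)) simp
  then show ?thesis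
    unfolding coradical_def by (intro lin_span_submodule[OF module_C]) blast
qed

lemma coradical_left_defect:
  assumes "x \<in> carrier C" shows "x \<in> coradical K C \<Delta> \<longleftrightarrow> left_defect x = \<zero>\<^bsub>T\<^esub>"
proof
  assume "x \<in> coradical K C \<Delta>"
  then obtain a where a: "a \<in> carrier K" "x = a \<odot>\<^bsub>C\<^esub> e" by (auto simp: coradical_eq)
  have "\<Delta> x = p e x"
    using a e_closed by (simp add: linear_maps_smult[OF \<Delta>] comult_e
        linear_maps_smult[OF p_right[OF e_closed linear_ident]])
  then show "left_defect x = \<zero>\<^bsub>T\<^esub>"
    using assms by (simp add: left_defect_def T.minus_eq_zero_iff p_closed e_closed)
next
  assume "left_defect x = \<zero>\<^bsub>T\<^esub>"
  then have eq: "\<Delta> x = p e x"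
    using assms by (simp add: left_defect_def T.minus_eq_zero_iff p_closed e_closed \<Delta>_closed)
  have "x = tensor_lift K C (\<lambda>a b. \<epsilon> b \<odot>\<^bsub>C\<^esub> a) (p e x)"
    using counit_right[OF assms] eq by simp
  also have "\<dots> = \<epsilon> x \<odot>\<^bsub>C\<^esub> e"
    by (rule tensor_lift_pure[OF mods(1,1,1) functional_bilinear_right[OF \<epsilon>] e_closed assms])
  finally show "x \<in> coradical K C \<Delta>" using \<epsilon>_closed[OF assms] by (auto simp: coradical_eq)
qed

text \<open>The map \<open>G(a \<otimes> b) = a \<otimes> b - e \<otimes> \<epsilon>(a) b\<close> vanishes on \<open>K e \<otimes> C\<close>, preserves \<open>C \<otimes> P n\<close>, and by the counit
  law sends \<open>\<Delta> x\<close> to \<open>\<Delta> x - e \<otimes> x\<close>.  Applied to the wedge condition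
  \<open>\<Delta> x \<in> C \<otimes> P n + K e \<otimes> C\<close> that defines the filtration it leaves a single tensor product.\<close>

lemma filtration_Suc_iff:
  assumes P: "submodule (P n) K C" and x: "x \<in> carrier C"
  shows "x \<in> P (Suc n) \<longleftrightarrow> left_defect x \<in> tensor_span K C C (carrier C) (P n)"
proof -
  have Pc: "P n \<subseteq> carrier C" by (rule C.submoduleE(1)[OF P])
  let ?S = "tensor_span K C C (carrier C) (P n)"
  have S: "submodule ?S K T" by (rule tensor_span_submodule[OF mods(1,1) order_refl Pc])
  let ?E = "tensor_lift K C (\<lambda>a b. \<epsilon> a \<odot>\<^bsub>C\<^esub> b)"
  let ?G = "\<lambda>t. t \<ominus>\<^bsub>T\<^esub> p e (?E t)"
  note E = tensor_lift_linear[OF mods(1,1,1) functional_bilinear_left[OF \<epsilon>]]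
    and Ep = tensor_lift_pure[OF mods(1,1,1) functional_bilinear_left[OF \<epsilon>]]
  have G: "?G \<in> linear_maps K T T"
    by (intro linear_minus mods linear_ident p_right E e_closed)
  show ?thesis
  proof (cases n)
    case 0
    have "?S \<subseteq> {\<zero>\<^bsub>T\<^esub>}"
      unfolding 0 filtration_pred_simps
      using linear_maps_zero[OF mods(1,2) p_right[OF _ linear_ident]]
      by (intro tensor_span_least submodule_zero mods) auto
    then show ?thesis
      using submodule_zero_mem[OF S] coradical_left_defect[OF x] 0
      by (auto simp: filtration_pred_simps)
  next
    case (Suc m)
    let ?R = "tensor_span K C C (coradical K C \<Delta>) (carrier C)"
    have Rc: "?R \<subseteq> carrier T" by (rule tensor_span_subset[OF mods(1,1) coradical_subset order_refl])
    have Sc: "?S \<subseteq> carrier T" by (rule T.submoduleE(1)[OF S])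
    have eq: "x \<in> P (Suc n) \<longleftrightarrow> \<Delta> x \<in> ?S <+>\<^bsub>T\<^esub> ?R"
      using x unfolding Suc filtration_pred_simps by simp
    have GD: "?G (\<Delta> x) = left_defect x"
      by (simp add: left_defect_def counit_left[OF x])
    show ?thesis
    proof
      assume "x \<in> P (Suc n)"
      then obtain s r where sr: "s \<in> ?S" "r \<in> ?R" "\<Delta> x = s \<oplus>\<^bsub>T\<^esub> r"
        unfolding eq set_add_def' by blast
      have "?G r \<in> {\<zero>\<^bsub>T\<^esub>}"
      proof (rule linear_tensor_span[OF mods(1,1,2) G submodule_zero[OF mods(2)]
            coradical_subset order_refl _ sr(2)])
        fix a b assume a: "a \<in> coradical K C \<Delta>" and b: "b \<in> carrier C"
        from a obtain c where c: "c \<in> carrier K" "a = c \<odot>\<^bsub>C\<^esub> e" by (auto simp: coradical_eq)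
        then have ca: "a \<in> carrier C" using e_closed by simp
        have "?E (p a b) = c \<odot>\<^bsub>C\<^esub> b"
          using Ep[OF ca b] linear_maps_smult[OF \<epsilon> c(1) e_closed] c by (simp add: counit_e)
        then have "p e (?E (p a b)) = p a b"
          using linear_maps_smult[OF p_right[OF e_closed linear_ident] c(1) b]
            linear_maps_smult[OF p_left[OF b linear_ident] c(1) e_closed] c(2) by simp
        then show "?G (p a b) \<in> {\<zero>\<^bsub>T\<^esub>}"
          using ca b by (simp add: T.minus_eq_zero_iff p_closed)
      qed
      moreover have "?G s \<in> ?S"
      proof (rule linear_tensor_span[OF mods(1,1,2) G S order_refl Pc _ sr(1)])
        fix a b assume a: "a \<in> carrier C" and b: "b \<in> P n"
        have bc: "b \<in> carrier C" using b Pc by blast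
        have "p a b \<in> ?S" "p e (\<epsilon> a \<odot>\<^bsub>C\<^esub> b) \<in> ?S"
          by (intro tensor_span_pure e_closed C.submoduleE(4)[OF P] \<epsilon>_closed a b)+
        then show "?G (p a b) \<in> ?S"
          using a bc submodule_diff[OF mods(2) S] by (simp add: Ep)
      qed
      moreover have "left_defect x = ?G s \<oplus>\<^bsub>T\<^esub> ?G r"
        using linear_maps_add[OF G, of s r] GD sr Sc Rc by auto
      ultimately show "left_defect x \<in> ?S" using Sc by (auto simp: T.r_zero subset_iff)
    next
      assume d: "left_defect x \<in> ?S"
      have "e \<in> coradical K C \<Delta>"
        unfolding coradical_eq using e_closed by (intro CollectI exI[of _ "\<one>\<^bsub>K\<^esub>"]) simp
      then have "p e x \<in> ?R" using x by (rule tensor_span_pure)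
      moreover have "\<Delta> x = left_defect x \<oplus>\<^bsub>T\<^esub> p e x"
        using \<Delta>_left_defect[OF x] x T.a_comm by (simp add: p_closed left_defect_closed e_closed)
      ultimately show "x \<in> P (Suc n)" unfolding eq set_add_def' using d by blast
    qed
  qed
qed

lemma filtration_subset_carrier: "P n \<subseteq> carrier C"
proof (cases n)
  case 0
  then show ?thesis by (simp add: filtration_pred_simps)
next
  case (Suc m)
  then show ?thesis by (cases m) (use coradical_subset in \<open>auto simp: filtration_pred_simps\<close>)
qed

lemma filtration_submodule: "submodule (P n) K C"
proof (induction n)
  case 0
  show ?case by (simp add: filtration_pred_simps submodule_zero module_C)
next
  case (Suc n)
  have "P (Suc n) = {x \<in> carrier C. left_defect x \<in> tensor_span K C C (carrier C) (P n)}"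
    using filtration_Suc_iff[OF Suc] filtration_subset_carrier[of "Suc n"] by blast
  then show ?case
    using submodule_vimage[OF mods(1,2) left_defect_linear
        tensor_span_submodule[OF mods(1,1) order_refl filtration_subset_carrier]] by simp
qed

lemma filtration_closed: "x \<in> P n \<Longrightarrow> x \<in> carrier C"
  using filtration_subset_carrier by blast

lemma filtration_left_defect:
  "x \<in> P (Suc n) \<Longrightarrow> left_defect x \<in> tensor_span K C C (carrier C) (P n)"
  using filtration_Suc_iff[OF filtration_submodule] filtration_closed by blast

lemma filtrationI:
  "x \<in> carrier C \<Longrightarrow> left_defect x \<in> tensor_span K C C (carrier C) (P n) \<Longrightarrow> x \<in> P (Suc n)"
  using filtration_Suc_iff[OF filtration_submodule] by blast

lemma filtration_mono: "P n \<subseteq> P (Suc n)"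
proof (induction n)
  case 0
  show ?case
    using submodule_zero_mem[OF coradical_submodule] by (simp add: filtration_pred_simps)
next
  case (Suc n)
  show ?case
  proof
    fix x assume x: "x \<in> P (Suc n)"
    then show "x \<in> P (Suc (Suc n))"
      using filtration_left_defect[OF x] tensor_span_mono[OF order_refl Suc]
      by (intro filtrationI filtration_closed[OF x]) blast
  qed
qed

lemma comult_filtration_right:
  assumes "x \<in> P (Suc n)" shows "\<Delta> x \<in> tensor_span K C C (carrier C) (P (Suc n))"
proof -
  have "left_defect x \<in> tensor_span K C C (carrier C) (P (Suc n))"
    using filtration_left_defect[OF assms] tensor_span_mono[OF order_refl filtration_mono] by blast
  moreover have "p e x \<in> tensor_span K C C (carrier C) (P (Suc n))"
    using assms by (intro tensor_span_pure e_closed)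
  ultimately show ?thesis
    unfolding \<Delta>_left_defect[OF filtration_closed[OF assms]]
    by (intro T.submoduleE(5)[OF tensor_span_submodule[OF mods(1,1) order_refl
            filtration_subset_carrier]])
qed

text \<open>The criterion for membership in the filtration uses the left defect only.  For the mirror image
  contract the second tensor factor of the right defect \<open>\<Delta> x - x \<otimes> e\<close> with a functional \<open>f\<close>.  By
  coassociativity this contraction commutes with taking left defects, and therefore it lowers the
  filtration degree by induction.\<close>

definition "right_contraction f x =
  tensor_lift K C (\<lambda>a b. f b \<odot>\<^bsub>C\<^esub> a) (\<Delta> x) \<ominus>\<^bsub>C\<^esub> f e \<odot>\<^bsub>C\<^esub> x"

lemma right_contraction_linear:
  assumes f: "f \<in> linear_maps K C (base_space K)"
  shows "right_contraction f \<in> linear_maps K C C"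
  unfolding right_contraction_def[abs_def]
  using linear_maps_closed[OF f e_closed]
  by (intro linear_minus mods linear_smult_right linear_ident functional_bilinear_right f
      linear_lift_arg[OF \<Delta> _ mods(1,1,1)]) simp

lemma comult_right_contraction:
  assumes f: "f \<in> linear_maps K C (base_space K)" and x: "x \<in> carrier C"
  shows "\<Delta> (right_contraction f x) = tensor_map K C C (\<lambda>y. y) (right_contraction f) (\<Delta> x)"
proof -
  let ?TT = "tensor K C T" and ?TT' = "tensor K T C"
  let ?h = "tensor_lift K C (\<lambda>a b. f b \<odot>\<^bsub>C\<^esub> a)"
  have TT: "module K ?TT" and TT': "module K ?TT'" by (intro module_tensor mods)+
  have fc: "f a \<in> carrier K" if "a \<in> carrier C" for a using linear_maps_closed[OF f that] by simp
  note fb = functional_bilinear_right[OF f]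
  have h: "?h \<in> linear_maps K T C" by (rule tensor_lift_linear[OF mods(1,1,1) fb])
  note hp = tensor_lift_pure[OF mods(1,1,1) fb]
  have idh: "tensor_map K C C (\<lambda>y. y) ?h \<in> linear_maps K ?TT T"
    by (rule tensor_map_linear[OF mods(1,2,1,1) linear_ident h])
  have id\<Delta>: "tensor_map K C T (\<lambda>y. y) \<Delta> \<in> linear_maps K T ?TT"
    by (rule tensor_map_linear[OF mods(1,1,1,2) linear_ident \<Delta>])
  have \<Delta>id: "tensor_map K T C \<Delta> (\<lambda>y. y) \<in> linear_maps K T ?TT'"
    by (rule tensor_map_linear[OF mods(1,1,2,1) \<Delta> linear_ident])
  note as = tensor_assoc_pure(1)[OF mods(1,1,1)]
  have h\<Delta>: "(\<lambda>y. ?h (\<Delta> y)) \<in> linear_maps K C C" by (rule linear_comp[OF \<Delta> h])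
  have idh\<Delta>: "tensor_map K C C (\<lambda>y. y) (\<lambda>y. ?h (\<Delta> y)) \<in> linear_maps K T T"
    by (rule tensor_map_linear[OF mods(1,1,1,1) linear_ident h\<Delta>])
  \<comment> \<open>With \<open>h(a \<otimes> b) = f(b) a\<close>, coassociativity is contracted by \<open>id \<otimes> h\<close>; its two sides become
    \<open>(id \<otimes> h \<Delta>) \<Delta>\<close> and \<open>\<Delta> h \<Delta>\<close>.\<close>
  have 1: "tensor_map K C C (\<lambda>y. y) (\<lambda>y. ?h (\<Delta> y)) t
      = tensor_map K C C (\<lambda>y. y) ?h (tensor_map K C T (\<lambda>y. y) \<Delta> t)" if "t \<in> carrier T" for t
    by (rule tensor_ext[OF mods(1,1,2) idh\<Delta> linear_comp[OF id\<Delta> idh] _ that])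
       (simp add: tensor_map_pure[OF mods(1,1,1,2) linear_ident \<Delta>]
         tensor_map_pure[OF mods(1,2,1,1) linear_ident h]
         tensor_map_pure[OF mods(1,1,1,1) linear_ident h\<Delta>] \<Delta>_closed)
  have b: "(\<lambda>u v. pure_tensor K C T u (p v w)) \<in> bilinear_maps K C C ?TT"
    if "w \<in> carrier C" for w
    using that by (intro bilinear_mapsI p_left linear_pure_left[OF mods(1,2)]
        linear_pure_right[OF mods(1,2)] linear_ident p_closed)
  have 2: "tensor_map K C C (\<lambda>y. y) ?h (tensor_assoc K C C C (pure_tensor K T C s w)) = f w \<odot>\<^bsub>T\<^esub> s"
    if s: "s \<in> carrier T" and w: "w \<in> carrier C" for s w
  proof -
    have "tensor_map K C C (\<lambda>y. y) ?h (tensor_assoc K C C C (pure_tensor K T C s w))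
        = tensor_map K C C (\<lambda>y. y) ?h (tensor_lift K ?TT (\<lambda>u v. pure_tensor K C T u (p v w)) s)"
      by (simp add: tensor_assoc_pure(2)[OF mods(1,1,1) s w])
    also have "\<dots> = f w \<odot>\<^bsub>T\<^esub> s"
      by (rule tensor_ext[OF mods(1,1,2) linear_comp[OF tensor_lift_linear[OF mods(1,1) TT b[OF w]] idh]
            linear_smult_right[OF mods(2) fc[OF w] linear_ident] _ s])
         (simp add: tensor_lift_pure[OF mods(1,1) TT b[OF w]]
           tensor_map_pure[OF mods(1,2,1,1) linear_ident h] p_closed w hp fc
           linear_maps_smult[OF p_right[OF _ linear_ident]])
    finally show ?thesis .
  qed
  have 3: "tensor_map K C C (\<lambda>y. y) ?h (tensor_assoc K C C C (tensor_map K T C \<Delta> (\<lambda>y. y) t))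
      = \<Delta> (?h t)" if "t \<in> carrier T" for t
    by (rule tensor_ext[OF mods(1,1,2) linear_comp[OF linear_comp[OF \<Delta>id as] idh]
          linear_comp[OF h \<Delta>] _ that])
       (simp add: tensor_map_pure[OF mods(1,1,2,1) \<Delta> linear_ident] 2 \<Delta>_closed hp fc
         linear_maps_smult[OF \<Delta>])
  have eq: "\<Delta> (?h (\<Delta> x)) = tensor_map K C C (\<lambda>y. y) (\<lambda>y. ?h (\<Delta> y)) (\<Delta> x)"
    using 1[OF \<Delta>_closed[OF x]] 3[OF \<Delta>_closed[OF x]] coassoc[OF x] by simp
  have rc: "right_contraction f \<in> linear_maps K C C" by (rule right_contraction_linear[OF f])
  have fe: "f e \<in> carrier K" by (rule fc[OF e_closed])
  have 4: "tensor_map K C C (\<lambda>y. y) (right_contraction f) t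
      = tensor_map K C C (\<lambda>y. y) (\<lambda>y. ?h (\<Delta> y)) t \<ominus>\<^bsub>T\<^esub> f e \<odot>\<^bsub>T\<^esub> t" if "t \<in> carrier T" for t
  proof (rule tensor_ext[OF mods(1,1,2) tensor_map_linear[OF mods(1,1,1,1) linear_ident rc]
        linear_minus[OF mods(2) idh\<Delta> linear_smult_right[OF mods(2) fe linear_ident]] _ that])
    fix v w assume v: "v \<in> carrier C" and w: "w \<in> carrier C"
    show "tensor_map K C C (\<lambda>y. y) (right_contraction f) (p v w)
      = tensor_map K C C (\<lambda>y. y) (\<lambda>y. ?h (\<Delta> y)) (p v w) \<ominus>\<^bsub>T\<^esub> f e \<odot>\<^bsub>T\<^esub> p v w"
      using v w linear_maps_closed[OF h\<Delta> w] fe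
      by (simp add: tensor_map_pure[OF mods(1,1,1,1) linear_ident rc]
          tensor_map_pure[OF mods(1,1,1,1) linear_ident h\<Delta>] right_contraction_def
          linear_maps_diff[OF mods(1,2) p_right[OF _ linear_ident]]
          linear_maps_smult[OF p_right[OF _ linear_ident]])
  qed
  show ?thesis
    unfolding 4[OF \<Delta>_closed[OF x]] eq[symmetric]
    using x fe linear_maps_closed[OF h\<Delta> x]
    by (simp add: right_contraction_def linear_maps_diff[OF mods(1,2) \<Delta>] linear_maps_smult[OF \<Delta>])
qed

lemma right_contraction_filtration:
  assumes f: "f \<in> linear_maps K C (base_space K)"
  shows "x \<in> P (Suc n) \<Longrightarrow> right_contraction f x \<in> P n"
proof (induction n arbitrary: x)
  case 0
  then obtain a where a: "a \<in> carrier K" "x = a \<odot>\<^bsub>C\<^esub> e"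
    by (auto simp: filtration_pred_simps coradical_eq)
  have fe: "f e \<in> carrier K" using linear_maps_closed[OF f e_closed] by simp
  have "right_contraction f e = \<zero>\<^bsub>C\<^esub>"
    using e_closed fe
    by (simp add: right_contraction_def comult_e C.minus_eq_zero_iff
        tensor_lift_pure[OF mods(1,1,1) functional_bilinear_right[OF f]])
  then show ?case
    using a e_closed
    by (simp add: linear_maps_smult[OF right_contraction_linear[OF f]] filtration_pred_simps)
next
  case (Suc n)
  have x: "x \<in> carrier C" by (rule filtration_closed[OF Suc.prems])
  note rc = right_contraction_linear[OF f]
  let ?M = "tensor_map K C C (\<lambda>y. y) (right_contraction f)"
  have M: "?M \<in> linear_maps K T T" by (rule tensor_map_linear[OF mods(1,1,1,1) linear_ident rc])
  note Mp = tensor_map_pure[OF mods(1,1,1,1) linear_ident rc]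
  have "left_defect (right_contraction f x) = ?M (left_defect x)"
    unfolding left_defect_def
    using x e_closed
    by (simp add: comult_right_contraction[OF f x] linear_maps_diff[OF mods(2,2) M] \<Delta>_closed
        p_closed Mp)
  moreover have "?M (left_defect x) \<in> tensor_span K C C (carrier C) (P n)"
    by (rule linear_tensor_span[OF mods(1,1,2) M
          tensor_span_submodule[OF mods(1,1) order_refl filtration_subset_carrier]
          order_refl filtration_subset_carrier _ filtration_left_defect[OF Suc.prems]])
       (simp add: Mp filtration_closed, intro tensor_span_pure Suc.IH)
  ultimately show ?case
    by (intro filtrationI linear_maps_closed[OF rc x]) simp
qed

lemma filtration_right_defect:
  assumes "x \<in> P (Suc n)"
  shows "\<Delta> x \<ominus>\<^bsub>T\<^esub> p x e \<in> tensor_span K C C (P n) (carrier C)"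
proof (rule tensor_span_detect_left[OF field_K mods(1,1) filtration_submodule])
  have x: "x \<in> carrier C" by (rule filtration_closed[OF assms])
  show "\<Delta> x \<ominus>\<^bsub>T\<^esub> p x e \<in> carrier T" using x by (simp add: \<Delta>_closed p_closed e_closed)
  fix f assume f: "f \<in> linear_maps K C (base_space K)"
  have "tensor_lift K C (\<lambda>v w. f w \<odot>\<^bsub>C\<^esub> v) (\<Delta> x \<ominus>\<^bsub>T\<^esub> p x e) = right_contraction f x"
    using x e_closed
    by (simp add: right_contraction_def \<Delta>_closed p_closed
        linear_maps_diff[OF mods(2,1) tensor_lift_linear[OF mods(1,1,1) functional_bilinear_right[OF f]]]
        tensor_lift_pure[OF mods(1,1,1) functional_bilinear_right[OF f]])
  then show "tensor_lift K C (\<lambda>v w. f w \<odot>\<^bsub>C\<^esub> v) (\<Delta> x \<ominus>\<^bsub>T\<^esub> p x e) \<in> P n"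
    using right_contraction_filtration[OF f assms] by simp
qed

lemma comult_filtration_left:
  assumes "x \<in> P (Suc n)" shows "\<Delta> x \<in> tensor_span K C C (P (Suc n)) (carrier C)"
proof -
  have x: "x \<in> carrier C" by (rule filtration_closed[OF assms])
  have "\<Delta> x \<ominus>\<^bsub>T\<^esub> p x e \<in> tensor_span K C C (P (Suc n)) (carrier C)"
    using filtration_right_defect[OF assms] tensor_span_mono[OF filtration_mono order_refl] by blast
  moreover have "p x e \<in> tensor_span K C C (P (Suc n)) (carrier C)"
    using assms by (intro tensor_span_pure e_closed)
  ultimately have "p x e \<oplus>\<^bsub>T\<^esub> (\<Delta> x \<ominus>\<^bsub>T\<^esub> p x e) \<in> tensor_span K C C (P (Suc n)) (carrier C)"
    by (intro T.submoduleE(5)[OF tensor_span_submodule[OF mods(1,1) filtration_subset_carrier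
            order_refl]])
  then show ?thesis using x by (simp add: T.add_minus_cancel \<Delta>_closed p_closed e_closed)
qed

end

section \<open>Connected algebras in Yetter-Drinfeld modules\<close>

text \<open>The vector spaces underlying tensor products and the unit object in Yetter-Drinfeld modules.\<close>

lemma linear_maps_yd_coalg_tensor:
  "linear_maps K (yd_coalg_tensor K H C D) U = linear_maps K (tensor K C D) U"
  by (simp add: linear_maps_def yd_coalg_tensor_def yd_tensor_def Let_def)

lemma carrier_yd_coalg_tensor: "carrier (yd_coalg_tensor K H C D) = carrier (tensor K C D)"
  by (simp add: yd_coalg_tensor_def yd_tensor_def Let_def)

lemma linear_maps_yd_unit:
  "linear_maps K V (yd_unit K H) = linear_maps K V (base_space K)"
  "linear_maps K (yd_unit K H) V = linear_maps K (base_space K) V"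
  by (simp_all add: linear_maps_def yd_unit_def base_space_def)

locale connected_yd_algebra =
  fixes K :: "('k, 'c) ring_scheme" and H :: "('k, 'h, 'd) hopf_scheme"
    and Q :: "('k, 'h, 'q, 'e) yd_bialg_scheme"
  assumes hopf: "hopf_algebra K H"
    and yd_coalgebra: "yd_coalgebra K H Q"
    and mul_hom: "mul Q \<in> yd_coalg_hom K H (tpower2 K H Q) Q"
    and uni_hom: "uni Q \<in> yd_coalg_hom K H (yd_unit K H) Q"
    and mul_one: "mul Q (pure_tensor K Q Q (one_of K Q) (one_of K Q)) = one_of K Q"
    and connected: "connected_bialg K Q"
begin

lemma coalgebra_Q: "coalgebra K Q (comult Q) (counit Q)"
  using yd_coalgebra by (simp add: yd_coalgebra_def)

lemma field_K: "field K" and module_Q: "module K Q" and module_H: "module K H"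
  using coalgebra_Q hopf by (auto simp: coalgebra_def hopf_algebra_def)

lemma cring_K: "cring K" using module_Q by (simp add: module_def)

lemmas module_base = module_base_space[OF cring_K]

lemma uni_linear: "uni Q \<in> linear_maps K (base_space K) Q"
  using uni_hom by (simp add: yd_coalg_hom_def yd_hom_def linear_maps_yd_unit)

lemma one_K: "\<one>\<^bsub>K\<^esub> \<in> carrier K"
  using cring_K by (simp add: cring.axioms(1) ring.ring_simprules(6))

lemma one_Q_closed: "one_of K Q \<in> carrier Q"
  using linear_maps_closed[OF uni_linear] one_K by simp

lemma comult_one: "comult Q (one_of K Q) = pure_tensor K Q Q (one_of K Q) (one_of K Q)"
  and counit_one: "counit Q (one_of K Q) = \<one>\<^bsub>K\<^esub>"
  using uni_hom one_K
    tensor_map_pure[OF module_base module_base module_Q module_Q uni_linear uni_linear, of "\<one>\<^bsub>K\<^esub>" "\<one>\<^bsub>K\<^esub>"]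
  by (auto simp: yd_coalg_hom_def yd_unit_def)

sublocale connected_coalgebra K Q "comult Q" "counit Q" "one_of K Q"
  using coalgebra_Q one_Q_closed comult_one counit_one connected
  by unfold_locales (simp_all add: connected_bialg_def)

abbreviation "HQ \<equiv> tensor K H Q"
abbreviation "pHQ \<equiv> pure_tensor K H Q"
abbreviation "TT \<equiv> tensor K T T"
abbreviation "pT \<equiv> pure_tensor K T T"
abbreviation "eQ \<equiv> one_of K Q"

lemma module_TT: "module K TT"
  by (rule module_tensor[OF mods(2,2)])

sublocale TT: module K TT by (rule module_TT)

lemma one_H: "\<one>\<^bsub>H\<^esub> \<in> carrier H"
  using hopf by (simp add: hopf_algebra_def ring.ring_simprules(6))

lemma hmult_closed: "g \<in> carrier H \<Longrightarrow> h \<in> carrier H \<Longrightarrow> g \<otimes>\<^bsub>H\<^esub> h \<in> carrier H"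
  using hopf by (simp add: hopf_algebra_def ring.ring_simprules(5))

lemma hmult_one: "h \<in> carrier H \<Longrightarrow> \<one>\<^bsub>H\<^esub> \<otimes>\<^bsub>H\<^esub> h = h"
  using hopf by (simp add: hopf_algebra_def ring.ring_simprules(12))

lemma hmult_linear_right: "g \<in> carrier H \<Longrightarrow> (\<lambda>h. g \<otimes>\<^bsub>H\<^esub> h) \<in> linear_maps K H H"
  and hmult_linear_left: "g \<in> carrier H \<Longrightarrow> (\<lambda>h. h \<otimes>\<^bsub>H\<^esub> g) \<in> linear_maps K H H"
  using hopf unfolding hopf_algebra_def
  by (auto intro!: linear_mapsI simp: ring.ring_simprules(5,13,23))

lemma hcomult_linear: "hcomult H \<in> linear_maps K H (tensor K H H)"
  and hcounit_linear: "hcounit H \<in> linear_maps K H (base_space K)"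
  and hcounit_left: "h \<in> carrier H \<Longrightarrow>
    tensor_lift K H (\<lambda>a b. hcounit H a \<odot>\<^bsub>H\<^esub> b) (hcomult H h) = h"
  using hopf by (auto simp: hopf_algebra_def coalgebra_def)

lemmas hcomult_closed = linear_maps_closed[OF hcomult_linear]
lemma hcounit_closed: "h \<in> carrier H \<Longrightarrow> hcounit H h \<in> carrier K"
  using linear_maps_closed[OF hcounit_linear] by simp

lemma act_linear: "h \<in> carrier H \<Longrightarrow> act Q h \<in> linear_maps K Q Q"
  and act_linear_left: "v \<in> carrier Q \<Longrightarrow> (\<lambda>h. act Q h v) \<in> linear_maps K H Q"
  and act_one: "v \<in> carrier Q \<Longrightarrow> act Q \<one>\<^bsub>H\<^esub> v = v"
  and coact_linear: "coact Q \<in> linear_maps K Q HQ"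
  and coact_counit: "v \<in> carrier Q \<Longrightarrow>
    tensor_lift K Q (\<lambda>a w. hcounit H a \<odot>\<^bsub>Q\<^esub> w) (coact Q v) = v"
  using yd_coalgebra
  by (auto simp: yd_coalgebra_def yetter_drinfeld_def left_module_def left_comodule_def)

lemmas coact_closed = linear_maps_closed[OF coact_linear]

lemma coact_in_span:
  "x \<in> carrier Q \<Longrightarrow> coact Q x \<in> tensor_span K H Q (carrier H) (carrier Q)"
  by (simp add: tensor_span_carrier module_H mods coact_closed)

lemma act_closed: "h \<in> carrier H \<Longrightarrow> v \<in> carrier Q \<Longrightarrow> act Q h v \<in> carrier Q"
  by (rule linear_maps_closed[OF act_linear])

lemma act_eQ: "h \<in> carrier H \<Longrightarrow> act Q h eQ = hcounit H h \<odot>\<^bsub>Q\<^esub> eQ"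
  using uni_hom one_K linear_maps_smult[OF uni_linear hcounit_closed, of h "\<one>\<^bsub>K\<^esub>"]
  by (auto simp: yd_coalg_hom_def yd_hom_def yd_unit_def)

lemma coact_eQ: "coact Q eQ = pHQ \<one>\<^bsub>H\<^esub> eQ"
  using uni_hom one_K one_H
    tensor_map_pure[OF module_H module_base module_H module_Q linear_ident uni_linear, of "\<one>\<^bsub>H\<^esub>" "\<one>\<^bsub>K\<^esub>"]
  by (auto simp: yd_coalg_hom_def yd_hom_def yd_unit_def)

lemmas pT_closed = pure_tensor_closed[OF mods(2,2)]
  and pT_left = linear_pure_left[OF mods(2,2)] and pT_right = linear_pure_right[OF mods(2,2)]

subsection \<open>The coradical filtration is stable under action and coaction\<close>

lemma diagonal_act_bilinear:
  assumes "t \<in> carrier T"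
  shows "(\<lambda>g h. tensor_map K Q Q (act Q g) (act Q h) t) \<in> bilinear_maps K H H T"
proof (rule bilinear_mapsI)
  fix g assume g: "g \<in> carrier H"
  show "(\<lambda>h. tensor_map K Q Q (act Q g) (act Q h) t) \<in> linear_maps K H T"
    unfolding tensor_map_def
    by (rule linear_lift_par[OF assms _ _ mods(1,1,2) module_H])
       (intro tensor_map_bilinear mods act_linear g p_right act_linear_left act_closed; assumption)+
  show "(\<lambda>h. tensor_map K Q Q (act Q h) (act Q g) t) \<in> linear_maps K H T"
    unfolding tensor_map_def
    by (rule linear_lift_par[OF assms _ _ mods(1,1,2) module_H])
       (intro tensor_map_bilinear mods act_linear g p_left act_linear_left act_closed; assumption)+
qed

lemma comult_act:
  assumes "h \<in> carrier H" "x \<in> carrier Q"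
  shows "comult Q (act Q h x)
    = tensor_lift K T (\<lambda>g k. tensor_map K Q Q (act Q g) (act Q k) (comult Q x)) (hcomult H h)"
  using yd_coalgebra assms by (simp add: yd_coalgebra_def yd_hom_def yd_tensor_def Let_def)

text \<open>As \<open>\<Delta>\<close> is \<open>H\<close>-linear and \<open>h 1 = \<epsilon>(h) 1\<close>, acting diagonally by \<open>h\<close> on \<open>\<Delta> x = 1 \<otimes> x + d\<close> with
  \<open>d \<in> Q \<otimes> P n\<close> gives \<open>\<Delta>(h x) = 1 \<otimes> h x + h d\<close>, where \<open>h d\<close> lies in \<open>Q \<otimes> P n\<close> by induction.\<close>

lemma filtration_act: "h \<in> carrier H \<Longrightarrow> x \<in> P n \<Longrightarrow> act Q h x \<in> P n"
proof (induction n arbitrary: h x)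
  case 0
  then show ?case
    using linear_maps_zero[OF mods(1,1) act_linear] by (simp add: filtration_pred_simps)
next
  case (Suc n)
  have x: "x \<in> carrier Q" by (rule filtration_closed[OF Suc.prems(2)])
  note h = Suc.prems(1)
  let ?S = "tensor_span K Q Q (carrier Q) (P n)"
  have S: "submodule ?S K T"
    by (rule tensor_span_submodule[OF mods(1,1) order_refl filtration_subset_carrier])
  let ?\<Psi> = "\<lambda>t. tensor_lift K T (\<lambda>g k. tensor_map K Q Q (act Q g) (act Q k) t) (hcomult H h)"
  have \<Psi>: "?\<Psi> \<in> linear_maps K T T"
    by (rule linear_lift_par[OF hcomult_closed[OF h] diagonal_act_bilinear _ module_H module_H mods(2,2)],
        assumption)
       (intro tensor_map_linear mods act_linear; assumption)
  have hc: "(\<lambda>g k. hcounit H g \<odot>\<^bsub>H\<^esub> k) \<in> bilinear_maps K H H H"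
    using hcounit_closed
    by (intro bilinear_mapsI linear_smult_left linear_smult_right linear_ident module_H hcounit_linear)
  have "?\<Psi> (p eQ x) = p eQ (act Q h x)"
  proof -
    have eq: "tensor_map K Q Q (act Q g) (act Q k) (p eQ x)
        = p eQ (act Q (hcounit H g \<odot>\<^bsub>H\<^esub> k) x)" if g: "g \<in> carrier H" and k: "k \<in> carrier H" for g k
    proof -
      have "tensor_map K Q Q (act Q g) (act Q k) (p eQ x) = p (hcounit H g \<odot>\<^bsub>Q\<^esub> eQ) (act Q k x)"
        using g k x e_closed
        by (simp add: tensor_map_pure[OF mods(1,1,1,1) act_linear act_linear] act_eQ)
      also have "\<dots> = hcounit H g \<odot>\<^bsub>T\<^esub> p eQ (act Q k x)"
        using g k x e_closed
        by (simp add: linear_maps_smult[OF p_left[OF _ linear_ident]] act_closed hcounit_closed)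
      also have "\<dots> = p eQ (hcounit H g \<odot>\<^bsub>Q\<^esub> act Q k x)"
        using g k x e_closed
        by (simp add: linear_maps_smult[OF p_right[OF _ linear_ident]] act_closed hcounit_closed)
      also have "\<dots> = p eQ (act Q (hcounit H g \<odot>\<^bsub>H\<^esub> k) x)"
        using g k x by (simp add: linear_maps_smult[OF act_linear_left] hcounit_closed)
      finally show ?thesis .
    qed
    have "?\<Psi> (p eQ x) = tensor_lift K T (\<lambda>g k. p eQ (act Q (hcounit H g \<odot>\<^bsub>H\<^esub> k) x)) (hcomult H h)"
      by (rule tensor_lift_cong[OF module_H module_H hcomult_closed[OF h] eq])
    also have "\<dots> = p eQ (act Q (tensor_lift K H (\<lambda>g k. hcounit H g \<odot>\<^bsub>H\<^esub> k) (hcomult H h)) x)"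
      by (rule linear_comp_tensor_lift[symmetric, OF module_H module_H module_H mods(2) hc
            p_right[OF e_closed act_linear_left[OF x]] hcomult_closed[OF h]])
    finally show ?thesis by (simp add: hcounit_left[OF h])
  qed
  moreover have "?\<Psi> (left_defect x) \<in> ?S"
  proof (rule linear_tensor_span[OF mods(1,1,2) \<Psi> S order_refl filtration_subset_carrier _
        filtration_left_defect[OF Suc.prems(2)]])
    fix a b assume a: "a \<in> carrier Q" and b: "b \<in> P n"
    have bc: "b \<in> carrier Q" by (rule filtration_closed[OF b])
    have hs: "hcomult H h \<in> tensor_span K H H (carrier H) (carrier H)"
      by (simp add: tensor_span_carrier module_H hcomult_closed h)
    show "?\<Psi> (p a b) \<in> ?S"
      by (rule lift_tensor_span[OF module_H module_H mods(2)
            diagonal_act_bilinear[OF p_closed[OF a bc]] S order_refl order_refl _ hs])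
         (simp add: tensor_map_pure[OF mods(1,1,1,1) act_linear act_linear a bc],
          intro tensor_span_pure act_closed a Suc.IH b)
  qed
  moreover have "comult Q (act Q h x) = ?\<Psi> (p eQ x) \<oplus>\<^bsub>T\<^esub> ?\<Psi> (left_defect x)"
    unfolding comult_act[OF h x] \<Delta>_left_defect[OF x]
    by (rule linear_maps_add[OF \<Psi>]) (simp_all add: p_closed e_closed x left_defect_closed)
  ultimately have "left_defect (act Q h x) \<in> ?S"
    using linear_maps_closed[OF \<Psi> left_defect_closed[OF x]] act_closed[OF h x] e_closed
    by (simp add: left_defect_def T.minus_eq p_closed T.a_ac T.r_neg1 T.r_neg2)
  then show ?case by (intro filtrationI act_closed h x)
qed

text \<open>Stability under the coaction means stability under the endomorphisms \<open>x \<mapsto> f(x\<^bsub>-1\<^esub>) x\<^sub>0\<close> for all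
  functionals \<open>f\<close> on \<open>H\<close>.\<close>

definition "coact_contraction f = (\<lambda>x. tensor_lift K Q (\<lambda>h v. f h \<odot>\<^bsub>Q\<^esub> v) (coact Q x))"

lemma coact_functional_bilinear:
  assumes "module K U" "g \<in> linear_maps K Q U" "f \<in> linear_maps K H (base_space K)"
  shows "(\<lambda>h v. f h \<odot>\<^bsub>U\<^esub> g v) \<in> bilinear_maps K H Q U"
  using linear_maps_closed[OF assms(3)]
  by (intro bilinear_mapsI linear_smult_left linear_smult_right linear_maps_closed[OF assms(2)] assms)
     simp_all

lemma coact_contraction_linear:
  "f \<in> linear_maps K H (base_space K) \<Longrightarrow> coact_contraction f \<in> linear_maps K Q Q"
  unfolding coact_contraction_def
  by (rule linear_lift_arg[OF coact_linear coact_functional_bilinear[OF mods(1) linear_ident]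
        module_H mods(1,1)])

text \<open>The record \<open>yd_tensor K H Q Q\<close> has the vector space structure of \<open>T\<close>, but it is another term, so
  that the colinearity of \<open>\<Delta>\<close> has to be rewritten.\<close>

lemma comult_coact:
  assumes "x \<in> carrier Q"
  shows "coact (yd_tensor K H Q Q) (comult Q x) = tensor_map K H T (\<lambda>h. h) (comult Q) (coact Q x)"
proof -
  have "tensor_map K H (yd_tensor K H Q Q) = (tensor_map K H T :: ('h \<Rightarrow> 'h) \<Rightarrow> ('q \<Rightarrow> _) \<Rightarrow> _)"
    by (simp add: fun_eq_iff tensor_map_def tensor_lift_def tensor_def pure_tensor_def
        tensor_relations_def yd_tensor_def Let_def)
  then show ?thesis using yd_coalgebra assms by (simp add: yd_coalgebra_def yd_hom_def)
qed

text \<open>Colinearity of \<open>\<Delta>\<close> expresses the comultiplication of \<open>f(x\<^bsub>-1\<^esub>) x\<^sub>0\<close> by the linear map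
  \<open>\<Xi>(v \<otimes> w) = f(v\<^bsub>-1\<^esub> w\<^bsub>-1\<^esub>) v\<^sub>0 \<otimes> w\<^sub>0\<close> applied to \<open>\<Delta> x\<close>.  For \<open>v\<close> fixed, the second factor of
  \<open>\<Xi>(v \<otimes> w)\<close> is a contraction of the coaction of \<open>w\<close> with a functional of the form \<open>f(h _)\<close>; thus the
  induction runs over all functionals at once.\<close>

lemma filtration_coact_contraction:
  "f \<in> linear_maps K H (base_space K) \<Longrightarrow> x \<in> P n \<Longrightarrow> coact_contraction f x \<in> P n"
proof (induction n arbitrary: f x)
  case 0
  then show ?case
    using linear_maps_zero[OF mods(1,1) coact_contraction_linear] by (simp add: filtration_pred_simps)
next
  case (Suc n)
  have x: "x \<in> carrier Q" by (rule filtration_closed[OF Suc.prems(2)])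
  note f = Suc.prems(1)
  let ?S = "tensor_span K Q Q (carrier Q) (P n)"
  have S: "submodule ?S K T"
    by (rule tensor_span_submodule[OF mods(1,1) order_refl filtration_subset_carrier])
  let ?HT = "tensor K H T" and ?pHT = "pure_tensor K H T"
  have HT: "module K ?HT" by (intro module_tensor module_H mods)
  have fc: "f h \<in> carrier K" if "h \<in> carrier H" for h using linear_maps_closed[OF f that] by simp
  have Lb: "(\<lambda>h t. f h \<odot>\<^bsub>T\<^esub> t) \<in> bilinear_maps K H T T"
    using fc by (intro bilinear_mapsI linear_smult_left linear_smult_right linear_ident mods f)
  let ?L = "tensor_lift K T (\<lambda>h t. f h \<odot>\<^bsub>T\<^esub> t)"
  note L = tensor_lift_linear[OF module_H mods(2,2) Lb] and Lp = tensor_lift_pure[OF module_H mods(2,2) Lb]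
  have inner: "(\<lambda>k w. ?pHT (h \<otimes>\<^bsub>H\<^esub> k) (p v w)) \<in> bilinear_maps K H Q ?HT"
    if "h \<in> carrier H" "v \<in> carrier Q" for h v
    using that by (intro bilinear_mapsI linear_pure_left[OF module_H mods(2)]
        linear_pure_right[OF module_H mods(2)] hmult_linear_right p_right linear_ident
        p_closed hmult_closed)
  let ?I = "\<lambda>w h v. tensor_lift K ?HT (\<lambda>k w. ?pHT (h \<otimes>\<^bsub>H\<^esub> k) (p v w)) (coact Q w)"
  have I: "?I w \<in> bilinear_maps K H Q ?HT" if w: "w \<in> carrier Q" for w
    by (intro bilinear_mapsI linear_lift_par[OF coact_closed[OF w] inner _ module_H mods(1) HT module_H]
        linear_lift_par[OF coact_closed[OF w] inner _ module_H mods(1) HT mods(1)]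
        linear_pure_left[OF module_H mods(2)] linear_pure_right[OF module_H mods(2)]
        hmult_linear_left p_left linear_ident p_closed hmult_closed; assumption)
  let ?B = "\<lambda>v w. tensor_lift K ?HT (?I w) (coact Q v)"
  have B: "?B \<in> bilinear_maps K Q Q ?HT"
  proof (rule bilinear_mapsI)
    fix v assume v: "v \<in> carrier Q"
    show "(\<lambda>w. ?B v w) \<in> linear_maps K Q ?HT"
      by (rule linear_lift_par[OF coact_closed[OF v] I _ module_H mods(1) HT mods(1)], assumption)
         (rule linear_lift_arg[OF coact_linear inner module_H mods(1) HT])
    show "(\<lambda>w. ?B w v) \<in> linear_maps K Q ?HT"
      by (rule linear_lift_arg[OF coact_linear I[OF v] module_H mods(1) HT])
  qed
  have coactT: "coact (yd_tensor K H Q Q) = tensor_lift K ?HT ?B"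
    by (simp add: yd_tensor_def Let_def)
  note cT = tensor_lift_linear[OF mods(1,1) HT B] and cTp = tensor_lift_pure[OF mods(1,1) HT B]
  let ?\<Xi> = "\<lambda>t. ?L (tensor_lift K ?HT ?B t)"
  have \<Xi>: "?\<Xi> \<in> linear_maps K T T" by (rule linear_comp[OF cT L])
  have LI: "?L (?I w h v) = p v (coact_contraction (\<lambda>k. f (h \<otimes>\<^bsub>H\<^esub> k)) w)"
    if h: "h \<in> carrier H" and v: "v \<in> carrier Q" and w: "w \<in> carrier Q" for h v w
  proof -
    have g: "(\<lambda>k. f (h \<otimes>\<^bsub>H\<^esub> k)) \<in> linear_maps K H (base_space K)"
      by (rule linear_comp[OF hmult_linear_right[OF h] f])
    have pv: "p v \<in> linear_maps K Q T" by (rule p_right[OF v linear_ident])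
    have "?L (?I w h v) = tensor_lift K T (\<lambda>k w. ?L (?pHT (h \<otimes>\<^bsub>H\<^esub> k) (p v w))) (coact Q w)"
      by (rule linear_comp_tensor_lift[OF module_H mods(1) HT mods(2) inner[OF h v] L coact_closed[OF w]])
    also have "\<dots> = tensor_lift K T (\<lambda>k w. f (h \<otimes>\<^bsub>H\<^esub> k) \<odot>\<^bsub>T\<^esub> p v w) (coact Q w)"
      using h v
      by (intro tensor_lift_cong[OF module_H mods(1) coact_closed[OF w]])
         (simp add: Lp hmult_closed p_closed)
    also have "\<dots> = tensor_lift K T (\<lambda>k w. p v (f (h \<otimes>\<^bsub>H\<^esub> k) \<odot>\<^bsub>Q\<^esub> w)) (coact Q w)"
      using h v fc
      by (intro tensor_lift_cong[OF module_H mods(1) coact_closed[OF w]])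
         (simp add: linear_maps_smult[OF pv] hmult_closed)
    also have "\<dots> = p v (coact_contraction (\<lambda>k. f (h \<otimes>\<^bsub>H\<^esub> k)) w)"
      unfolding coact_contraction_def
      by (rule linear_comp_tensor_lift[symmetric, OF module_H mods(1,1,2)
            coact_functional_bilinear[OF mods(1) linear_ident g] pv coact_closed[OF w]])
    finally show ?thesis .
  qed
  have "?\<Xi> (p eQ x) = p eQ (coact_contraction f x)"
  proof -
    have "?\<Xi> (p eQ x) = ?L (?I x \<one>\<^bsub>H\<^esub> eQ)"
      using x e_closed one_H
      by (simp add: cTp coact_eQ tensor_lift_pure[OF module_H mods(1) HT I[OF x]])
    also have "\<dots> = p eQ (coact_contraction (\<lambda>k. f (\<one>\<^bsub>H\<^esub> \<otimes>\<^bsub>H\<^esub> k)) x)"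
      by (rule LI[OF one_H e_closed x])
    also have "coact_contraction (\<lambda>k. f (\<one>\<^bsub>H\<^esub> \<otimes>\<^bsub>H\<^esub> k)) x = coact_contraction f x"
      unfolding coact_contraction_def
      by (rule tensor_lift_cong[OF module_H mods(1) coact_closed[OF x]])
         (simp add: hmult_one)
    finally show ?thesis .
  qed
  moreover have "?\<Xi> (left_defect x) \<in> ?S"
  proof (rule linear_tensor_span[OF mods(1,1,2) \<Xi> S order_refl filtration_subset_carrier _
        filtration_left_defect[OF Suc.prems(2)]])
    fix a b assume a: "a \<in> carrier Q" and b: "b \<in> P n"
    have bc: "b \<in> carrier Q" by (rule filtration_closed[OF b])
    have "?\<Xi> (p a b) = tensor_lift K T (\<lambda>h v. ?L (?I b h v)) (coact Q a)"
      using a bc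
      by (simp add: cTp linear_comp_tensor_lift[OF module_H mods(1) HT mods(2) I[OF bc] L coact_closed[OF a]])
    also have "\<dots> \<in> ?S"
    proof (rule lift_tensor_span[OF module_H mods(1,2) _ S order_refl order_refl _ coact_in_span[OF a]])
      show "(\<lambda>h v. ?L (?I b h v)) \<in> bilinear_maps K H Q T"
        by (intro bilinear_mapsI linear_comp[OF _ L] bilinear_mapsD[OF I[OF bc]])
      fix h v assume h: "h \<in> carrier H" and v: "v \<in> carrier Q"
      show "?L (?I b h v) \<in> ?S"
        unfolding LI[OF h v bc]
        by (intro tensor_span_pure v Suc.IH b linear_comp[OF hmult_linear_right[OF h] f])
    qed
    finally show "?\<Xi> (p a b) \<in> ?S" .
  qed
  moreover have "comult Q (coact_contraction f x) = ?\<Xi> (comult Q x)"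
  proof -
    have m: "(\<lambda>h v. ?pHT h (comult Q v)) \<in> bilinear_maps K H Q ?HT"
      by (rule tensor_map_bilinear[OF module_H mods(1) module_H mods(2) linear_ident \<Delta>])
    have "comult Q (coact_contraction f x)
        = tensor_lift K T (\<lambda>h v. comult Q (f h \<odot>\<^bsub>Q\<^esub> v)) (coact Q x)"
      unfolding coact_contraction_def
      by (rule linear_comp_tensor_lift[OF module_H mods(1,1,2)
            coact_functional_bilinear[OF mods(1) linear_ident f] \<Delta> coact_closed[OF x]])
    also have "\<dots> = tensor_lift K T (\<lambda>h v. ?L (?pHT h (comult Q v))) (coact Q x)"
      by (rule tensor_lift_cong[OF module_H mods(1) coact_closed[OF x]])
         (simp add: Lp \<Delta>_closed linear_maps_smult[OF \<Delta>] fc)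
    also have "\<dots> = ?L (tensor_map K H T (\<lambda>h. h) (comult Q) (coact Q x))"
      unfolding tensor_map_def
      by (rule linear_comp_tensor_lift[symmetric, OF module_H mods(1) HT mods(2) m L coact_closed[OF x]])
    also have "\<dots> = ?\<Xi> (comult Q x)"
      using comult_coact[OF x] by (simp add: coactT)
    finally show ?thesis .
  qed
  then have "comult Q (coact_contraction f x) = ?\<Xi> (p eQ x) \<oplus>\<^bsub>T\<^esub> ?\<Xi> (left_defect x)"
    unfolding \<Delta>_left_defect[OF x]
    by (simp add: linear_maps_add[OF \<Xi>] p_closed e_closed x left_defect_closed)
  ultimately have "left_defect (coact_contraction f x) \<in> ?S"
    using linear_maps_closed[OF \<Xi> left_defect_closed[OF x]] e_closed
      linear_maps_closed[OF coact_contraction_linear[OF f] x]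
    by (simp add: left_defect_def T.minus_eq p_closed T.a_ac T.r_neg1 T.r_neg2)
  then show ?case
    by (intro filtrationI linear_maps_closed[OF coact_contraction_linear[OF f] x])
qed

lemma filtration_coact:
  assumes "x \<in> P n" shows "coact Q x \<in> tensor_span K H Q (carrier H) (P n)"
  using filtration_coact_contraction[OF _ assms] coact_closed[OF filtration_closed[OF assms]]
  by (intro tensor_span_detect_right[OF field_K module_H mods(1) filtration_submodule])
     (simp_all add: coact_contraction_def)

end

context connected_yd_algebra
begin

subsection \<open>The comultiplication of the braided tensor square\<close>

abbreviation "Q2 \<equiv> tpower2 K H Q"

abbreviation "braid \<equiv> yd_braiding K H Q Q"

lemma braid_inner_bilinear:
  assumes "y \<in> carrier Q"
  shows "(\<lambda>h v. p (act Q h y) v) \<in> bilinear_maps K H Q T"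
  using assms by (intro bilinear_mapsI p_left p_right act_linear_left linear_ident act_closed)

lemma braid_bilinear:
  "(\<lambda>x y. tensor_lift K T (\<lambda>h v. p (act Q h y) v) (coact Q x)) \<in> bilinear_maps K Q Q T"
proof (rule bilinear_mapsI)
  fix x assume x: "x \<in> carrier Q"
  show "(\<lambda>y. tensor_lift K T (\<lambda>h v. p (act Q h y) v) (coact Q x)) \<in> linear_maps K Q T"
    by (rule linear_lift_par[OF coact_closed[OF x] braid_inner_bilinear _ module_H mods(1,2,1)],
        assumption) (intro p_left act_linear; assumption)
  show "(\<lambda>y. tensor_lift K T (\<lambda>h v. p (act Q h x) v) (coact Q y)) \<in> linear_maps K Q T"
    by (rule linear_lift_arg[OF coact_linear braid_inner_bilinear[OF x] module_H mods(1,2)])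
qed

lemma braid_linear: "braid \<in> linear_maps K T T"
  unfolding yd_braiding_def by (rule tensor_lift_linear[OF mods(1,1,2) braid_bilinear])

lemma braid_pure:
  "x \<in> carrier Q \<Longrightarrow> y \<in> carrier Q \<Longrightarrow>
    braid (p x y) = tensor_lift K T (\<lambda>h v. p (act Q h y) v) (coact Q x)"
  unfolding yd_braiding_def by (rule tensor_lift_pure[OF mods(1,1,2) braid_bilinear])

lemmas braid_closed = linear_maps_closed[OF braid_linear]

text \<open>The value of \<open>id \<otimes> c \<otimes> id\<close> on \<open>(x\<^sub>1 \<otimes> x\<^sub>2) \<otimes> (y\<^sub>1 \<otimes> y\<^sub>2)\<close>.\<close>

definition "middle_braid x\<^sub>1 x\<^sub>2 y\<^sub>1 y\<^sub>2 =
  tensor_lift K TT (\<lambda>y' x'. pT (p x\<^sub>1 y') (p x' y\<^sub>2)) (braid (p x\<^sub>2 y\<^sub>1))"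

lemma middle_inner_bilinear:
  assumes "x \<in> carrier Q" "y \<in> carrier Q"
  shows "(\<lambda>y' x'. pT (p x y') (p x' y)) \<in> bilinear_maps K Q Q TT"
  using assms by (intro bilinear_mapsI pT_left pT_right p_left p_right linear_ident p_closed)

lemma middle_braid_linear:
  assumes "a \<in> carrier Q" "b \<in> carrier Q" "c \<in> carrier Q"
  shows "(\<lambda>x. middle_braid x a b c) \<in> linear_maps K Q TT"
    and "(\<lambda>x. middle_braid a x b c) \<in> linear_maps K Q TT"
    and "(\<lambda>x. middle_braid a b x c) \<in> linear_maps K Q TT"
    and "(\<lambda>x. middle_braid a b c x) \<in> linear_maps K Q TT"
proof -
  show "(\<lambda>x. middle_braid x a b c) \<in> linear_maps K Q TT"
    unfolding middle_braid_def
    by (rule linear_lift_par[OF braid_closed middle_inner_bilinear _ mods(1,1) module_TT mods(1)])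
       (assumption | intro p_closed assms pT_left p_left linear_ident)+
  show "(\<lambda>x. middle_braid a b c x) \<in> linear_maps K Q TT"
    unfolding middle_braid_def
    by (rule linear_lift_par[OF braid_closed middle_inner_bilinear _ mods(1,1) module_TT mods(1)])
       (assumption | intro p_closed assms pT_right p_right linear_ident)+
  show "(\<lambda>x. middle_braid a x b c) \<in> linear_maps K Q TT"
    unfolding middle_braid_def
    by (rule linear_lift_arg[OF linear_comp[OF p_left[OF assms(2) linear_ident] braid_linear]
          middle_inner_bilinear[OF assms(1,3)] mods(1,1) module_TT])
  show "(\<lambda>x. middle_braid a b x c) \<in> linear_maps K Q TT"
    unfolding middle_braid_def
    by (rule linear_lift_arg[OF linear_comp[OF p_right[OF assms(2) linear_ident] braid_linear]
          middle_inner_bilinear[OF assms(1,3)] mods(1,1) module_TT])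
qed

lemma middle_inner_coact_bilinear:
  assumes "x\<^sub>1 \<in> carrier Q" "y\<^sub>1 \<in> carrier Q" "y\<^sub>2 \<in> carrier Q"
  shows "(\<lambda>h v. pT (p x\<^sub>1 (act Q h y\<^sub>1)) (p v y\<^sub>2)) \<in> bilinear_maps K H Q TT"
  using assms
  by (intro bilinear_mapsI pT_left pT_right p_left p_right act_linear_left linear_ident
      p_closed act_closed)

lemma middle_braid_eq:
  assumes "x\<^sub>1 \<in> carrier Q" "x\<^sub>2 \<in> carrier Q" "y\<^sub>1 \<in> carrier Q" "y\<^sub>2 \<in> carrier Q"
  shows "middle_braid x\<^sub>1 x\<^sub>2 y\<^sub>1 y\<^sub>2
    = tensor_lift K TT (\<lambda>h v. pT (p x\<^sub>1 (act Q h y\<^sub>1)) (p v y\<^sub>2)) (coact Q x\<^sub>2)"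
proof -
  note mb = middle_inner_bilinear[OF assms(1,4)]
  let ?M = "tensor_lift K TT (\<lambda>y' x'. pT (p x\<^sub>1 y') (p x' y\<^sub>2))"
  have M: "?M \<in> linear_maps K T TT" by (rule tensor_lift_linear[OF mods(1,1) module_TT mb])
  have "middle_braid x\<^sub>1 x\<^sub>2 y\<^sub>1 y\<^sub>2 = ?M (tensor_lift K T (\<lambda>h v. p (act Q h y\<^sub>1) v) (coact Q x\<^sub>2))"
    by (simp add: middle_braid_def braid_pure assms)
  also have "\<dots> = tensor_lift K TT (\<lambda>h v. ?M (p (act Q h y\<^sub>1) v)) (coact Q x\<^sub>2)"
    by (rule linear_comp_tensor_lift[OF module_H mods(1,2) module_TT
          braid_inner_bilinear[OF assms(3)] M coact_closed[OF assms(2)]])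
  also have "\<dots> = tensor_lift K TT (\<lambda>h v. pT (p x\<^sub>1 (act Q h y\<^sub>1)) (p v y\<^sub>2)) (coact Q x\<^sub>2)"
    by (rule tensor_lift_cong[OF module_H mods(1) coact_closed[OF assms(2)]])
       (simp add: tensor_lift_pure[OF mods(1,1) module_TT mb] act_closed assms)
  finally show ?thesis .
qed

text \<open>Which subspace contains the braided tensor is decided by where the coaction of \<open>x\<^sub>2\<close> lands: in
  \<open>H \<otimes> P n\<close> if \<open>x\<^sub>2 \<in> P n\<close>, and in \<open>H \<otimes> Q\<close> in general.\<close>

lemma middle_braid_mem:
  assumes "x\<^sub>1 \<in> carrier Q" "x\<^sub>2 \<in> carrier Q" "y\<^sub>1 \<in> carrier Q" "y\<^sub>2 \<in> carrier Q"
    and "submodule N K TT" "X \<subseteq> carrier Q" "coact Q x\<^sub>2 \<in> tensor_span K H Q (carrier H) X"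
    and "\<And>h v. h \<in> carrier H \<Longrightarrow> v \<in> X \<Longrightarrow> pT (p x\<^sub>1 (act Q h y\<^sub>1)) (p v y\<^sub>2) \<in> N"
  shows "middle_braid x\<^sub>1 x\<^sub>2 y\<^sub>1 y\<^sub>2 \<in> N"
  unfolding middle_braid_eq[OF assms(1-4)]
  by (rule lift_tensor_span[OF module_H mods(1) module_TT middle_inner_coact_bilinear[OF assms(1,3,4)]
        assms(5) order_refl assms(6,8,7)])

text \<open>Moving \<open>1\<close> through the braiding, as its second or first argument, is the flip: the action of
  \<open>H\<close> on \<open>1\<close> is by the counit, and the coaction of \<open>1\<close> is \<open>1 \<otimes> 1\<close>.\<close>

lemma middle_braid_one_first:
  assumes "x \<in> carrier Q" "y \<in> carrier Q"
  shows "middle_braid eQ x eQ y = pT (p eQ eQ) (p x y)"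
proof -
  have cb: "(\<lambda>h v. hcounit H h \<odot>\<^bsub>Q\<^esub> v) \<in> bilinear_maps K H Q Q"
    by (rule coact_functional_bilinear[OF mods(1) linear_ident hcounit_linear])
  have l: "(\<lambda>v. pT (p eQ eQ) (p v y)) \<in> linear_maps K Q TT"
    by (intro pT_right p_left linear_ident p_closed e_closed assms)
  have "middle_braid eQ x eQ y
      = tensor_lift K TT (\<lambda>h v. pT (p eQ eQ) (p (hcounit H h \<odot>\<^bsub>Q\<^esub> v) y)) (coact Q x)"
    unfolding middle_braid_eq[OF e_closed assms(1) e_closed assms(2)]
  proof (rule tensor_lift_cong[OF module_H mods(1) coact_closed[OF assms(1)]])
    fix h v assume h: "h \<in> carrier H" and v: "v \<in> carrier Q"
    have "pT (p eQ (act Q h eQ)) (p v y) = hcounit H h \<odot>\<^bsub>TT\<^esub> pT (p eQ eQ) (p v y)"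
      using h v assms e_closed
      by (simp add: act_eQ linear_maps_smult[OF p_right[OF _ linear_ident]] hcounit_closed p_closed
          linear_maps_smult[OF pT_left[OF _ linear_ident]])
    also have "\<dots> = pT (p eQ eQ) (p (hcounit H h \<odot>\<^bsub>Q\<^esub> v) y)"
      using h v by (simp add: linear_maps_smult[OF l] hcounit_closed)
    finally show "pT (p eQ (act Q h eQ)) (p v y) = pT (p eQ eQ) (p (hcounit H h \<odot>\<^bsub>Q\<^esub> v) y)" .
  qed
  also have "\<dots> = pT (p eQ eQ) (p (tensor_lift K Q (\<lambda>h v. hcounit H h \<odot>\<^bsub>Q\<^esub> v) (coact Q x)) y)"
    by (rule linear_comp_tensor_lift[symmetric, OF module_H mods(1,1) module_TT cb l
          coact_closed[OF assms(1)]])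
  finally show ?thesis by (simp add: coact_counit assms)
qed

lemma middle_braid_one_second:
  assumes "x\<^sub>1 \<in> carrier Q" "y\<^sub>1 \<in> carrier Q" "y\<^sub>2 \<in> carrier Q"
  shows "middle_braid x\<^sub>1 eQ y\<^sub>1 y\<^sub>2 = pT (p x\<^sub>1 y\<^sub>1) (p eQ y\<^sub>2)"
  by (simp add: middle_braid_eq assms e_closed coact_eQ act_one one_H
      tensor_lift_pure[OF module_H mods(1) module_TT middle_inner_coact_bilinear[OF assms]])

text \<open>The comultiplication of \<open>x \<otimes> y\<close> with \<open>\<Delta> x\<close> replaced by \<open>x\<^sub>1 \<otimes> x\<^sub>2\<close>.\<close>

definition "middle_comult x\<^sub>1 x\<^sub>2 y = tensor_lift K TT (middle_braid x\<^sub>1 x\<^sub>2) (comult Q y)"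

lemma middle_braid_bilinear:
  assumes "x\<^sub>1 \<in> carrier Q" "x\<^sub>2 \<in> carrier Q"
  shows "middle_braid x\<^sub>1 x\<^sub>2 \<in> bilinear_maps K Q Q TT"
  using assms by (intro bilinear_mapsI middle_braid_linear)

lemma middle_comult_bilinear:
  assumes "y \<in> carrier Q"
  shows "(\<lambda>x\<^sub>1 x\<^sub>2. middle_comult x\<^sub>1 x\<^sub>2 y) \<in> bilinear_maps K Q Q TT"
proof (rule bilinear_mapsI)
  fix x assume x: "x \<in> carrier Q"
  show "(\<lambda>x\<^sub>2. middle_comult x x\<^sub>2 y) \<in> linear_maps K Q TT"
    unfolding middle_comult_def
    by (rule linear_lift_par[OF \<Delta>_closed[OF assms] middle_braid_bilinear[OF x] _ mods(1,1) module_TT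
          mods(1)], assumption) (intro middle_braid_linear x; assumption)
  show "(\<lambda>x\<^sub>1. middle_comult x\<^sub>1 x y) \<in> linear_maps K Q TT"
    unfolding middle_comult_def
    by (rule linear_lift_par[OF \<Delta>_closed[OF assms] middle_braid_bilinear[OF _ x] _ mods(1,1) module_TT
          mods(1)], assumption) (intro middle_braid_linear x; assumption)
qed

lemma middle_comult_linear:
  assumes "x\<^sub>1 \<in> carrier Q" "x\<^sub>2 \<in> carrier Q"
  shows "middle_comult x\<^sub>1 x\<^sub>2 \<in> linear_maps K Q TT"
  unfolding middle_comult_def[abs_def]
  by (rule linear_lift_arg[OF \<Delta> middle_braid_bilinear[OF assms] mods(1,1) module_TT])

lemma comult_Q2_bilinear:
  "(\<lambda>x y. tensor_lift K TT (\<lambda>x\<^sub>1 x\<^sub>2. middle_comult x\<^sub>1 x\<^sub>2 y) (comult Q x)) \<in> bilinear_maps K Q Q TT"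
proof (rule bilinear_mapsI)
  fix x assume x: "x \<in> carrier Q"
  show "(\<lambda>y. tensor_lift K TT (\<lambda>x\<^sub>1 x\<^sub>2. middle_comult x\<^sub>1 x\<^sub>2 y) (comult Q x)) \<in> linear_maps K Q TT"
    by (rule linear_lift_par[OF \<Delta>_closed[OF x] middle_comult_bilinear _ mods(1,1) module_TT
          mods(1)], assumption) (rule middle_comult_linear)
  show "(\<lambda>y. tensor_lift K TT (\<lambda>x\<^sub>1 x\<^sub>2. middle_comult x\<^sub>1 x\<^sub>2 x) (comult Q y)) \<in> linear_maps K Q TT"
    by (rule linear_lift_arg[OF \<Delta> middle_comult_bilinear[OF x] mods(1,1) module_TT])
qed

lemma comult_Q2_eq: "comult Q2 = tensor_lift K TT
    (\<lambda>x y. tensor_lift K TT (\<lambda>x\<^sub>1 x\<^sub>2. middle_comult x\<^sub>1 x\<^sub>2 y) (comult Q x))"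
  by (simp add: yd_coalg_tensor_def Let_def middle_comult_def middle_braid_def[abs_def])

lemma comult_Q2_linear: "comult Q2 \<in> linear_maps K T TT"
  unfolding comult_Q2_eq by (rule tensor_lift_linear[OF mods(1,1) module_TT comult_Q2_bilinear])

lemma comult_Q2_pure:
  "x \<in> carrier Q \<Longrightarrow> y \<in> carrier Q \<Longrightarrow>
    comult Q2 (p x y) = tensor_lift K TT (\<lambda>x\<^sub>1 x\<^sub>2. middle_comult x\<^sub>1 x\<^sub>2 y) (comult Q x)"
  unfolding comult_Q2_eq by (rule tensor_lift_pure[OF mods(1,1) module_TT comult_Q2_bilinear])

text \<open>Generators of a subspace of filtration degree one less than that of \<open>P (Suc a) \<otimes> P (Suc b)\<close>.\<close>

definition "lower_tensors a b =
  {p u v | u v. u \<in> P a \<and> v \<in> P (Suc b) \<or> u \<in> P (Suc a) \<and> v \<in> P b}"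

lemma lower_tensors_subset: "lower_tensors a b \<subseteq> carrier T"
  unfolding lower_tensors_def using filtration_closed p_closed by auto

text \<open>Split \<open>\<Delta> x = 1 \<otimes> x + d\<close> and \<open>\<Delta> y = 1 \<otimes> y + d'\<close> with \<open>d \<in> Q \<otimes> P a\<close> and \<open>d' \<in> Q \<otimes> P b\<close>.  The leading
  terms braid to \<open>(1 \<otimes> 1) \<otimes> (x \<otimes> y)\<close>.  In all other terms \<open>x\<^sub>2\<close> or \<open>y\<^sub>2\<close> has dropped in degree, and the
  braiding keeps the degree of \<open>x\<^sub>2\<close> because the filtration is stable under the coaction.\<close>

lemma comult_Q2_left:
  assumes x: "x \<in> P (Suc a)" and y: "y \<in> P (Suc b)"
  obtains s where "s \<in> tensor_span K T T (carrier T) (lower_tensors a b)"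
    and "comult Q2 (p x y) = pT (p eQ eQ) (p x y) \<oplus>\<^bsub>TT\<^esub> s"
proof -
  let ?S = "tensor_span K T T (carrier T) (lower_tensors a b)"
  have S: "submodule ?S K TT"
    by (rule tensor_span_submodule[OF mods(2,2) order_refl lower_tensors_subset])
  have xc: "x \<in> carrier Q" and yc: "y \<in> carrier Q" using x y filtration_closed by auto
  note Pc = filtration_subset_carrier
  let ?s1 = "tensor_lift K TT (\<lambda>x\<^sub>1 x\<^sub>2. middle_comult x\<^sub>1 x\<^sub>2 y) (left_defect x)"
  let ?s2 = "tensor_lift K TT (middle_braid eQ x) (left_defect y)"
  have s1: "?s1 \<in> ?S"
  proof (rule lift_tensor_span[OF mods(1,1) module_TT middle_comult_bilinear[OF yc] S order_refl Pc _
        filtration_left_defect[OF x]])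
    fix x\<^sub>1 x\<^sub>2 assume x1: "x\<^sub>1 \<in> carrier Q" and x2: "x\<^sub>2 \<in> P a"
    note x2c = filtration_closed[OF x2]
    show "middle_comult x\<^sub>1 x\<^sub>2 y \<in> ?S"
      unfolding middle_comult_def
    proof (rule lift_tensor_span[OF mods(1,1) module_TT middle_braid_bilinear[OF x1 x2c] S order_refl Pc _
          comult_filtration_right[OF y]])
      fix y\<^sub>1 y\<^sub>2 assume y1: "y\<^sub>1 \<in> carrier Q" and y2: "y\<^sub>2 \<in> P (Suc b)"
      show "middle_braid x\<^sub>1 x\<^sub>2 y\<^sub>1 y\<^sub>2 \<in> ?S"
      proof (rule middle_braid_mem[OF x1 x2c y1 filtration_closed[OF y2] S Pc
            filtration_coact[OF x2]])
        fix h v assume h: "h \<in> carrier H" and v: "v \<in> P a"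
        have "p v y\<^sub>2 \<in> lower_tensors a b" unfolding lower_tensors_def using v y2 by blast
        then show "pT (p x\<^sub>1 (act Q h y\<^sub>1)) (p v y\<^sub>2) \<in> ?S"
          by (intro tensor_span_pure p_closed act_closed x1 h y1)
      qed
    qed
  qed
  have s2: "?s2 \<in> ?S"
  proof (rule lift_tensor_span[OF mods(1,1) module_TT middle_braid_bilinear[OF e_closed xc] S order_refl
        Pc _ filtration_left_defect[OF y]])
    fix y\<^sub>1 y\<^sub>2 assume y1: "y\<^sub>1 \<in> carrier Q" and y2: "y\<^sub>2 \<in> P b"
    show "middle_braid eQ x y\<^sub>1 y\<^sub>2 \<in> ?S"
    proof (rule middle_braid_mem[OF e_closed xc y1 filtration_closed[OF y2] S Pc
          filtration_coact[OF x]])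
      fix h v assume h: "h \<in> carrier H" and v: "v \<in> P (Suc a)"
      have "p v y\<^sub>2 \<in> lower_tensors a b" unfolding lower_tensors_def using v y2 by blast
      then show "pT (p eQ (act Q h y\<^sub>1)) (p v y\<^sub>2) \<in> ?S"
        by (intro tensor_span_pure p_closed act_closed e_closed h y1)
    qed
  qed
  have sc: "?s1 \<in> carrier TT" "?s2 \<in> carrier TT"
    using s1 s2 TT.submoduleE(1)[OF S] by auto
  have "middle_comult eQ x y = middle_braid eQ x eQ y \<oplus>\<^bsub>TT\<^esub> ?s2"
    unfolding middle_comult_def \<Delta>_left_defect[OF yc]
    using linear_maps_add[OF tensor_lift_linear[OF mods(1,1) module_TT middle_braid_bilinear[OF e_closed xc]]]
    by (simp add: tensor_lift_pure[OF mods(1,1) module_TT middle_braid_bilinear[OF e_closed xc]]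
        p_closed e_closed yc left_defect_closed)
  moreover have "comult Q2 (p x y) = middle_comult eQ x y \<oplus>\<^bsub>TT\<^esub> ?s1"
    unfolding comult_Q2_pure[OF xc yc] \<Delta>_left_defect[OF xc]
    using linear_maps_add[OF tensor_lift_linear[OF mods(1,1) module_TT middle_comult_bilinear[OF yc]]]
    by (simp add: tensor_lift_pure[OF mods(1,1) module_TT middle_comult_bilinear[OF yc]]
        p_closed e_closed xc left_defect_closed)
  ultimately have "comult Q2 (p x y) = pT (p eQ eQ) (p x y) \<oplus>\<^bsub>TT\<^esub> (?s2 \<oplus>\<^bsub>TT\<^esub> ?s1)"
    using sc by (simp add: middle_braid_one_first xc yc TT.a_assoc pT_closed p_closed e_closed)
  then show thesis using that TT.submoduleE(5)[OF S s2 s1] by blast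
qed

text \<open>The mirror image, with the right defects.  Now \<open>x\<^sub>1\<close> or \<open>y\<^sub>1\<close> drops in degree, and the braiding
  keeps the degree of \<open>y\<^sub>1\<close> because the filtration is stable under the action.\<close>

lemma comult_Q2_right:
  assumes x: "x \<in> P (Suc a)" and y: "y \<in> P (Suc b)"
  obtains s where "s \<in> tensor_span K T T (lower_tensors a b) (carrier T)"
    and "comult Q2 (p x y) = pT (p x y) (p eQ eQ) \<oplus>\<^bsub>TT\<^esub> s"
proof -
  let ?S = "tensor_span K T T (lower_tensors a b) (carrier T)"
  have S: "submodule ?S K TT"
    by (rule tensor_span_submodule[OF mods(2,2) lower_tensors_subset order_refl])
  have xc: "x \<in> carrier Q" and yc: "y \<in> carrier Q" using x y filtration_closed by auto
  note Pc = filtration_subset_carrier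
  let ?r = "\<lambda>x. comult Q x \<ominus>\<^bsub>T\<^esub> p x eQ"
  have \<Delta>r: "comult Q x = p x eQ \<oplus>\<^bsub>T\<^esub> ?r x" and rc: "?r x \<in> carrier T" if "x \<in> carrier Q" for x
    using that by (simp_all add: T.add_minus_cancel \<Delta>_closed p_closed e_closed)
  let ?s1 = "tensor_lift K TT (\<lambda>x\<^sub>1 x\<^sub>2. middle_comult x\<^sub>1 x\<^sub>2 y) (?r x)"
  let ?s2 = "tensor_lift K TT (middle_braid x eQ) (?r y)"
  have s1: "?s1 \<in> ?S"
  proof (rule lift_tensor_span[OF mods(1,1) module_TT middle_comult_bilinear[OF yc] S Pc order_refl _
        filtration_right_defect[OF x]])
    fix x\<^sub>1 x\<^sub>2 assume x1: "x\<^sub>1 \<in> P a" and x2: "x\<^sub>2 \<in> carrier Q"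
    note x1c = filtration_closed[OF x1]
    show "middle_comult x\<^sub>1 x\<^sub>2 y \<in> ?S"
      unfolding middle_comult_def
    proof (rule lift_tensor_span[OF mods(1,1) module_TT middle_braid_bilinear[OF x1c x2] S Pc order_refl _
          comult_filtration_left[OF y]])
      fix y\<^sub>1 y\<^sub>2 assume y1: "y\<^sub>1 \<in> P (Suc b)" and y2: "y\<^sub>2 \<in> carrier Q"
      show "middle_braid x\<^sub>1 x\<^sub>2 y\<^sub>1 y\<^sub>2 \<in> ?S"
      proof (rule middle_braid_mem[OF x1c x2 filtration_closed[OF y1] y2 S order_refl
            coact_in_span[OF x2]])
        fix h v assume h: "h \<in> carrier H" and v: "v \<in> carrier Q"
        have "p x\<^sub>1 (act Q h y\<^sub>1) \<in> lower_tensors a b"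
          unfolding lower_tensors_def using x1 filtration_act[OF h y1] by blast
        then show "pT (p x\<^sub>1 (act Q h y\<^sub>1)) (p v y\<^sub>2) \<in> ?S"
          by (intro tensor_span_pure p_closed v y2)
      qed
    qed
  qed
  have s2: "?s2 \<in> ?S"
  proof (rule lift_tensor_span[OF mods(1,1) module_TT middle_braid_bilinear[OF xc e_closed] S Pc
        order_refl _ filtration_right_defect[OF y]])
    fix y\<^sub>1 y\<^sub>2 assume y1: "y\<^sub>1 \<in> P b" and y2: "y\<^sub>2 \<in> carrier Q"
    have "p x y\<^sub>1 \<in> lower_tensors a b" unfolding lower_tensors_def using x y1 by blast
    then show "middle_braid x eQ y\<^sub>1 y\<^sub>2 \<in> ?S"
      unfolding middle_braid_one_second[OF xc filtration_closed[OF y1] y2]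
      by (intro tensor_span_pure p_closed e_closed y2)
  qed
  have sc: "?s1 \<in> carrier TT" "?s2 \<in> carrier TT"
    using s1 s2 TT.submoduleE(1)[OF S] by auto
  have "middle_comult x eQ y = middle_braid x eQ y eQ \<oplus>\<^bsub>TT\<^esub> ?s2"
    using linear_maps_add[OF tensor_lift_linear[OF mods(1,1) module_TT
          middle_braid_bilinear[OF xc e_closed]] p_closed[OF yc e_closed] rc[OF yc]]
    unfolding middle_comult_def \<Delta>r[OF yc, symmetric]
    by (simp add: tensor_lift_pure[OF mods(1,1) module_TT middle_braid_bilinear[OF xc e_closed]]
        e_closed yc)
  moreover have "comult Q2 (p x y) = middle_comult x eQ y \<oplus>\<^bsub>TT\<^esub> ?s1"
    using linear_maps_add[OF tensor_lift_linear[OF mods(1,1) module_TT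
          middle_comult_bilinear[OF yc]] p_closed[OF xc e_closed] rc[OF xc]]
    unfolding comult_Q2_pure[OF xc yc] \<Delta>r[OF xc, symmetric]
    by (simp add: tensor_lift_pure[OF mods(1,1) module_TT middle_comult_bilinear[OF yc]]
        e_closed xc)
  ultimately have "comult Q2 (p x y) = pT (p x y) (p eQ eQ) \<oplus>\<^bsub>TT\<^esub> (?s2 \<oplus>\<^bsub>TT\<^esub> ?s1)"
    using sc by (simp add: middle_braid_one_second xc yc TT.a_assoc pT_closed p_closed e_closed)
  then show thesis using that TT.submoduleE(5)[OF S s2 s1] by blast
qed

subsection \<open>Filtered products and convolution with normalised functionals\<close>

definition "filtered_product g \<longleftrightarrow> g \<in> linear_maps K T Q \<and>
  (\<forall>a b. \<forall>x\<in>P (Suc a). \<forall>y\<in>P (Suc b). g (p x y) \<in> P (Suc (a + b)))"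

text \<open>The hypothesis concerns smaller degrees only, so that the lemma can also be used inside the
  induction proving that the product is filtered.\<close>

lemma lower_tensors_image:
  assumes g: "g \<in> linear_maps K T Q"
    and step: "\<And>a' b' x y. a' + b' < a + b \<Longrightarrow> x \<in> P (Suc a') \<Longrightarrow> y \<in> P (Suc b') \<Longrightarrow>
      g (p x y) \<in> P (Suc (a' + b'))"
    and t: "t \<in> lower_tensors a b"
  shows "g t \<in> P (a + b)"
proof -
  obtain u v where uv: "t = p u v" "u \<in> P a \<and> v \<in> P (Suc b) \<or> u \<in> P (Suc a) \<and> v \<in> P b"
    using t unfolding lower_tensors_def by blast
  have zero: "g (p \<zero>\<^bsub>Q\<^esub> w) = \<zero>\<^bsub>Q\<^esub>" "g (p w \<zero>\<^bsub>Q\<^esub>) = \<zero>\<^bsub>Q\<^esub>" if "w \<in> carrier Q" for w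
    using that linear_maps_zero[OF mods(2,1) g] linear_maps_zero[OF mods(1,2) p_left[OF that linear_ident]]
      linear_maps_zero[OF mods(1,2) p_right[OF that linear_ident]] by simp_all
  note z = submodule_zero_mem[OF filtration_submodule, of "a + b"]
  from uv(2) show ?thesis
  proof
    assume h: "u \<in> P a \<and> v \<in> P (Suc b)"
    then have v: "v \<in> carrier Q" using filtration_closed by blast
    show ?thesis
    proof (cases a)
      case 0
      then have "u = \<zero>\<^bsub>Q\<^esub>" using h by (simp add: filtration_pred_simps)
      then show ?thesis using z zero(1)[OF v] uv(1) by simp
    next
      case (Suc a')
      then show ?thesis using step[of a' b u v] h uv(1) by simp
    qed
  next
    assume h: "u \<in> P (Suc a) \<and> v \<in> P b"
    then have u: "u \<in> carrier Q" using filtration_closed by blast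
    show ?thesis
    proof (cases b)
      case 0
      then have "v = \<zero>\<^bsub>Q\<^esub>" using h by (simp add: filtration_pred_simps)
      then show ?thesis using z zero(2)[OF u] uv(1) by simp
    next
      case (Suc b')
      then show ?thesis using step[of a b' u v] h uv(1) by simp
    qed
  qed
qed

lemma filtered_product_lower:
  "filtered_product g \<Longrightarrow> t \<in> lower_tensors a b \<Longrightarrow> g t \<in> P (a + b)"
  using lower_tensors_image unfolding filtered_product_def by blast

lemma mul_linear: "mul Q \<in> linear_maps K T Q"
  using mul_hom by (simp add: yd_coalg_hom_def yd_hom_def linear_maps_yd_coalg_tensor)

lemma comult_mul: "t \<in> carrier T \<Longrightarrow> comult Q (mul Q t) = tensor_map K Q Q (mul Q) (mul Q) (comult Q2 t)"
  using mul_hom by (simp add: yd_coalg_hom_def carrier_yd_coalg_tensor)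

text \<open>Since \<open>m\<close> is a coalgebra map and \<open>1 1 = 1\<close>, applying \<open>m \<otimes> m\<close> to the left formula for the
  comultiplication of \<open>x \<otimes> y\<close> shows that the left defect of \<open>m(x \<otimes> y)\<close> lies in
  \<open>Q \<otimes> m(F)\<close>, where \<open>F\<close> is spanned by products of smaller degree.\<close>

lemma mul_filtration: "x \<in> P (Suc a) \<Longrightarrow> y \<in> P (Suc b) \<Longrightarrow> mul Q (p x y) \<in> P (Suc (a + b))"
proof (induction "a + b" arbitrary: a b x y rule: less_induct)
  case less
  have xc: "x \<in> carrier Q" and yc: "y \<in> carrier Q" using less.prems filtration_closed by auto
  have z: "p x y \<in> carrier T" by (rule p_closed[OF xc yc])
  let ?M = "tensor_map K Q Q (mul Q) (mul Q)"
  have M: "?M \<in> linear_maps K TT T" by (rule tensor_map_linear[OF mods(2,2,1,1) mul_linear mul_linear])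
  note Mp = tensor_map_pure[OF mods(2,2,1,1) mul_linear mul_linear]
  let ?R = "tensor_span K Q Q (carrier Q) (P (a + b))"
  have R: "submodule ?R K T"
    by (rule tensor_span_submodule[OF mods(1,1) order_refl filtration_subset_carrier])
  obtain s where s: "s \<in> tensor_span K T T (carrier T) (lower_tensors a b)"
    "comult Q2 (p x y) = pT (p eQ eQ) (p x y) \<oplus>\<^bsub>TT\<^esub> s"
    by (rule comult_Q2_left[OF less.prems])
  have sc: "s \<in> carrier TT"
    using s(1) tensor_span_subset[OF mods(2,2) order_refl lower_tensors_subset] by blast
  have Ms: "?M s \<in> ?R"
  proof (rule linear_tensor_span[OF mods(2,2,2) M R order_refl lower_tensors_subset _ s(1)])
    fix t t' assume t: "t \<in> carrier T" and t': "t' \<in> lower_tensors a b"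
    have "mul Q t' \<in> P (a + b)" by (rule lower_tensors_image[OF mul_linear less.hyps t'])
    then show "?M (pT t t') \<in> ?R"
      using t lower_tensors_subset t' linear_maps_closed[OF mul_linear t]
      by (subst Mp) (auto intro: tensor_span_pure)
  qed
  have mc: "mul Q (p x y) \<in> carrier Q" by (rule linear_maps_closed[OF mul_linear z])
  have "comult Q (mul Q (p x y)) = p eQ (mul Q (p x y)) \<oplus>\<^bsub>T\<^esub> ?M s"
    unfolding comult_mul[OF z] s(2) using sc z
    by (simp add: linear_maps_add[OF M] Mp pT_closed p_closed e_closed mul_one)
  then have "left_defect (mul Q (p x y)) = ?M s"
    using mc linear_maps_closed[OF M sc] e_closed
    by (simp add: left_defect_def T.minus_eq p_closed T.a_ac T.r_neg T.r_neg1 T.r_neg2)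
  then show ?case using Ms mc by (intro filtrationI) simp_all
qed

lemma filtered_product_mul: "filtered_product (mul Q)"
  unfolding filtered_product_def using mul_linear mul_filtration by blast

definition "left_conv f g = convolution K Q2 Q (\<lambda>a x. a \<odot>\<^bsub>Q\<^esub> x) f g"
definition "right_conv g f = convolution K Q2 Q (\<lambda>x a. a \<odot>\<^bsub>Q\<^esub> x) g f"

lemma conv_bilinear:
  assumes f: "f \<in> linear_maps K T (base_space K)" and g: "g \<in> linear_maps K T Q"
  shows "(\<lambda>s t. f s \<odot>\<^bsub>Q\<^esub> g t) \<in> bilinear_maps K T T Q"
    and "(\<lambda>s t. f t \<odot>\<^bsub>Q\<^esub> g s) \<in> bilinear_maps K T T Q"
  using linear_maps_closed[OF f] linear_maps_closed[OF g]
  by (auto intro!: bilinear_mapsI linear_smult_left[OF mods(1)] linear_smult_right[OF mods(1)] f g)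

lemma conv_linear:
  assumes f: "f \<in> linear_maps K T (base_space K)" and g: "g \<in> linear_maps K T Q"
  shows "left_conv f g \<in> linear_maps K T Q" and "right_conv g f \<in> linear_maps K T Q"
  unfolding left_conv_def right_conv_def convolution_def
  by (rule linear_lift_arg[OF comult_Q2_linear conv_bilinear(1)[OF f g] mods(2,2,1)],
      rule linear_lift_arg[OF comult_Q2_linear conv_bilinear(2)[OF f g] mods(2,2,1)])

text \<open>The leading term of the left formula contributes \<open>f(1 \<otimes> 1) g(x \<otimes> y) = g(x \<otimes> y)\<close>, and in the
  remaining terms \<open>g\<close> is evaluated on tensors of lower degree.\<close>

lemma left_conv_congruent:
  assumes f: "f \<in> linear_maps K T (base_space K)" "f (p eQ eQ) = \<one>\<^bsub>K\<^esub>" and g: "filtered_product g"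
    and x: "x \<in> P (Suc a)" and y: "y \<in> P (Suc b)"
  shows "left_conv f g (p x y) \<ominus>\<^bsub>Q\<^esub> g (p x y) \<in> P (a + b)"
proof -
  have g': "g \<in> linear_maps K T Q" using g by (simp add: filtered_product_def)
  note b = conv_bilinear(1)[OF f(1) g']
  have z: "p x y \<in> carrier T" using x y by (intro p_closed filtration_closed)
  obtain s where s: "s \<in> tensor_span K T T (carrier T) (lower_tensors a b)"
    "comult Q2 (p x y) = pT (p eQ eQ) (p x y) \<oplus>\<^bsub>TT\<^esub> s"
    by (rule comult_Q2_left[OF x y])
  have sc: "s \<in> carrier TT"
    using s(1) tensor_span_subset[OF mods(2,2) order_refl lower_tensors_subset] by blast
  let ?r = "tensor_lift K Q (\<lambda>s t. f s \<odot>\<^bsub>Q\<^esub> g t) s"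
  have r: "?r \<in> P (a + b)"
  proof (rule lift_tensor_span[OF mods(2,2,1) b filtration_submodule order_refl lower_tensors_subset _ s(1)])
    fix t t' assume "t \<in> carrier T" "t' \<in> lower_tensors a b"
    then show "f t \<odot>\<^bsub>Q\<^esub> g t' \<in> P (a + b)"
      using linear_maps_closed[OF f(1)] filtered_product_lower[OF g]
      by (intro C.submoduleE(4)[OF filtration_submodule]) simp_all
  qed
  have gz: "g (p x y) \<in> carrier Q" by (rule linear_maps_closed[OF g' z])
  have "left_conv f g (p x y) = g (p x y) \<oplus>\<^bsub>Q\<^esub> ?r"
    unfolding left_conv_def convolution_def s(2)
    using sc z gz e_closed
    by (simp add: linear_maps_add[OF tensor_lift_linear[OF mods(2,2,1) b]] pT_closed p_closed
        tensor_lift_pure[OF mods(2,2,1) b] f(2))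
  then have "left_conv f g (p x y) \<ominus>\<^bsub>Q\<^esub> g (p x y) = ?r"
    using gz filtration_closed[OF r] by (simp add: C.minus_eq C.a_ac C.r_neg C.r_neg1 C.r_neg2)
  then show ?thesis using r by simp
qed

lemma right_conv_congruent:
  assumes f: "f \<in> linear_maps K T (base_space K)" "f (p eQ eQ) = \<one>\<^bsub>K\<^esub>" and g: "filtered_product g"
    and x: "x \<in> P (Suc a)" and y: "y \<in> P (Suc b)"
  shows "right_conv g f (p x y) \<ominus>\<^bsub>Q\<^esub> g (p x y) \<in> P (a + b)"
proof -
  have g': "g \<in> linear_maps K T Q" using g by (simp add: filtered_product_def)
  note b = conv_bilinear(2)[OF f(1) g']
  have z: "p x y \<in> carrier T" using x y by (intro p_closed filtration_closed)
  obtain s where s: "s \<in> tensor_span K T T (lower_tensors a b) (carrier T)"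
    "comult Q2 (p x y) = pT (p x y) (p eQ eQ) \<oplus>\<^bsub>TT\<^esub> s"
    by (rule comult_Q2_right[OF x y])
  have sc: "s \<in> carrier TT"
    using s(1) tensor_span_subset[OF mods(2,2) lower_tensors_subset order_refl] by blast
  let ?r = "tensor_lift K Q (\<lambda>s t. f t \<odot>\<^bsub>Q\<^esub> g s) s"
  have r: "?r \<in> P (a + b)"
  proof (rule lift_tensor_span[OF mods(2,2,1) b filtration_submodule lower_tensors_subset order_refl _ s(1)])
    fix t t' assume "t \<in> lower_tensors a b" "t' \<in> carrier T"
    then show "f t' \<odot>\<^bsub>Q\<^esub> g t \<in> P (a + b)"
      using linear_maps_closed[OF f(1)] filtered_product_lower[OF g]
      by (intro C.submoduleE(4)[OF filtration_submodule]) simp_all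
  qed
  have gz: "g (p x y) \<in> carrier Q" by (rule linear_maps_closed[OF g' z])
  have "right_conv g f (p x y) = g (p x y) \<oplus>\<^bsub>Q\<^esub> ?r"
    unfolding right_conv_def convolution_def s(2)
    using sc z gz e_closed
    by (simp add: linear_maps_add[OF tensor_lift_linear[OF mods(2,2,1) b]] pT_closed p_closed
        tensor_lift_pure[OF mods(2,2,1) b] f(2))
  then have "right_conv g f (p x y) \<ominus>\<^bsub>Q\<^esub> g (p x y) = ?r"
    using gz filtration_closed[OF r] by (simp add: C.minus_eq C.a_ac C.r_neg C.r_neg1 C.r_neg2)
  then show ?thesis using r by simp
qed

lemma filtered_product_left_conv:
  assumes f: "f \<in> linear_maps K T (base_space K)" "f (p eQ eQ) = \<one>\<^bsub>K\<^esub>" and g: "filtered_product g"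
  shows "filtered_product (left_conv f g)"
proof -
  have g': "g \<in> linear_maps K T Q" using g by (simp add: filtered_product_def)
  note l = conv_linear(1)[OF f(1) g']
  have "left_conv f g (p x y) \<in> P (Suc (a + b))" if x: "x \<in> P (Suc a)" and y: "y \<in> P (Suc b)" for a b x y
  proof -
    have z: "p x y \<in> carrier T" using x y by (intro p_closed filtration_closed)
    have "g (p x y) \<in> P (Suc (a + b))"
      using g x y unfolding filtered_product_def by simp
    then have "g (p x y) \<oplus>\<^bsub>Q\<^esub> (left_conv f g (p x y) \<ominus>\<^bsub>Q\<^esub> g (p x y)) \<in> P (Suc (a + b))"
      by (rule C.submoduleE(5)[OF filtration_submodule _
            subsetD[OF filtration_mono left_conv_congruent[OF f g x y]]])
    then show ?thesis
      using linear_maps_closed[OF l z] linear_maps_closed[OF g' z] by (simp add: C.add_minus_cancel)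
  qed
  then show ?thesis using l by (simp add: filtered_product_def)
qed

text \<open>In degree \<open>0\<close> the error term of the left formula is spanned by tensors with a zero factor, which
  every linear map kills.\<close>

lemma comult_Q2_one: "\<exists>s\<in>tensor_span K T T (carrier T) {\<zero>\<^bsub>T\<^esub>}.
    comult Q2 (p eQ eQ) = pT (p eQ eQ) (p eQ eQ) \<oplus>\<^bsub>TT\<^esub> s"
proof -
  have e: "eQ \<in> P (Suc 0)"
    unfolding filtration_pred_simps coradical_eq using e_closed
    by (intro CollectI exI[of _ "\<one>\<^bsub>K\<^esub>"]) simp
  have "p \<zero>\<^bsub>Q\<^esub> v = \<zero>\<^bsub>T\<^esub>" "p v \<zero>\<^bsub>Q\<^esub> = \<zero>\<^bsub>T\<^esub>" if "v \<in> carrier Q" for v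
    using linear_maps_zero[OF mods(1,2) p_left[OF that linear_ident]]
      linear_maps_zero[OF mods(1,2) p_right[OF that linear_ident]] by simp_all
  then have "lower_tensors 0 0 \<subseteq> {\<zero>\<^bsub>T\<^esub>}"
    using filtration_closed[of _ "Suc 0"] by (auto simp: lower_tensors_def filtration_pred_simps(1))
  then have "tensor_span K T T (carrier T) (lower_tensors 0 0)
      \<subseteq> tensor_span K T T (carrier T) {\<zero>\<^bsub>T\<^esub>}" by (rule tensor_span_mono[OF order_refl])
  then show ?thesis using comult_Q2_left[OF e e] by blast
qed

text \<open>As \<open>1 \<otimes> 1\<close> is grouplike, \<open>f(1 \<otimes> 1) g(1 \<otimes> 1) = \<epsilon>(1 \<otimes> 1) = 1\<close>.\<close>

lemma convolution_inverse_one: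
  assumes f: "f \<in> linear_maps K T (base_space K)" "f (p eQ eQ) = \<one>\<^bsub>K\<^esub>"
    and g: "g \<in> convolution_inverses K Q2 f"
  shows "g \<in> linear_maps K T (base_space K)" and "g (p eQ eQ) = \<one>\<^bsub>K\<^esub>"
proof -
  show g': "g \<in> linear_maps K T (base_space K)"
    using g by (simp add: convolution_inverses_def linear_maps_yd_coalg_tensor)
  have ee: "p eQ eQ \<in> carrier T" by (intro p_closed e_closed)
  have fc: "f t \<in> carrier K" and gc: "g t \<in> carrier K" if "t \<in> carrier T" for t
    using linear_maps_closed[OF f(1) that] linear_maps_closed[OF g' that] by simp_all
  have b: "(\<lambda>s t. f s \<otimes>\<^bsub>K\<^esub> g t) \<in> bilinear_maps K T T (base_space K)"
    using fc gc by (intro bilinear_mapsI linear_mult_left linear_mult_right K.is_cring f(1) g')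
  obtain s where s: "s \<in> tensor_span K T T (carrier T) {\<zero>\<^bsub>T\<^esub>}"
    "comult Q2 (p eQ eQ) = pT (p eQ eQ) (p eQ eQ) \<oplus>\<^bsub>TT\<^esub> s"
    using comult_Q2_one by blast
  have z: "{\<zero>\<^bsub>T\<^esub>} \<subseteq> carrier T" by simp
  have sc: "s \<in> carrier TT" using s(1) tensor_span_subset[OF mods(2,2) order_refl z] by blast
  have "tensor_lift K (base_space K) (\<lambda>s t. f s \<otimes>\<^bsub>K\<^esub> g t) s \<in> {\<zero>\<^bsub>base_space K\<^esub>}"
    by (rule lift_tensor_span[OF mods(2,2,3) b submodule_zero[OF mods(3)] order_refl z _ s(1)])
       (use linear_maps_zero[OF mods(2,3) g'] fc in simp)
  then have "scalar_convolution K Q2 f g (p eQ eQ) = g (p eQ eQ)"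
    unfolding convolution_def s(2)
    using linear_maps_add[OF tensor_lift_linear[OF mods(2,2,3) b] pT_closed[OF ee ee] sc] gc[OF ee]
    by (simp add: tensor_lift_pure[OF mods(2,2,3) b ee ee] f(2))
  moreover have "scalar_convolution K Q2 f g (p eQ eQ) = counit Q2 (p eQ eQ)"
    using g ee by (simp add: convolution_inverses_def carrier_yd_coalg_tensor)
  moreover have "counit Q2 (p eQ eQ) = \<one>\<^bsub>K\<^esub>"
  proof -
    have "(\<lambda>x y. counit Q x \<otimes>\<^bsub>K\<^esub> counit Q y) \<in> bilinear_maps K Q Q (base_space K)"
      using \<epsilon>_closed by (intro bilinear_mapsI linear_mult_left linear_mult_right K.is_cring \<epsilon>)
    then show ?thesis
      by (simp add: yd_coalg_tensor_def Let_def tensor_lift_pure[OF mods(1,1,3)] e_closed counit_e)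
  qed
  ultimately show "g (p eQ eQ) = \<one>\<^bsub>K\<^esub>" by simp
qed

text \<open>Both factors of \<open>f * m * g\<close> are normalised at \<open>1 \<otimes> 1\<close>, so each of the two convolutions changes the
  product only in lower degree.\<close>

lemma twisted_product_congruent:
  assumes f: "f \<in> linear_maps K T (base_space K)" "f (p eQ eQ) = \<one>\<^bsub>K\<^esub>"
    and g: "g \<in> convolution_inverses K Q2 f"
    and x: "x \<in> P (Suc a)" and y: "y \<in> P (Suc b)"
  shows "right_conv (left_conv f (mul Q)) g (p x y) \<in> carrier Q"
    and "right_conv (left_conv f (mul Q)) g (p x y) \<ominus>\<^bsub>Q\<^esub> mul Q (p x y) \<in> P (a + b)"
proof -
  let ?m1 = "left_conv f (mul Q)"
  let ?m2 = "right_conv ?m1 g"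
  note g' = convolution_inverse_one[OF f g]
  have z: "p x y \<in> carrier T" using x y by (intro p_closed filtration_closed)
  have m1: "filtered_product ?m1" by (rule filtered_product_left_conv[OF f filtered_product_mul])
  then have m1l: "?m1 \<in> linear_maps K T Q" by (simp add: filtered_product_def)
  have c0: "mul Q (p x y) \<in> carrier Q" by (rule linear_maps_closed[OF mul_linear z])
  have c1: "?m1 (p x y) \<in> carrier Q" by (rule linear_maps_closed[OF m1l z])
  show c2: "?m2 (p x y) \<in> carrier Q" by (rule linear_maps_closed[OF conv_linear(2)[OF g'(1) m1l] z])
  have "(?m2 (p x y) \<ominus>\<^bsub>Q\<^esub> ?m1 (p x y)) \<oplus>\<^bsub>Q\<^esub> (?m1 (p x y) \<ominus>\<^bsub>Q\<^esub> mul Q (p x y)) \<in> P (a + b)"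
    by (intro C.submoduleE(5)[OF filtration_submodule] right_conv_congruent[OF g' m1 x y]
        left_conv_congruent[OF f filtered_product_mul x y])
  then show "?m2 (p x y) \<ominus>\<^bsub>Q\<^esub> mul Q (p x y) \<in> P (a + b)"
    using c0 c1 c2 by (simp add: C.minus_eq C.a_assoc C.r_neg C.r_neg1 C.r_neg2)
qed

end

section \<open>The associated graded bialgebra of a twist\<close>

lemma direct_sum_simps:
  "f \<in> carrier (direct_sum M) \<longleftrightarrow>
    (\<forall>n. f n \<in> carrier (M n)) \<and> finite {n. f n \<noteq> \<zero>\<^bsub>M n\<^esub>}"
  "\<zero>\<^bsub>direct_sum M\<^esub> = (\<lambda>n. \<zero>\<^bsub>M n\<^esub>)"
  "f \<oplus>\<^bsub>direct_sum M\<^esub> g = (\<lambda>n. f n \<oplus>\<^bsub>M n\<^esub> g n)"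
  "a \<odot>\<^bsub>direct_sum M\<^esub> f = (\<lambda>n. a \<odot>\<^bsub>M n\<^esub> f n)"
  by (auto simp: direct_sum_def)

lemma module_direct_sum:
  assumes M: "\<And>n. module K (M n)"
  shows "module K (direct_sum M)"
proof -
  interpret M: module K "M n" for n by (rule M)
  have car: "f n \<in> carrier (M n)" if "f \<in> carrier (direct_sum M)" for f n
    using that by (simp add: direct_sum_simps(1))
  have add: "f \<oplus>\<^bsub>direct_sum M\<^esub> g \<in> carrier (direct_sum M)"
    if f: "f \<in> carrier (direct_sum M)" and g: "g \<in> carrier (direct_sum M)" for f g
  proof -
    have "{n. f n \<oplus>\<^bsub>M n\<^esub> g n \<noteq> \<zero>\<^bsub>M n\<^esub>} \<subseteq> {n. f n \<noteq> \<zero>\<^bsub>M n\<^esub>} \<union> {n. g n \<noteq> \<zero>\<^bsub>M n\<^esub>}"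
      by auto
    moreover have "finite ({n. f n \<noteq> \<zero>\<^bsub>M n\<^esub>} \<union> {n. g n \<noteq> \<zero>\<^bsub>M n\<^esub>})"
      using f g by (simp add: direct_sum_simps(1))
    ultimately have "finite {n. f n \<oplus>\<^bsub>M n\<^esub> g n \<noteq> \<zero>\<^bsub>M n\<^esub>}" by (rule finite_subset)
    then show ?thesis using f g by (simp add: direct_sum_simps(1,3))
  qed
  have smult: "a \<odot>\<^bsub>direct_sum M\<^esub> f \<in> carrier (direct_sum M)"
    if f: "f \<in> carrier (direct_sum M)" and a: "a \<in> carrier K" for f a
  proof -
    have "{n. a \<odot>\<^bsub>M n\<^esub> f n \<noteq> \<zero>\<^bsub>M n\<^esub>} \<subseteq> {n. f n \<noteq> \<zero>\<^bsub>M n\<^esub>}"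
      using a by auto
    moreover have "finite {n. f n \<noteq> \<zero>\<^bsub>M n\<^esub>}" using f by (simp add: direct_sum_simps(1))
    ultimately have "finite {n. a \<odot>\<^bsub>M n\<^esub> f n \<noteq> \<zero>\<^bsub>M n\<^esub>}" by (rule finite_subset)
    then show ?thesis using f a by (simp add: direct_sum_simps(1,4))
  qed
  have zero: "\<zero>\<^bsub>direct_sum M\<^esub> \<in> carrier (direct_sum M)"
    by (simp add: direct_sum_simps(1,2))
  have inv: "\<exists>g\<in>carrier (direct_sum M). g \<oplus>\<^bsub>direct_sum M\<^esub> f = \<zero>\<^bsub>direct_sum M\<^esub>"
    if f: "f \<in> carrier (direct_sum M)" for f
    using smult[OF f, of "\<ominus>\<^bsub>K\<^esub> \<one>\<^bsub>K\<^esub>"] car[OF f]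
    by (intro bexI[of _ "(\<ominus>\<^bsub>K\<^esub> \<one>\<^bsub>K\<^esub>) \<odot>\<^bsub>direct_sum M\<^esub> f"])
       (simp_all add: direct_sum_simps(2-4) M.smult_l_minus M.l_neg)
  have "abelian_group (direct_sum M)"
    by (rule abelian_groupI)
       (use add zero inv in \<open>auto simp: direct_sum_simps(2,3) car M.a_ac\<close>)
  then show ?thesis
    by (intro moduleI)
       (use smult in \<open>auto simp: direct_sum_simps(3,4) car M.smult_l_distr M.smult_r_distr
          M.smult_assoc1 M.is_cring\<close>)
qed

text \<open>Replacing the product and the reassociator affects neither the vector space nor the coalgebra
  structure, hence neither the coradical filtration nor any component of \<open>gr\<close> but its product.\<close>

context
  fixes K :: "('k, 'c) ring_scheme" and Q :: "('k, 'h, 'q, 'e) coquasi_bialg_scheme"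
    and \<mu> :: "('k, 'q, 'q) tens \<Rightarrow> 'q" and \<rho> :: "('k, ('k, 'q, 'q) tens, 'q) tens \<Rightarrow> 'k"
begin

abbreviation "Q_upd \<equiv> Q\<lparr>mul := \<mu>, reassoc := \<rho>\<rparr>"

lemma coset_update: "a_r_coset Q_upd = a_r_coset Q"
  by (simp add: fun_eq_iff a_r_coset_def')

lemma quotient_space_update: "quotient_space Q_upd N = quotient_space Q N"
  "quotient_space (Q_upd\<lparr>carrier := X\<rparr>) N = quotient_space (Q\<lparr>carrier := X\<rparr>) N"
  by (simp_all add: quotient_space_def A_RCOSETS_def' a_r_coset_def' set_add_def' fun_eq_iff)

lemma submodule_update: "submodule N K Q_upd = submodule N K Q"
  by (simp add: submodule_def submodule_axioms_def)

lemma pure_tensor_update: "pure_tensor K Q_upd Q_upd = pure_tensor K Q Q"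
  and tensor_update: "tensor K Q_upd Q_upd = tensor K Q Q"
  by (simp_all add: fun_eq_iff pure_tensor_def tensor_def tensor_relations_def)

lemma subtensor_update: "subtensor K Q_upd = subtensor K Q"
  by (simp add: fun_eq_iff subtensor_def pure_tensor_update tensor_update)

lemma coradical_update: "coradical K Q_upd \<Delta> = coradical K Q \<Delta>"
  by (simp add: coradical_def simple_subcoalgebra_def subcoalgebra_def submodule_update
      subtensor_update lin_span_def)

lemma coradical_filtration_update: "coradical_filtration K Q_upd \<Delta> n = coradical_filtration K Q \<Delta> n"
  by (induction n) (simp_all add: coradical_update subtensor_update tensor_update)

lemma coradical_filtration_pred_update:
  "coradical_filtration_pred K Q_upd \<Delta> = coradical_filtration_pred K Q \<Delta>"
  by (simp add: fun_eq_iff coradical_filtration_pred_def coradical_filtration_update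
      split: nat.split)

lemma gr_component_update: "gr_component K Q_upd = gr_component K Q"
  by (simp add: fun_eq_iff gr_component_def coradical_filtration_update
      coradical_filtration_pred_update quotient_space_update)

lemma gr_space_update: "gr_space K Q_upd = gr_space K Q"
  by (simp add: gr_space_def gr_component_update)

lemma gr_comult_component_update: "gr_comult_component K Q_upd = gr_comult_component K Q"
  by (simp add: fun_eq_iff gr_comult_component_def coradical_filtration_pred_update
      quotient_space_update coset_update gr_component_update)

lemma gr_coact_component_update: "gr_coact_component K H Q_upd = gr_coact_component K H Q"
  by (simp add: fun_eq_iff gr_coact_component_def coradical_filtration_pred_update
      quotient_space_update coset_update gr_component_update)

text \<open>The product of \<open>gr\<close> is undefined outside the tensor square of the graded space, so equality has to
  be checked there only.\<close>

lemma gr_update: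
  assumes "\<And>t. t \<in> carrier (tensor K (gr_space K Q) (gr_space K Q)) \<Longrightarrow>
    mul (gr K H Q_upd) t = mul (gr K H Q) t"
  shows "gr K H Q_upd = gr K H Q"
proof -
  have "mul (gr K H Q_upd) = mul (gr K H Q)"
  proof
    fix t
    show "mul (gr K H Q_upd) t = mul (gr K H Q) t"
    proof (cases "t \<in> carrier (tensor K (gr_space K Q) (gr_space K Q))")
      case True
      then show ?thesis by (rule assms)
    next
      case False
      then show ?thesis by (simp add: gr_def Let_def gr_space_update)
    qed
  qed
  moreover have "gr K H Q_upd = (gr K H Q)\<lparr>mul := mul (gr K H Q_upd)\<rparr>"
    by (simp add: gr_def Let_def gr_space_update gr_component_update gr_comult_component_update
        gr_coact_component_update coradical_filtration_pred_update coset_update)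
  ultimately show ?thesis by simp
qed

end

context connected_yd_algebra
begin

lemma gr_component_eq:
  "gr_component K Q n = quotient_space (Q\<lparr>carrier := P (Suc n)\<rparr>) (P n)"
  by (simp add: gr_component_def coradical_filtration_pred_def)

lemma module_gr_component: "module K (gr_component K Q n)"
proof -
  have m: "module K (Q\<lparr>carrier := P k\<rparr>)" for k
    by (rule submodule.submodule_is_module[OF filtration_submodule mods(1)])
  interpret S: module K "Q\<lparr>carrier := P (Suc n)\<rparr>" by (rule m)
  have "submodule (P n) K (Q\<lparr>carrier := P (Suc n)\<rparr>)"
    by (rule S.module_incl_imp_submodule) (simp_all add: filtration_mono m)
  then show ?thesis unfolding gr_component_eq by (rule module_quotient_space[OF m])
qed

lemma gr_component_subset:
  assumes X: "X \<in> carrier (gr_component K Q n)" and x: "x \<in> X"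
  shows "x \<in> P (Suc n)"
proof -
  obtain z where z: "z \<in> P (Suc n)" "X = (\<Union>h\<in>P n. {h \<oplus>\<^bsub>Q\<^esub> z})"
    using X unfolding gr_component_eq quotient_space_simps A_RCOSETS_def' a_r_coset_def' by auto
  then obtain h where "h \<in> P n" "x = h \<oplus>\<^bsub>Q\<^esub> z" using x by blast
  then show ?thesis
    using z(1) filtration_mono[of n] C.submoduleE(5)[OF filtration_submodule, of h "Suc n" z] by blast
qed

lemma module_gr_space: "module K (gr_space K Q)"
  unfolding gr_space_def by (rule module_direct_sum[OF module_gr_component])

lemma mul_gr: "mul (gr K H Q) = (\<lambda>t\<in>carrier (tensor K (gr_space K Q) (gr_space K Q)).
    tensor_lift K (gr_space K Q) (\<lambda>f g n. \<Oplus>\<^bsub>gr_component K Q n\<^esub>a\<in>{..n}.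
      (\<Union>x\<in>f a. \<Union>y\<in>g (n - a). P n +>\<^bsub>Q\<^esub> mul Q (p x y))) t)"
  by (simp add: gr_def Let_def)

text \<open>The product in \<open>gr\<close> is formed from the cosets modulo \<open>P n\<close> of products of representatives whose degrees
  add up to \<open>n\<close>; congruent products have equal cosets.\<close>

lemma gr_product_cong:
  assumes "\<And>a b x y. x \<in> P (Suc a) \<Longrightarrow> y \<in> P (Suc b) \<Longrightarrow>
      \<mu> (p x y) \<in> carrier Q \<and> \<mu> (p x y) \<ominus>\<^bsub>Q\<^esub> mul Q (p x y) \<in> P (a + b)"
    and t: "t \<in> carrier (tensor K (gr_space K Q) (gr_space K Q))"
  shows "tensor_lift K (gr_space K Q) (\<lambda>f g n. \<Oplus>\<^bsub>gr_component K Q n\<^esub>a\<in>{..n}.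
      (\<Union>x\<in>f a. \<Union>y\<in>g (n - a). P n +>\<^bsub>Q\<^esub> \<mu> (p x y))) t = mul (gr K H Q) t"
  unfolding mul_gr restrict_apply' [OF t]
proof (rule tensor_lift_cong[OF module_gr_space module_gr_space t], intro ext finsum_cong_everywhere)
  fix f g :: "nat \<Rightarrow> 'q set" and n a :: nat
  assume f: "f \<in> carrier (gr_space K Q)" and g: "g \<in> carrier (gr_space K Q)" and a: "a \<in> {..n}"
  have "P n +>\<^bsub>Q\<^esub> \<mu> (p x y) = P n +>\<^bsub>Q\<^esub> mul Q (p x y)" if x: "x \<in> f a" and y: "y \<in> g (n - a)" for x y
  proof -
    have x': "x \<in> P (Suc a)" and y': "y \<in> P (Suc (n - a))"
      using f g by (auto simp: gr_space_def direct_sum_simps(1)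
          intro: gr_component_subset[OF _ x] gr_component_subset[OF _ y])
    have "mul Q (p x y) \<in> carrier Q"
      by (rule filtration_closed[OF mul_filtration[OF x' y']])
    then show ?thesis
      using assms(1)[OF x' y'] a by (simp add: coset_eq_iff[OF mods(1) filtration_submodule])
  qed
  then show "(\<Union>x\<in>f a. \<Union>y\<in>g (n - a). P n +>\<^bsub>Q\<^esub> \<mu> (p x y))
      = (\<Union>x\<in>f a. \<Union>y\<in>g (n - a). P n +>\<^bsub>Q\<^esub> mul Q (p x y))" by simp
qed

end

lemma coquasi_bialgebra_connected_yd_algebra:
  assumes "hopf_algebra K H" "coquasi_bialgebra K H Q" "connected_bialg K Q"
  shows "connected_yd_algebra K H Q"
proof
  have *: "yd_coalgebra K H Q" "mul Q \<in> yd_coalg_hom K H (tpower2 K H Q) Q"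
    "uni Q \<in> yd_coalg_hom K H (yd_unit K H) Q"
    "\<And>x. x \<in> carrier Q \<Longrightarrow> mul Q (pure_tensor K Q Q (one_of K Q) x) = x"
    using assms(2) by (simp_all add: coquasi_bialgebra_def Let_def)
  show "hopf_algebra K H" "yd_coalgebra K H Q" "mul Q \<in> yd_coalg_hom K H (tpower2 K H Q) Q"
    "uni Q \<in> yd_coalg_hom K H (yd_unit K H) Q" "connected_bialg K Q"
    by (fact assms * )+
  interpret K: field K using *(1) by (simp add: yd_coalgebra_def coalgebra_def)
  have "one_of K Q \<in> carrier Q"
    using *(3) K.one_closed
    by (auto simp: yd_coalg_hom_def yd_hom_def linear_maps_def yd_unit_def)
  then show "mul Q (pure_tensor K Q Q (one_of K Q) (one_of K Q)) = one_of K Q" by (rule *(4))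
qed

theorem proposition2p6:
  fixes K :: "('k, 'c) ring_scheme"
    and H :: "('k, 'h, 'd) hopf_scheme"
    and Q :: "('k, 'h, 'q, 'e) coquasi_bialg_scheme"
    and \<gamma> :: "('k, 'q, 'q) tens \<Rightarrow> 'k"
  assumes "field K"
    and "hopf_algebra K H"
    and "coquasi_bialgebra K H Q"
    and "connected_bialg K Q"
    and "gauge_transformation K H Q \<gamma>"
  shows "gr K H (gauge_twist K H Q \<gamma>) = gr K H Q"
proof -
  interpret connected_yd_algebra K H Q
    by (rule coquasi_bialgebra_connected_yd_algebra[OF assms(2-4)])
  define \<delta> where "\<delta> = convolution_inverse K Q2 \<gamma>"
  define \<mu> where "\<mu> = right_conv (left_conv \<gamma> (mul Q)) \<delta>"
  obtain \<rho> where twist: "gauge_twist K H Q \<gamma> = Q\<lparr>mul := \<mu>, reassoc := \<rho>\<rparr>"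
    by (simp add: gauge_twist_def Let_def \<mu>_def \<delta>_def left_conv_def right_conv_def)
  have \<gamma>: "\<gamma> \<in> linear_maps K T (base_space K)" "\<gamma> (p eQ eQ) = \<one>\<^bsub>K\<^esub>"
    "convolution_inverses K Q2 \<gamma> \<noteq> {}"
    using assms(5) e_closed
    by (auto simp: gauge_transformation_def yd_hom_def linear_maps_yd_coalg_tensor
        linear_maps_yd_unit counit_e)
  have \<delta>: "\<delta> \<in> convolution_inverses K Q2 \<gamma>"
    using \<gamma>(3) unfolding \<delta>_def convolution_inverse_def by (simp add: some_in_eq)
  have cong: "\<mu> (p x y) \<in> carrier Q \<and> \<mu> (p x y) \<ominus>\<^bsub>Q\<^esub> mul Q (p x y) \<in> P (a + b)"
    if "x \<in> P (Suc a)" "y \<in> P (Suc b)" for a b x y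
    using twisted_product_congruent[OF \<gamma>(1,2) \<delta> that] unfolding \<mu>_def by blast
  show ?thesis
    unfolding twist
  proof (rule gr_update)
    fix t assume t: "t \<in> carrier (tensor K (gr_space K Q) (gr_space K Q))"
    have "mul (gr K H (Q\<lparr>mul := \<mu>, reassoc := \<rho>\<rparr>)) t
      = tensor_lift K (gr_space K Q) (\<lambda>f g n. \<Oplus>\<^bsub>gr_component K Q n\<^esub>a\<in>{..n}.
          (\<Union>x\<in>f a. \<Union>y\<in>g (n - a). P n +>\<^bsub>Q\<^esub> \<mu> (p x y))) t"
      using t by (simp add: gr_def Let_def gr_space_update gr_component_update
          coradical_filtration_pred_update coset_update pure_tensor_update)
    also have "\<dots> = mul (gr K H Q) t" by (rule gr_product_cong[OF cong t])
    finally show "mul (gr K H (Q\<lparr>mul := \<mu>, reassoc := \<rho>\<rparr>)) t = mul (gr K H Q) t" .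
  qed
qed

end
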